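(* Let $T$ be a complete $\omega$-categorical theory in a countable language with soft elimination of imaginaries, and let $\mathcal{M}$ be its $\kappa$-saturated model as in the context. If the exchange property with respect to $0$ holds, then $T$ is superrosy with finite $U^{\text{þ}}$-rank.
   Context: Standing setting: $\mathcal{M}\models T$ is $\kappa$-saturated for some large infinite cardinal $\kappa$, universe $M$; $\mathcal{M}^{\mathrm{eq}}$ is the expansion by imaginaries with universe $M^{\mathrm{eq}}$; $\mathrm{acl}^{\mathrm{eq}}$ is algebraic closure in $\mathcal{M}^{\mathrm{eq}}$; subsets considered have size $<\kappa$. $T$ has soft elimination of imaginaries if for every $a\in M^{\mathrm{eq}}$ there is a finite tuple $\bar b$ of elements of $M$ with $\mathrm{acl}^{\mathrm{eq}}(a)=\mathrm{acl}^{\mathrm{eq}}(\bar b)$. For $A\subseteq M^{\mathrm{eq}}$ let $\mathrm{acl}^0(A)=\mathrm{acl}^{\mathrm{eq}}(A)\cap M$. $0$-rank: $\mathrm{rk}^0(A/B)\ge 0$ always; $\mathrm{rk}^0(A/B)\ge\alpha+1$ iff there is $a\in\mathrm{acl}^0(A)\setminus\mathrm{acl}^0(B)$ with $\mathrm{rk}^0(A/\{a\}\cup B)\ge\alpha$; limit stages by intersection; $\mathrm{rk}^0(A/B)=\alpha$ iff $\ge\alpha$ and not $\ge\alpha+1$; $\mathrm{rk}^0(a/C)=\mathrm{rk}^0(\{a\}/C)$. Exchange property with respect to $0$: whenever $C\subseteq M^{\mathrm{eq}}$, $2\le k<\omega$, $a_1,\dots,a_k\in M$, $\mathrm{rk}^0(a_i/C)=1$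 for all $i$, and $a_k\in\mathrm{acl}^{\mathrm{eq}}(\{a_1,\dots,a_{k-1}\}\cup C)\setminus\mathrm{acl}^{\mathrm{eq}}(\{a_2,\dots,a_{k-1}\}\cup C)$, then $a_1\in\mathrm{acl}^{\mathrm{eq}}(\{a_2,\dots,a_k\}\cup C)$. Superrosy and $U^{\text{þ}}$-rank are in the sense of Onshuus and Ealy–Onshuus. *)

theory Defs
  imports Main "HOL-Library.Countable_Set"
begin

unbundle cardinal_syntax

section \<open>First-order logic\<close>

record ('f, 'r) lang =
  funs :: "'f set"
  rels :: "'r set"
  farity :: "'f \<Rightarrow> nat"
  rarity :: "'r \<Rightarrow> nat"

record ('f, 'r, 'a) struct =
  univ :: "'a set"
  funI :: "'f \<Rightarrow> 'a list \<Rightarrow> 'a"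
  relI :: "'r \<Rightarrow> 'a list \<Rightarrow> bool"

datatype 'f tm = Var nat | App 'f "'f tm list"

datatype ('f, 'r) fm =
    Eq "'f tm" "'f tm"
  | Rel 'r "'f tm list"
  | Neg "('f, 'r) fm"
  | Conj "('f, 'r) fm" "('f, 'r) fm"
  | Exists nat "('f, 'r) fm"

fun tvars :: "'f tm \<Rightarrow> nat set" where
  "tvars (Var i) = {i}"
| "tvars (App f ts) = (\<Union>t\<in>set ts. tvars t)"

fun wf_tm :: "('f, 'r) lang \<Rightarrow> 'f tm \<Rightarrow> bool" where
  "wf_tm L (Var i) \<longleftrightarrow> True"
| "wf_tm L (App f ts) \<longleftrightarrow>
     f \<in> funs L \<and> length ts = farity L f \<and> (\<forall>t\<in>set ts. wf_tm L t)"

fun eval_tm :: "('f, 'r, 'a) struct \<Rightarrow> (nat \<Rightarrow> 'a) \<Rightarrow> 'f tm \<Rightarrow> 'a" where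
  "eval_tm M v (Var i) = v i"
| "eval_tm M v (App f ts) = funI M f (map (eval_tm M v) ts)"

primrec fv :: "('f, 'r) fm \<Rightarrow> nat set" where
  "fv (Eq s t) = tvars s \<union> tvars t"
| "fv (Rel R ts) = (\<Union>t\<in>set ts. tvars t)"
| "fv (Neg \<phi>) = fv \<phi>"
| "fv (Conj \<phi> \<psi>) = fv \<phi> \<union> fv \<psi>"
| "fv (Exists i \<phi>) = fv \<phi> - {i}"

primrec wf_fm :: "('f, 'r) lang \<Rightarrow> ('f, 'r) fm \<Rightarrow> bool" where
  "wf_fm L (Eq s t) \<longleftrightarrow> wf_tm L s \<and> wf_tm L t"
| "wf_fm L (Rel R ts) \<longleftrightarrow>
     R \<in> rels L \<and> length ts = rarity L R \<and> (\<forall>t\<in>set ts. wf_tm L t)"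
| "wf_fm L (Neg \<phi>) \<longleftrightarrow> wf_fm L \<phi>"
| "wf_fm L (Conj \<phi> \<psi>) \<longleftrightarrow> wf_fm L \<phi> \<and> wf_fm L \<psi>"
| "wf_fm L (Exists i \<phi>) \<longleftrightarrow> wf_fm L \<phi>"

primrec sat :: "('f, 'r, 'a) struct \<Rightarrow> (nat \<Rightarrow> 'a) \<Rightarrow> ('f, 'r) fm \<Rightarrow> bool" where
  "sat M v (Eq s t) \<longleftrightarrow> eval_tm M v s = eval_tm M v t"
| "sat M v (Rel R ts) \<longleftrightarrow> relI M R (map (eval_tm M v) ts)"
| "sat M v (Neg \<phi>) \<longleftrightarrow> \<not> sat M v \<phi>"
| "sat M v (Conj \<phi> \<psi>) \<longleftrightarrow> sat M v \<phi> \<and> sat M v \<psi>"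
| "sat M v (Exists i \<phi>) \<longleftrightarrow> (\<exists>a\<in>univ M. sat M (v(i := a)) \<phi>)"

definition is_struct :: "('f, 'r) lang \<Rightarrow> ('f, 'r, 'a) struct \<Rightarrow> bool" where
  "is_struct L M \<longleftrightarrow> univ M \<noteq> {} \<and>
     (\<forall>f\<in>funs L. \<forall>as. set as \<subseteq> univ M \<and> length as = farity L f \<longrightarrow> funI M f as \<in> univ M)"

definition tuples :: "('f, 'r, 'a) struct \<Rightarrow> nat \<Rightarrow> 'a list set" where
  "tuples M n = {as. set as \<subseteq> univ M \<and> length as = n}"

definition form :: "('f, 'r) lang \<Rightarrow> nat \<Rightarrow> ('f, 'r) fm \<Rightarrow> bool" where
  "form L n \<phi> \<longleftrightarrow> wf_fm L \<phi> \<and> fv \<phi> \<subseteq> {..<n}"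

text \<open>
  Only used for \<^term>\<open>form L (length as) \<phi>\<close>, so the entries of \<^term>\<open>as\<close> determine the value.
  A formula with parameters, with object variables \<open>x\<close> and parameters \<open>d\<close>, is a formula
  evaluated at the concatenation \<^term>\<open>x @ d\<close>.
\<close>
definition holds :: "('f, 'r, 'a) struct \<Rightarrow> ('f, 'r) fm \<Rightarrow> 'a list \<Rightarrow> bool" where
  "holds M \<phi> as \<longleftrightarrow> sat M (\<lambda>i. as ! i) \<phi>"

definition sol :: "('f, 'r, 'a) struct \<Rightarrow> nat \<Rightarrow> ('f, 'r) fm \<Rightarrow> 'a list \<Rightarrow> 'a list set" where
  "sol M n \<phi> ds = {xs \<in> tuples M n. holds M \<phi> (xs @ ds)}"

definition models :: "('f, 'r) lang \<Rightarrow> ('f, 'r, 'a) struct \<Rightarrow> ('f, 'r) fm set \<Rightarrow> bool" where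
  "models L M T \<longleftrightarrow> is_struct L M \<and> (\<forall>\<phi>\<in>T. holds M \<phi> [])"

definition isomorphic ::
  "('f, 'r) lang \<Rightarrow> ('f, 'r, 'a) struct \<Rightarrow> ('f, 'r, 'b) struct \<Rightarrow> bool" where
  "isomorphic L M N \<longleftrightarrow> (\<exists>h. bij_betw h (univ M) (univ N) \<and>
     (\<forall>f\<in>funs L. \<forall>as\<in>tuples M (farity L f). h (funI M f as) = funI N f (map h as)) \<and>
     (\<forall>R\<in>rels L. \<forall>as\<in>tuples M (rarity L R). relI M R as \<longleftrightarrow> relI N R (map h as)))"

definition countable_lang :: "('f, 'r) lang \<Rightarrow> bool" where
  "countable_lang L \<longleftrightarrow> countable (funs L) \<and> countable (rels L)"

text \<open>
  In a countable language, \<open>T\<close> entails a sentence iff the sentence holds in every countable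
  model of \<open>T\<close> (downward Loewenheim-Skolem), and every countable structure is isomorphic to one
  whose universe is a set of natural numbers. So models in the type \<^typ>\<open>nat\<close> suffice here.
\<close>
definition entails :: "('f, 'r) lang \<Rightarrow> ('f, 'r) fm set \<Rightarrow> ('f, 'r) fm \<Rightarrow> bool" where
  "entails L T \<phi> \<longleftrightarrow>
     (\<forall>N :: ('f, 'r, nat) struct. models L N T \<longrightarrow> holds N \<phi> [])"

definition complete_theory :: "('f, 'r) lang \<Rightarrow> ('f, 'r) fm set \<Rightarrow> bool" where
  "complete_theory L T \<longleftrightarrow> (\<forall>\<phi>\<in>T. form L 0 \<phi>) \<and>
     (\<exists>N :: ('f, 'r, nat) struct. models L N T) \<and>
     (\<forall>\<phi>. form L 0 \<phi> \<longrightarrow> entails L T \<phi> \<or> entails L T (Neg \<phi>))"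

definition omega_categorical :: "('f, 'r) lang \<Rightarrow> ('f, 'r) fm set \<Rightarrow> bool" where
  "omega_categorical L T \<longleftrightarrow>
     (\<exists>N :: ('f, 'r, nat) struct. models L N T \<and> infinite (univ N)) \<and>
     (\<forall>(N :: ('f, 'r, nat) struct) (N' :: ('f, 'r, nat) struct).
        models L N T \<and> infinite (univ N) \<and> models L N' T \<and> infinite (univ N') \<longrightarrow>
        isomorphic L N N')"

definition small :: "'k rel \<Rightarrow> ('f, 'r, 'a) struct \<Rightarrow> 'a set \<Rightarrow> bool" where
  "small \<kappa> M A \<longleftrightarrow> A \<subseteq> univ M \<and> |A| <o \<kappa>"

definition saturated :: "'k rel \<Rightarrow> ('f, 'r) lang \<Rightarrow> ('f, 'r, 'a) struct \<Rightarrow> bool" where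
  "saturated \<kappa> L M \<longleftrightarrow> (\<forall>A. small \<kappa> M A \<longrightarrow>
     (\<forall>\<Phi>. (\<forall>(\<phi>, cs)\<in>\<Phi>. set cs \<subseteq> A \<and> form L (Suc (length cs)) \<phi>) \<and>
          (\<forall>\<Phi>'. finite \<Phi>' \<and> \<Phi>' \<subseteq> \<Phi> \<longrightarrow> (\<exists>a\<in>univ M. \<forall>(\<phi>, cs)\<in>\<Phi>'. holds M \<phi> (a # cs)))
        \<longrightarrow> (\<exists>a\<in>univ M. \<forall>(\<phi>, cs)\<in>\<Phi>. holds M \<phi> (a # cs))))"

definition acl :: "('f, 'r) lang \<Rightarrow> ('f, 'r, 'a) struct \<Rightarrow> 'a set \<Rightarrow> 'a set" where
  "acl L M A = {a \<in> univ M. \<exists>\<phi> cs. set cs \<subseteq> A \<and> form L (Suc (length cs)) \<phi> \<and>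
     holds M \<phi> (a # cs) \<and> finite {b \<in> univ M. holds M \<phi> (b # cs)}}"

text \<open>The tuples \<open>as\<close> and \<open>bs\<close> have the same complete type over \<open>A\<close>.\<close>
definition same_type ::
  "('f, 'r) lang \<Rightarrow> ('f, 'r, 'a) struct \<Rightarrow> 'a set \<Rightarrow> 'a list \<Rightarrow> 'a list \<Rightarrow> bool" where
  "same_type L M A as bs \<longleftrightarrow> length as = length bs \<and>
     (\<forall>\<phi> cs. set cs \<subseteq> A \<and> form L (length as + length cs) \<phi> \<longrightarrow>
        holds M \<phi> (as @ cs) = holds M \<phi> (bs @ cs))"

section \<open>Imaginaries\<close>

text \<open>
  An imaginary is a pair of a parameter-free definable equivalence relation \<open>E\<close> on \<open>n\<close>-tuples,
  \<open>n > 0\<close>, and an \<open>E\<close>-class. The first component makes the sorts disjoint. The expansion by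
  imaginaries is a one-sorted structure with a unary predicate for each sort; its language is
  relational, function symbols of the original language being replaced by their graphs.
\<close>
type_synonym 'a imag = "('a list \<times> 'a list) set \<times> 'a list set"

definition def_equiv ::
  "('f, 'r) lang \<Rightarrow> ('f, 'r, 'a) struct \<Rightarrow> nat \<Rightarrow> ('a list \<times> 'a list) set \<Rightarrow> bool" where
  "def_equiv L M n E \<longleftrightarrow> 0 < n \<and> equiv (tuples M n) E \<and>
     (\<exists>\<phi>. form L (n + n) \<phi> \<and>
        E = {(as, bs). as \<in> tuples M n \<and> bs \<in> tuples M n \<and> holds M \<phi> (as @ bs)})"

text \<open>The element \<open>a\<close> of \<open>M\<close> is identified with its class under equality on 1-tuples.\<close>
definition real_elem :: "('f, 'r, 'a) struct \<Rightarrow> 'a \<Rightarrow> 'a imag" where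
  "real_elem M a = (Id_on (tuples M 1), {[a]})"

definition home :: "('f, 'r, 'a) struct \<Rightarrow> 'a imag set" where
  "home M = real_elem M ` univ M"

datatype ('f, 'r, 'a) eqsym =
    Base 'r
  | Graph 'f
  | Sort "('a list \<times> 'a list) set"
  | Proj "('a list \<times> 'a list) set"

definition eq_lang ::
  "('f, 'r) lang \<Rightarrow> ('f, 'r, 'a) struct \<Rightarrow> ('f, ('f, 'r, 'a) eqsym) lang" where
  "eq_lang L M = \<lparr>
     funs = {},
     rels = Base ` rels L \<union> Graph ` funs L \<union>
            Sort ` {E. \<exists>n. def_equiv L M n E} \<union> Proj ` {E. \<exists>n. def_equiv L M n E},
     farity = (\<lambda>_. 0),
     rarity = (\<lambda>s. case s of
         Base R \<Rightarrow> rarity L R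
       | Graph f \<Rightarrow> Suc (farity L f)
       | Sort E \<Rightarrow> 1
       | Proj E \<Rightarrow> Suc (THE n. def_equiv L M n E))\<rparr>"

definition eq_struct ::
  "('f, 'r) lang \<Rightarrow> ('f, 'r, 'a) struct \<Rightarrow> ('f, ('f, 'r, 'a) eqsym, 'a imag) struct" where
  "eq_struct L M = \<lparr>
     univ = {(E, X). \<exists>n. def_equiv L M n E \<and> X \<in> tuples M n // E},
     funI = (\<lambda>_ _. undefined),
     relI = (\<lambda>s xs. case s of
         Base R \<Rightarrow> (\<exists>as\<in>tuples M (rarity L R). xs = map (real_elem M) as \<and> relI M R as)
       | Graph f \<Rightarrow> (\<exists>as\<in>tuples M (farity L f). xs = map (real_elem M) (as @ [funI M f as]))
       | Sort E \<Rightarrow> (\<exists>X. xs = [(E, X)])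
       | Proj E \<Rightarrow> (\<exists>n. \<exists>as\<in>tuples M n. def_equiv L M n E \<and>
                      xs = map (real_elem M) as @ [(E, E `` {as})]))\<rparr>"

definition acl_eq :: "('f, 'r) lang \<Rightarrow> ('f, 'r, 'a) struct \<Rightarrow> 'a imag set \<Rightarrow> 'a imag set" where
  "acl_eq L M A = acl (eq_lang L M) (eq_struct L M) A"

definition acl0 :: "('f, 'r) lang \<Rightarrow> ('f, 'r, 'a) struct \<Rightarrow> 'a imag set \<Rightarrow> 'a imag set" where
  "acl0 L M A = acl_eq L M A \<inter> home M"

definition soft_elim_imag :: "('f, 'r) lang \<Rightarrow> ('f, 'r, 'a) struct \<Rightarrow> bool" where
  "soft_elim_imag L M \<longleftrightarrow> (\<forall>a\<in>univ (eq_struct L M).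
     \<exists>bs. set bs \<subseteq> home M \<and> acl_eq L M {a} = acl_eq L M (set bs))"

section \<open>Ordinal-valued ranks and the 0-rank\<close>

text \<open>Ordinals are represented as elements of well-orders; \<open>\<alpha>\<close> is the successor of \<open>\<beta>\<close> in \<open>r\<close>.\<close>
definition succ_in :: "'o rel \<Rightarrow> 'o \<Rightarrow> 'o \<Rightarrow> bool" where
  "succ_in r \<beta> \<alpha> \<longleftrightarrow> (\<beta>, \<alpha>) \<in> r - Id \<and> (\<nexists>\<gamma>. (\<beta>, \<gamma>) \<in> r - Id \<and> (\<gamma>, \<alpha>) \<in> r - Id)"

text \<open>
  \<open>rank_ge r step \<alpha> x\<close> says that the rank of \<open>x\<close> is at least \<open>\<alpha>\<close>, where rank at least \<open>0\<close> always
  holds, rank at least \<open>\<beta> + 1\<close> means that \<open>step x y\<close> for some \<open>y\<close> of rank at least \<open>\<beta>\<close>, and limit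
  stages are intersections. The recursion equation is \<open>rank_ge_unfold\<close>.
\<close>
definition rank_ge :: "'o rel \<Rightarrow> ('x \<Rightarrow> 'x \<Rightarrow> bool) \<Rightarrow> 'o \<Rightarrow> 'x \<Rightarrow> bool" where
  "rank_ge r step = wfrec (r - Id) (\<lambda>ge \<alpha> x.
     (\<forall>\<beta>. succ_in r \<beta> \<alpha> \<longrightarrow> (\<exists>y. step x y \<and> ge \<beta> y)) \<and>
     ((\<nexists>\<beta>. succ_in r \<beta> \<alpha>) \<longrightarrow> (\<forall>\<beta>. (\<beta>, \<alpha>) \<in> r - Id \<longrightarrow> ge \<beta> x)))"

lemma rank_ge_unfold:
  fixes r :: "'o rel" and step :: "'x \<Rightarrow> 'x \<Rightarrow> bool"
  assumes "Well_order r"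
  shows "rank_ge r step \<alpha> x \<longleftrightarrow>
     (\<forall>\<beta>. succ_in r \<beta> \<alpha> \<longrightarrow> (\<exists>y. step x y \<and> rank_ge r step \<beta> y)) \<and>
     ((\<nexists>\<beta>. succ_in r \<beta> \<alpha>) \<longrightarrow> (\<forall>\<beta>. (\<beta>, \<alpha>) \<in> r - Id \<longrightarrow> rank_ge r step \<beta> x))"
proof -
  have wf: "wf (r - Id)"
    using assms by (simp add: well_order_on_def)
  have c: "succ_in r \<beta> \<alpha> \<Longrightarrow> cut h (r - Id) \<alpha> \<beta> = h \<beta>"
    "(\<beta>, \<alpha>) \<in> r - Id \<Longrightarrow> cut h (r - Id) \<alpha> \<beta> = h \<beta>"
    for \<beta> and h :: "'o \<Rightarrow> 'x \<Rightarrow> bool"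
    by (simp_all add: cut_def succ_in_def)
  show ?thesis
    unfolding rank_ge_def
    by (subst wfrec[OF wf]) (simp only: c cong: conj_cong imp_cong)
qed

lemma rank_ge_natLeq_0: "rank_ge natLeq step 0 x"
  by (subst rank_ge_unfold[OF natLeq_Well_order]) (auto simp: succ_in_def natLeq_def)

lemma rank_ge_natLeq_Suc:
  "rank_ge natLeq step (Suc n) x \<longleftrightarrow> (\<exists>y. step x y \<and> rank_ge natLeq step n y)"
proof -
  have "succ_in natLeq b (Suc n) \<longleftrightarrow> b = n" for b
  proof
    assume h: "succ_in natLeq b (Suc n)"
    show "b = n"
    proof (rule ccontr)
      assume "b \<noteq> n"
      then have "(b, n) \<in> natLeq - Id" "(n, Suc n) \<in> natLeq - Id"
        using h by (auto simp: succ_in_def natLeq_def)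
      then show False using h unfolding succ_in_def by blast
    qed
  qed (auto simp: succ_in_def natLeq_def)
  then show ?thesis
    by (subst rank_ge_unfold[OF natLeq_Well_order]) auto
qed

definition rk0_step ::
  "('f, 'r) lang \<Rightarrow> ('f, 'r, 'a) struct \<Rightarrow>
   'a imag set \<times> 'a imag set \<Rightarrow> 'a imag set \<times> 'a imag set \<Rightarrow> bool" where
  "rk0_step L M p q \<longleftrightarrow>
     (\<exists>A B a. p = (A, B) \<and> a \<in> acl0 L M A - acl0 L M B \<and> q = (A, insert a B))"

text \<open>\<open>rk0_ge L M r \<alpha> A B\<close>: the 0-rank of \<open>A\<close> over \<open>B\<close> is at least \<open>\<alpha>\<close>.\<close>
definition rk0_ge ::
  "('f, 'r) lang \<Rightarrow> ('f, 'r, 'a) struct \<Rightarrow> 'o rel \<Rightarrow> 'o \<Rightarrow>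
   'a imag set \<Rightarrow> 'a imag set \<Rightarrow> bool" where
  "rk0_ge L M r \<alpha> A B \<longleftrightarrow> rank_ge r (rk0_step L M) \<alpha> (A, B)"

definition rk0_eq ::
  "('f, 'r) lang \<Rightarrow> ('f, 'r, 'a) struct \<Rightarrow> nat \<Rightarrow> 'a imag set \<Rightarrow> 'a imag set \<Rightarrow> bool" where
  "rk0_eq L M n A B \<longleftrightarrow> rk0_ge L M natLeq n A B \<and> \<not> rk0_ge L M natLeq (n + 1) A B"

definition exchange0 :: "'k rel \<Rightarrow> ('f, 'r) lang \<Rightarrow> ('f, 'r, 'a) struct \<Rightarrow> bool" where
  "exchange0 \<kappa> L M \<longleftrightarrow> (\<forall>C (k::nat) a.
     small \<kappa> (eq_struct L M) C \<and> 2 \<le> k \<and>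
     (\<forall>i\<in>{1..k}. a i \<in> home M \<and> rk0_eq L M 1 {a i} C) \<and>
     a k \<in> acl_eq L M (a ` {1..k - 1} \<union> C) - acl_eq L M (a ` {2..k - 1} \<union> C)
     \<longrightarrow> a 1 \<in> acl_eq L M (a ` {2..k} \<union> C))"

section \<open>Thorn-forking, rosiness and the thorn U-rank\<close>

text \<open>
  The definitions are for an arbitrary structure \<open>S\<close>; they are applied to the expansion by
  imaginaries. In \<open>k_inconsistent S n \<delta> k B\<close> the family \<open>\<delta>(x, b)\<close>, for \<open>b\<close> in \<open>B\<close>, is indexed by
  its parameters and \<open>x\<close> is an \<open>n\<close>-tuple.
\<close>
definition k_inconsistent ::
  "('f, 'r, 'a) struct \<Rightarrow> nat \<Rightarrow> ('f, 'r) fm \<Rightarrow> nat \<Rightarrow> 'a list set \<Rightarrow> bool" where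
  "k_inconsistent S n \<delta> k B \<longleftrightarrow>
     (\<forall>B'\<subseteq>B. finite B' \<and> card B' = k \<longrightarrow> \<not> (\<exists>xs\<in>tuples S n. \<forall>b\<in>B'. holds S \<delta> (xs @ b)))"

definition strongly_divides ::
  "('f, 'r) lang \<Rightarrow> ('f, 'r, 'a) struct \<Rightarrow> nat \<Rightarrow> ('f, 'r) fm \<Rightarrow> 'a list \<Rightarrow> 'a set \<Rightarrow> bool" where
  "strongly_divides L S n \<delta> a A \<longleftrightarrow>
     (let R = {a' \<in> tuples S (length a). same_type L S A a a'}
      in infinite R \<and> (\<exists>k. k_inconsistent S n \<delta> k R))"

definition thorn_divides ::
  "('f, 'r) lang \<Rightarrow> ('f, 'r, 'a) struct \<Rightarrow> nat \<Rightarrow> ('f, 'r) fm \<Rightarrow> 'a list \<Rightarrow> 'a set \<Rightarrow> bool" where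
  "thorn_divides L S n \<delta> a A \<longleftrightarrow>
     (\<exists>cs. set cs \<subseteq> univ S \<and> strongly_divides L S n \<delta> a (A \<union> set cs))"

definition thorn_forks ::
  "('f, 'r) lang \<Rightarrow> ('f, 'r, 'a) struct \<Rightarrow> nat \<Rightarrow> ('f, 'r) fm \<Rightarrow> 'a list \<Rightarrow> 'a set \<Rightarrow> bool" where
  "thorn_forks L S n \<chi> d A \<longleftrightarrow>
     (\<exists>D. finite D \<and>
        (\<forall>(\<delta>, a)\<in>D. set a \<subseteq> univ S \<and> form L (n + length a) \<delta> \<and> thorn_divides L S n \<delta> a A) \<and>
        sol S n \<chi> d \<subseteq> (\<Union>(\<delta>, a)\<in>D. sol S n \<delta> a))"

text \<open>The complete type of the tuple \<open>bs\<close> over \<open>B\<close> thorn-forks over \<open>A\<close>.\<close>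
definition type_thorn_forks ::
  "('f, 'r) lang \<Rightarrow> ('f, 'r, 'a) struct \<Rightarrow> 'a list \<Rightarrow> 'a set \<Rightarrow> 'a set \<Rightarrow> bool" where
  "type_thorn_forks L S bs B A \<longleftrightarrow>
     (\<exists>\<chi> ds. set ds \<subseteq> B \<and> form L (length bs + length ds) \<chi> \<and> holds S \<chi> (bs @ ds) \<and>
        thorn_forks L S (length bs) \<chi> ds A)"

text \<open>
  Complete types over small sets are represented as pairs of a realisation and the set of
  parameters. So \<open>(bs, B)\<close> is a thorn-forking extension of \<open>(as, A)\<close> if \<open>bs\<close> realises the type of
  \<open>as\<close> over \<open>A\<close>, \<open>B\<close> contains \<open>A\<close>, and the type of \<open>bs\<close> over \<open>B\<close> thorn-forks over \<open>A\<close>.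
\<close>
definition thorn_ext ::
  "'k rel \<Rightarrow> ('f, 'r) lang \<Rightarrow> ('f, 'r, 'a) struct \<Rightarrow>
   'a list \<times> 'a set \<Rightarrow> 'a list \<times> 'a set \<Rightarrow> bool" where
  "thorn_ext \<kappa> L S p q \<longleftrightarrow>
     (\<exists>as A bs B. p = (as, A) \<and> q = (bs, B) \<and>
        A \<subseteq> B \<and> small \<kappa> S B \<and> bs \<in> tuples S (length as) \<and>
        same_type L S A as bs \<and> type_thorn_forks L S bs B A)"

definition U_thorn_ge ::
  "'k rel \<Rightarrow> ('f, 'r) lang \<Rightarrow> ('f, 'r, 'a) struct \<Rightarrow> 'o rel \<Rightarrow> 'o \<Rightarrow> 'a list \<Rightarrow> 'a set \<Rightarrow> bool" where
  "U_thorn_ge \<kappa> L S r \<alpha> as A \<longleftrightarrow> rank_ge r (thorn_ext \<kappa> L S) \<alpha> (as, A)"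

text \<open>
  Onshuus' local thorn rank of a formula in \<open>n\<close> variables, represented by its solution set \<open>X\<close>, with
  respect to formulas \<open>\<delta>(x; y)\<close> in \<open>\<Delta>\<close> and \<open>\<pi>(y; z)\<close> in \<open>\<Pi>\<close>, where \<open>y\<close> and \<open>z\<close> have lengths \<open>m\<close> and \<open>l\<close>.
  Rosiness says that these ranks are below \<open>\<omega>\<close>, so only finite stages are needed.
\<close>
primrec local_thorn_ge ::
  "('f, 'r, 'a) struct \<Rightarrow> nat \<Rightarrow> nat \<Rightarrow> nat \<Rightarrow> ('f, 'r) fm set \<Rightarrow> ('f, 'r) fm set \<Rightarrow> nat \<Rightarrow>
   nat \<Rightarrow> 'a list set \<Rightarrow> bool" where
  "local_thorn_ge S n m l \<Delta> \<Pi> k 0 X \<longleftrightarrow> X \<noteq> {}"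
| "local_thorn_ge S n m l \<Delta> \<Pi> k (Suc \<alpha>) X \<longleftrightarrow>
     (\<exists>\<delta>\<in>\<Delta>. \<exists>\<pi>\<in>\<Pi>. \<exists>c\<in>tuples S l.
        infinite {a \<in> sol S m \<pi> c. local_thorn_ge S n m l \<Delta> \<Pi> k \<alpha> (X \<inter> sol S n \<delta> a)} \<and>
        k_inconsistent S n \<delta> k (sol S m \<pi> c))"

text \<open>The local rank of a type is the minimum of the ranks of its formulas.\<close>
definition rosy :: "'k rel \<Rightarrow> ('f, 'r) lang \<Rightarrow> ('f, 'r, 'a) struct \<Rightarrow> bool" where
  "rosy \<kappa> L S \<longleftrightarrow>
     (\<forall>as A m l \<Delta> \<Pi> k. set as \<subseteq> univ S \<and> small \<kappa> S A \<and>
        finite \<Delta> \<and> (\<forall>\<delta>\<in>\<Delta>. form L (length as + m) \<delta>) \<and>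
        finite \<Pi> \<and> (\<forall>\<pi>\<in>\<Pi>. form L (m + l) \<pi>) \<longrightarrow>
        (\<exists>\<theta> ds N. set ds \<subseteq> A \<and> form L (length as + length ds) \<theta> \<and> holds S \<theta> (as @ ds) \<and>
           \<not> local_thorn_ge S (length as) m l \<Delta> \<Pi> k N (sol S (length as) \<theta> ds)))"

text \<open>
  The rank of \<open>(as, A)\<close> is an ordinal iff it fails to be at least \<open>\<alpha>\<close> for some ordinal \<open>\<alpha>\<close>. The
  rank of types ranges over a set of pairs \<open>(as, A)\<close>, so well-orders on the type of such pairs
  are long enough.
\<close>
definition superrosy_in :: "'k rel \<Rightarrow> ('f, 'r) lang \<Rightarrow> ('f, 'r, 'a) struct \<Rightarrow> bool" where
  "superrosy_in \<kappa> L S \<longleftrightarrow> rosy \<kappa> L S \<and>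
     (\<forall>as A. set as \<subseteq> univ S \<and> small \<kappa> S A \<longrightarrow>
        (\<exists>(r :: ('a list \<times> 'a set) rel) \<alpha>. Well_order r \<and> \<alpha> \<in> Field r \<and>
           \<not> U_thorn_ge \<kappa> L S r \<alpha> as A))"

definition superrosy :: "'k rel \<Rightarrow> ('f, 'r) lang \<Rightarrow> ('f, 'r, 'a) struct \<Rightarrow> bool" where
  "superrosy \<kappa> L M \<longleftrightarrow> superrosy_in \<kappa> (eq_lang L M) (eq_struct L M)"

text \<open>
  Every type of a finite tuple of imaginaries has finite rank, and there is a finite bound on the
  ranks of all types of single elements of \<open>M\<close>.
\<close>
definition finite_U_thorn :: "'k rel \<Rightarrow> ('f, 'r) lang \<Rightarrow> ('f, 'r, 'a) struct \<Rightarrow> bool" where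
  "finite_U_thorn \<kappa> L M \<longleftrightarrow>
     (\<forall>as A. set as \<subseteq> univ (eq_struct L M) \<and> small \<kappa> (eq_struct L M) A \<longrightarrow>
        (\<exists>n. \<not> U_thorn_ge \<kappa> (eq_lang L M) (eq_struct L M) natLeq n as A)) \<and>
     (\<exists>n. \<forall>a\<in>home M. \<forall>A. small \<kappa> (eq_struct L M) A \<longrightarrow>
        \<not> U_thorn_ge \<kappa> (eq_lang L M) (eq_struct L M) natLeq n [a] A)"

end

theory Submission
  imports Defs
begin

text \<open>
  By the theorem of Ryll-Nardzewski, \<open>M\<close> has finitely many types of \<open>n\<close>-tuples for each \<open>n\<close>. It is proved
  inside \<open>M\<close>: if there were infinitely many, one of them would be non-isolated, and
  saturation would yield a countable elementary substructure omitting it next to one realising it.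

  Say that \<open>z\<close> is an atom over \<open>C\<close> if it has 0-rank 1 over \<open>C\<close>. Since algebraic closures of finite sets
  contain finitely many elements of \<open>M\<close>, every real element not algebraic over \<open>C\<close> has an atom over \<open>C\<close>
  in its algebraic closure. Hence exchange for two atoms already gives exchange between an atom and an
  arbitrary real element, and any two maximal chains of atoms generating the same closure have the
  same length. By soft elimination of imaginaries every finite tuple of imaginaries has such chains, and
  their length is an additive dimension; the corresponding notion of independence is symmetric and
  satisfies extension. If a type thorn-forks, then its dimension drops: after passing to independent
  realisations of the parameters, strong dividing makes a tuple algebraic over the realisation of the
  type that is not algebraic over the base. So the thorn ranks are bounded by the dimension.
\<close>

section \<open>Definable sets\<close>

text \<open>The model is only assumed to be saturated, so automorphisms are not at hand. Partial
  elementary relations take their place, and the orbit of an element over a set means the set of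
  realisations of its type. The structure of imaginaries is one-sorted with infinitely many sort
  predicates. It therefore has infinitely many 1-types, and it is not saturated: "to lie in no sort"
  is finitely satisfiable but not realised. Finiteness of types and compactness survive only inside
  a fixed sort, which is why the abstract setting carries a sort function. Transferring them from
  the real elements needs a back-and-forth in which a formula sees only the finitely many sorts that
  it mentions. The same obstacle returns for rosiness, which the definition of superrosy demands
  besides ordinal ranks. The parameters in a local thorn rank may lie in any sort, and they have to
  be confined to finitely many sorts before finiteness of algebraic closures can be applied to them.
  After that the local rank, too, is bounded by the dimension.\<close>

lemma finite_tvars [simp]: "finite (tvars t)"
  by (induction t) auto

lemma finite_fv [simp]: "finite (fv \<phi>)"
  by (induction \<phi>) auto

lemma eval_tm_cong: "(\<And>i. i \<in> tvars t \<Longrightarrow> v i = w i) \<Longrightarrow> eval_tm S v t = eval_tm S w t"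
proof (induction t)
  case (App f ts)
  then have "map (eval_tm S v) ts = map (eval_tm S w) ts" by auto
  then show ?case by (simp only: eval_tm.simps)
qed simp

lemma sat_cong: "(\<And>i. i \<in> fv \<phi> \<Longrightarrow> v i = w i) \<Longrightarrow> sat S v \<phi> \<longleftrightarrow> sat S w \<phi>"
proof (induction \<phi> arbitrary: v w)
  case (Eq s t)
  then show ?case using eval_tm_cong[of s v w S] eval_tm_cong[of t v w S] by simp
next
  case (Rel R ts)
  then have "map (eval_tm S v) ts = map (eval_tm S w) ts"
    by (auto intro!: eval_tm_cong)
  then show ?case by (simp only: sat.simps)
next
  case (Exists i \<phi>)
  have "sat S (v(i := a)) \<phi> \<longleftrightarrow> sat S (w(i := a)) \<phi>" for a
    by (rule Exists.IH) (use Exists.prems in auto)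
  then show ?case by simp
next
  case (Conj p q)
  have "sat S v p = sat S w p" "sat S v q = sat S w q"
    by (rule Conj.IH(1), use Conj.prems in simp) (rule Conj.IH(2), use Conj.prems in simp)
  then show ?case by simp
next
  case (Neg p)
  have "sat S v p = sat S w p" by (rule Neg.IH) (use Neg.prems in auto)
  then show ?case by simp
qed

section \<open>Renaming variables\<close>

lemma tm_rename:
  "\<exists>t'. (wf_tm L t \<longrightarrow> wf_tm L t') \<and> tvars t' = \<sigma> ` tvars t \<and>
     (\<forall>v. eval_tm S v t' = eval_tm S (v \<circ> \<sigma>) t)"
proof (induction t)
  case (Var i)
  show ?case by (intro exI[of _ "Var (\<sigma> i)"]) simp
next
  case (App f ts)
  then obtain g where g: "\<And>t. t \<in> set ts \<Longrightarrow> wf_tm L t \<longrightarrow> wf_tm L (g t)"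
    "\<And>t. t \<in> set ts \<Longrightarrow> tvars (g t) = \<sigma> ` tvars t"
    "\<And>t v. t \<in> set ts \<Longrightarrow> eval_tm S v (g t) = eval_tm S (v \<circ> \<sigma>) t"
    by metis
  have "map (eval_tm S v) (map g ts) = map (eval_tm S (v \<circ> \<sigma>)) ts" for v
    using g(3) by simp
  then show ?case using g(1,2)
    by (intro exI[of _ "App f (map g ts)"]) (auto simp del: map_map simp: image_UN comp_def)
qed

text \<open>The renaming may identify variables; this is what allows tuples with repeated entries to
  be substituted into a formula.\<close>

lemma fm_rename:
  "\<exists>\<phi>'. (wf_fm L \<phi> \<longrightarrow> wf_fm L \<phi>') \<and> fv \<phi>' \<subseteq> \<sigma> ` fv \<phi> \<and>
     (\<forall>v. sat S v \<phi>' \<longleftrightarrow> sat S (v \<circ> \<sigma>) \<phi>)"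
proof (induction \<phi> arbitrary: \<sigma>)
  case (Eq s t)
  obtain s' where s: "wf_tm L s \<longrightarrow> wf_tm L s'" "tvars s' = \<sigma> ` tvars s"
    "\<And>v. eval_tm S v s' = eval_tm S (v \<circ> \<sigma>) s"
    using tm_rename[of L s \<sigma> S] by blast
  obtain t' where t: "wf_tm L t \<longrightarrow> wf_tm L t'" "tvars t' = \<sigma> ` tvars t"
    "\<And>v. eval_tm S v t' = eval_tm S (v \<circ> \<sigma>) t"
    using tm_rename[of L t \<sigma> S] by blast
  show ?case using s t by (intro exI[of _ "Eq s' t'"]) (auto simp: comp_def)
next
  case (Rel R ts)
  obtain g where g: "\<And>t. wf_tm L t \<longrightarrow> wf_tm L (g t)" "\<And>t. tvars (g t) = \<sigma> ` tvars t"
    "\<And>t v. eval_tm S v (g t) = eval_tm S (v \<circ> \<sigma>) t"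
    using tm_rename[of L _ \<sigma> S] by metis
  have "map (eval_tm S v) (map g ts) = map (eval_tm S (v \<circ> \<sigma>)) ts" for v
    using g by simp
  then show ?case using g by (intro exI[of _ "Rel R (map g ts)"]) (auto simp del: map_map simp: comp_def)
next
  case (Neg \<phi>)
  obtain p where p: "wf_fm L \<phi> \<longrightarrow> wf_fm L p" "fv p \<subseteq> \<sigma> ` fv \<phi>"
    "\<And>v. sat S v p \<longleftrightarrow> sat S (v \<circ> \<sigma>) \<phi>" using Neg[of \<sigma>] by blast
  then show ?case by (intro exI[of _ "Neg p"]) (auto simp: comp_def)
next
  case (Conj \<phi> \<psi>)
  obtain p where p: "wf_fm L \<phi> \<longrightarrow> wf_fm L p" "fv p \<subseteq> \<sigma> ` fv \<phi>"
    "\<And>v. sat S v p \<longleftrightarrow> sat S (v \<circ> \<sigma>) \<phi>" using Conj.IH(1)[of \<sigma>] by blast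
  obtain q where q: "wf_fm L \<psi> \<longrightarrow> wf_fm L q" "fv q \<subseteq> \<sigma> ` fv \<psi>"
    "\<And>v. sat S v q \<longleftrightarrow> sat S (v \<circ> \<sigma>) \<psi>" using Conj.IH(2)[of \<sigma>] by blast
  show ?case using p q by (intro exI[of _ "Conj p q"]) (auto simp: comp_def)
next
  case (Exists i \<phi>)
  \<comment> \<open>The bound variable moves to a \<open>j\<close> that is not the image of any free
    variable of \<open>\<phi>\<close>, so nothing is captured.\<close>
  obtain j where j: "j \<notin> \<sigma> ` fv \<phi>"
    using ex_new_if_finite[of "\<sigma> ` fv \<phi>"] by auto
  obtain p where p: "wf_fm L \<phi> \<longrightarrow> wf_fm L p" "fv p \<subseteq> (\<sigma>(i := j)) ` fv \<phi>"
    "\<And>v. sat S v p \<longleftrightarrow> sat S (v \<circ> \<sigma>(i := j)) \<phi>" using Exists.IH[of "\<sigma>(i := j)"] by blast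
  have "sat S (v(j := a) \<circ> \<sigma>(i := j)) \<phi> \<longleftrightarrow> sat S ((v \<circ> \<sigma>)(i := a)) \<phi>" for v a
    by (rule sat_cong) (use j in auto)
  then show ?case using p by (intro exI[of _ "Exists j p"]) (auto simp: comp_def)
qed

text \<open>Definable sets are sets of valuations, with \<open>F\<close> bounding the variables that
  matter. Boolean operations, projections and renamings become operations on sets, and formulas
  rarely have to be written down. Valuations may leave \<open>univ S\<close>, only quantifiers are
  confined to it; so negation is the full complement.\<close>

definition fdef :: "('f, 'r) lang \<Rightarrow> ('f, 'r, 'a) struct \<Rightarrow> nat set \<Rightarrow> (nat \<Rightarrow> 'a) set \<Rightarrow> bool" where
  "fdef L S F V \<longleftrightarrow> (\<exists>\<phi>. wf_fm L \<phi> \<and> fv \<phi> \<subseteq> F \<and> V = {v. sat S v \<phi>})"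

definition pdef :: "('f, 'r) lang \<Rightarrow> ('f, 'r, 'a) struct \<Rightarrow> 'a set \<Rightarrow> 'a set \<Rightarrow> bool" where
  "pdef L S C W \<longleftrightarrow> (\<exists>\<phi> cs. set cs \<subseteq> C \<and> form L (Suc (length cs)) \<phi> \<and>
     W = {x \<in> univ S. holds S \<phi> (x # cs)})"

lemma fdefI: "wf_fm L \<phi> \<Longrightarrow> fv \<phi> \<subseteq> F \<Longrightarrow> fdef L S F {v. sat S v \<phi>}"
  unfolding fdef_def by blast

lemma fdef_mono: "fdef L S F V \<Longrightarrow> F \<subseteq> G \<Longrightarrow> fdef L S G V"
  unfolding fdef_def by blast

lemma fdef_finite: "fdef L S F V \<Longrightarrow> \<exists>G\<subseteq>F. finite G \<and> fdef L S G V"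
  unfolding fdef_def by (metis finite_fv order_refl)

lemma fdef_cong: "fdef L S F V \<Longrightarrow> (\<And>i. i \<in> F \<Longrightarrow> v i = w i) \<Longrightarrow> v \<in> V \<longleftrightarrow> w \<in> V"
  unfolding fdef_def using sat_cong[of _ v w S] by blast

lemma fdef_compl: "fdef L S F V \<Longrightarrow> fdef L S F (- V)"
proof -
  assume "fdef L S F V"
  then obtain \<phi> where "wf_fm L \<phi>" "fv \<phi> \<subseteq> F" "V = {v. sat S v \<phi>}" unfolding fdef_def by blast
  then show ?thesis unfolding fdef_def by (intro exI[of _ "Neg \<phi>"]) auto
qed

lemma fdef_Int: "fdef L S F V \<Longrightarrow> fdef L S G W \<Longrightarrow> fdef L S (F \<union> G) (V \<inter> W)"
proof -
  assume "fdef L S F V" "fdef L S G W"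
  then obtain \<phi> \<psi> where "wf_fm L \<phi>" "fv \<phi> \<subseteq> F" "V = {v. sat S v \<phi>}"
    "wf_fm L \<psi>" "fv \<psi> \<subseteq> G" "W = {v. sat S v \<psi>}" unfolding fdef_def by blast
  then show ?thesis unfolding fdef_def by (intro exI[of _ "Conj \<phi> \<psi>"]) auto
qed

lemma fdef_ex: "fdef L S F V \<Longrightarrow> fdef L S (F - {i}) {v. \<exists>a\<in>univ S. v(i := a) \<in> V}"
proof -
  assume "fdef L S F V"
  then obtain \<phi> where "wf_fm L \<phi>" "fv \<phi> \<subseteq> F" "V = {v. sat S v \<phi>}" unfolding fdef_def by blast
  then show ?thesis unfolding fdef_def by (intro exI[of _ "Exists i \<phi>"]) auto
qed

lemma fdef_rename: "fdef L S F V \<Longrightarrow> fdef L S (\<sigma> ` F) {v. v \<circ> \<sigma> \<in> V}"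
proof -
  assume "fdef L S F V"
  then obtain \<phi> where p: "wf_fm L \<phi>" "fv \<phi> \<subseteq> F" "V = {v. sat S v \<phi>}" unfolding fdef_def by blast
  obtain \<phi>' where "wf_fm L \<phi> \<longrightarrow> wf_fm L \<phi>'" "fv \<phi>' \<subseteq> \<sigma> ` fv \<phi>"
     "\<And>v. sat S v \<phi>' \<longleftrightarrow> sat S (v \<circ> \<sigma>) \<phi>" using fm_rename[of L \<phi> \<sigma> S] by blast
  moreover have "\<sigma> ` fv \<phi> \<subseteq> \<sigma> ` F" using p(2) by (rule image_mono)
  ultimately show ?thesis using p unfolding fdef_def by (intro exI[of _ \<phi>']) auto
qed

text \<open>A true sentence is used, so that \<open>F = {}\<close> is covered; its truth is where
  the universe has to be nonempty.\<close>

lemma fdef_UNIV: "univ S \<noteq> {} \<Longrightarrow> fdef L S F UNIV"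
  unfolding fdef_def by (intro exI[of _ "Exists 0 (Eq (Var 0) (Var 0))"]) auto

lemma fdef_INT:
  assumes "univ S \<noteq> {}" "finite \<V>" "\<And>V. V \<in> \<V> \<Longrightarrow> fdef L S F V"
  shows "fdef L S F (\<Inter>\<V>)"
  using assms(2,3)
proof (induction rule: finite_induct)
  case empty
  then show ?case using fdef_UNIV[OF assms(1)] by simp
next
  case (insert V \<V>)
  then have "fdef L S (F \<union> F) (V \<inter> \<Inter>\<V>)" by (intro fdef_Int) auto
  then show ?case by simp
qed

lemma fdef_ex_finite:
  assumes "fdef L S F V" "finite I"
  shows "fdef L S (F - I) {v. \<exists>w. (\<forall>i\<in>I. w i \<in> univ S) \<and> (\<forall>i. i \<notin> I \<longrightarrow> w i = v i) \<and> w \<in> V}"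
  using assms(2)
proof (induction rule: finite_induct)
  case empty
  have "{v. \<exists>w. (\<forall>i\<in>{}. w i \<in> univ S) \<and> (\<forall>i. i \<notin> {} \<longrightarrow> w i = v i) \<and> w \<in> V} = V"
    by (simp add: fun_eq_iff[symmetric])
  then show ?case using assms(1) by simp
next
  case (insert j I)
  let ?V = "\<lambda>I. {v. \<exists>w. (\<forall>i\<in>I. w i \<in> univ S) \<and> (\<forall>i. i \<notin> I \<longrightarrow> w i = v i) \<and> w \<in> V}"
  have "{v. \<exists>a\<in>univ S. v(j := a) \<in> ?V I} = ?V (insert j I)" (is "?l = ?r")
  proof (intro set_eqI iffI)
    fix v assume "v \<in> ?l"
    then obtain a w where a: "a \<in> univ S" "\<forall>i\<in>I. w i \<in> univ S"
       "\<forall>i. i \<notin> I \<longrightarrow> w i = (v(j := a)) i" "w \<in> V" by blast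
    then have "w j = a" using insert.hyps by auto
    then show "v \<in> ?r" using a insert.hyps by (auto intro!: exI[of _ w])
  next
    fix v assume "v \<in> ?r"
    then obtain w where w: "\<forall>i\<in>insert j I. w i \<in> univ S" "\<forall>i. i \<notin> insert j I \<longrightarrow> w i = v i" "w \<in> V"
      by blast
    then show "v \<in> ?l" by (auto intro!: bexI[of _ "w j"] exI[of _ w])
  qed
  moreover have "F - insert j I = F - I - {j}" by auto
  ultimately show ?case using fdef_ex[OF insert.IH, of j] by simp
qed

text \<open>Only finitely many variables of \<open>F\<close> matter. The values of \<open>v\<close>
  at these, listed in the order of \<open>js\<close>, become the parameters.\<close>

lemma pdefI:
  assumes V: "fdef L S (insert i F) V" and "i \<notin> F" and vC: "\<And>j. j \<in> F \<Longrightarrow> v j \<in> C"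
  shows "pdef L S C {x \<in> univ S. v(i := x) \<in> V}"
proof -
  obtain G where G: "G \<subseteq> insert i F" "finite G" "fdef L S G V" using fdef_finite[OF V] by blast
  obtain js where js: "set js = G - {i}" using finite_list[of "G - {i}"] G(2) by auto
  \<comment> \<open>The object variable \<open>i\<close> goes to 0, any other variable to the
    successor of a position where \<open>js\<close> has it.\<close>
  define \<sigma> where "\<sigma> j = (if j = i then 0 else Suc (SOME k. k < length js \<and> js ! k = j))" for j
  have s: "k < length js \<and> js ! k = j" if "j \<in> G" "j \<noteq> i" "\<sigma> j = Suc k" for j k
  proof -
    have "\<exists>k. k < length js \<and> js ! k = j" using that js by (metis Diff_iff in_set_conv_nth singletonD)
    from someI_ex[OF this] show ?thesis using that by (simp add: \<sigma>_def)
  qed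
  obtain \<phi> where p: "wf_fm L \<phi>" "fv \<phi> \<subseteq> \<sigma> ` G" "{v. v \<circ> \<sigma> \<in> V} = {v. sat S v \<phi>}"
    using fdef_rename[OF G(3), of \<sigma>] unfolding fdef_def by blast
  have lt: "\<sigma> j < Suc (length js)" if "j \<in> G" for j
  proof (cases "j = i")
    case False
    then obtain k where "\<sigma> j = Suc k" by (simp add: \<sigma>_def)
    then show ?thesis using s[OF that False] by simp
  qed (simp add: \<sigma>_def)
  have "holds S \<phi> (x # map v js) \<longleftrightarrow> v(i := x) \<in> V" for x
  proof -
    have "holds S \<phi> (x # map v js) \<longleftrightarrow> ((!) (x # map v js)) \<circ> \<sigma> \<in> V"
      using p(3) unfolding holds_def by auto
    also have "\<dots> \<longleftrightarrow> v(i := x) \<in> V"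
    proof (rule fdef_cong[OF G(3)])
      fix j assume j: "j \<in> G"
      show "((!) (x # map v js) \<circ> \<sigma>) j = (v(i := x)) j"
      proof (cases "j = i")
        case False
        then obtain k where k: "\<sigma> j = Suc k" by (simp add: \<sigma>_def)
        then show ?thesis using s[OF j False k] False by simp
      qed (simp add: \<sigma>_def)
    qed
    finally show ?thesis .
  qed
  moreover have "form L (Suc (length (map v js))) \<phi>"
    unfolding form_def using p(1,2) lt by fastforce
  moreover have "set (map v js) \<subseteq> C" using js G(1) vC by auto
  ultimately show ?thesis unfolding pdef_def by blast
qed

text \<open>The variable 0 is the object variable.\<close>
lemma pdefE:
  assumes "pdef L S C W"
  shows "\<exists>V n cs. fdef L S {..n} V \<and> length cs = n \<and> set cs \<subseteq> C \<and>
    (\<forall>v. (\<forall>i<n. v (Suc i) = cs ! i) \<longrightarrow> W = {x \<in> univ S. v(0 := x) \<in> V})"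
proof -
  obtain \<phi> cs where p: "set cs \<subseteq> C" "form L (Suc (length cs)) \<phi>"
     "W = {x \<in> univ S. holds S \<phi> (x # cs)}" using assms unfolding pdef_def by blast
  have d: "fdef L S {..length cs} {v. sat S v \<phi>}"
    using p(2) unfolding form_def by (intro fdefI) auto
  moreover have "\<forall>v. (\<forall>i<length cs. v (Suc i) = cs ! i) \<longrightarrow>
      W = {x \<in> univ S. v(0 := x) \<in> {v. sat S v \<phi>}}"
  proof (intro allI impI)
    fix v assume v: "\<forall>i<length cs. v (Suc i) = cs ! i"
    have "holds S \<phi> (x # cs) \<longleftrightarrow> v(0 := x) \<in> {v. sat S v \<phi>}" for x
      unfolding holds_def mem_Collect_eq
      by (rule sat_cong) (use p(2) v in \<open>auto simp: form_def nth_Cons split: nat.split\<close>)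
    then show "W = {x \<in> univ S. v(0 := x) \<in> {v. sat S v \<phi>}}" using p(3) by blast
  qed
  ultimately show ?thesis using p(1) by blast
qed

lemma pdef_mono: "pdef L S C W \<Longrightarrow> C \<subseteq> D \<Longrightarrow> pdef L S D W"
  unfolding pdef_def by blast

lemma pdef_compl: "pdef L S C W \<Longrightarrow> pdef L S C (univ S - W)"
proof -
  assume "pdef L S C W"
  then obtain \<phi> cs where "set cs \<subseteq> C" "form L (Suc (length cs)) \<phi>"
    "W = {x \<in> univ S. holds S \<phi> (x # cs)}" unfolding pdef_def by blast
  then show ?thesis unfolding pdef_def
    by (intro exI[of _ "Neg \<phi>"] exI[of _ cs]) (auto simp: form_def holds_def)
qed

text \<open>The two formulas come with different parameter lists. Concatenating the lists and
  shifting the parameter variables of the second formula past the first list makes both speak about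
  a single valuation.\<close>

lemma pdef_Int:
  assumes "pdef L S C W" "pdef L S C W'"
  shows "pdef L S C (W \<inter> W')"
proof -
  obtain V n cs where V: "fdef L S {..n} V" "length cs = n" "set cs \<subseteq> C"
    "\<And>v. (\<And>i. i < n \<Longrightarrow> v (Suc i) = cs ! i) \<Longrightarrow> W = {x \<in> univ S. v(0 := x) \<in> V}"
    using pdefE[OF assms(1)] by metis
  obtain V' n' cs' where V': "fdef L S {..n'} V'" "length cs' = n'" "set cs' \<subseteq> C"
    "\<And>v. (\<And>i. i < n' \<Longrightarrow> v (Suc i) = cs' ! i) \<Longrightarrow> W' = {x \<in> univ S. v(0 := x) \<in> V'}"
    using pdefE[OF assms(2)] by metis
  define \<sigma> where "\<sigma> i = (if i = 0 then 0 else n + i)" for i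
  let ?v = "\<lambda>i. (cs @ cs') ! (i - 1)"
  have W: "W = {x \<in> univ S. ?v(0 := x) \<in> V}" by (rule V(4)) (auto simp: V(2) nth_append)
  have "W' = {x \<in> univ S. (?v \<circ> \<sigma>)(0 := x) \<in> V'}"
    by (rule V'(4)) (auto simp: V(2) nth_append \<sigma>_def)
  moreover have "(?v \<circ> \<sigma>)(0 := x) = ?v(0 := x) \<circ> \<sigma>" for x
    by (auto simp: \<sigma>_def)
  ultimately have W': "W' = {x \<in> univ S. ?v(0 := x) \<in> {v. v \<circ> \<sigma> \<in> V'}}" by simp
  have "fdef L S ({..n} \<union> \<sigma> ` {..n'}) (V \<inter> {v. v \<circ> \<sigma> \<in> V'})"
    by (intro fdef_Int fdef_rename V V')
  then have "fdef L S (insert 0 {1..n + n'}) (V \<inter> {v. v \<circ> \<sigma> \<in> V'})"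
    by (rule fdef_mono) (auto simp: \<sigma>_def)
  then have "pdef L S C {x \<in> univ S. ?v(0 := x) \<in> V \<inter> {v. v \<circ> \<sigma> \<in> V'}}"
    by (rule pdefI) (use V(2,3) V'(2,3) in \<open>auto simp: nth_append subset_iff\<close>)
  moreover have "{x \<in> univ S. ?v(0 := x) \<in> V \<inter> {v. v \<circ> \<sigma> \<in> V'}} = W \<inter> W'"
    unfolding W W' by blast
  ultimately show ?thesis by simp
qed

lemma pdef_univ: "pdef L S C (univ S)"
proof -
  have "fdef L S (insert 0 {}) {v. sat S v (Eq (Var 0) (Var 0))}" by (rule fdefI) auto
  from pdefI[OF this, of undefined C] show ?thesis by simp
qed

lemma pdef_INT:
  assumes "finite I" "\<And>i. i \<in> I \<Longrightarrow> pdef L S C (W i)"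
  shows "pdef L S C (univ S \<inter> (\<Inter>i\<in>I. W i))"
  using assms
proof (induction rule: finite_induct)
  case (insert i I)
  then have "pdef L S C (univ S \<inter> (\<Inter>i\<in>I. W i))" "pdef L S C (W i)" by auto
  from pdef_Int[OF this(2,1)] have "pdef L S C (W i \<inter> (univ S \<inter> (\<Inter>i\<in>I. W i)))" .
  moreover have "W i \<inter> (univ S \<inter> (\<Inter>i\<in>I. W i)) = univ S \<inter> (\<Inter>j\<in>insert i I. W j)" by blast
  ultimately show ?case by simp
qed (simp add: pdef_univ)

lemma pdef_subset: "pdef L S C W \<Longrightarrow> W \<subseteq> univ S"
  unfolding pdef_def by blast

lemma pdef_UN:
  assumes "finite I" "\<And>i. i \<in> I \<Longrightarrow> pdef L S C (W i)"
  shows "pdef L S C (\<Union>i\<in>I. W i)"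
proof -
  have "pdef L S C (univ S - (univ S \<inter> (\<Inter>i\<in>I. univ S - W i)))"
    by (intro pdef_compl pdef_INT assms)
  moreover have "univ S - (univ S \<inter> (\<Inter>i\<in>I. univ S - W i)) = (\<Union>i\<in>I. W i)"
    using pdef_subset[OF assms(2)] by blast
  ultimately show ?thesis by simp
qed

lemma acl_pdef: "a \<in> acl L S C \<longleftrightarrow> (\<exists>W. pdef L S C W \<and> finite W \<and> a \<in> W)"
  unfolding acl_def pdef_def by blast

text \<open>Saturation for families of definable sets; the factor \<open>univ S\<close> gives
  intersections over an empty family their right meaning.\<close>

lemma saturated_pdef:
  assumes "saturated \<kappa> L S" "small \<kappa> S A" "\<And>W. W \<in> \<W> \<Longrightarrow> pdef L S A W"
    and "\<And>\<W>'. finite \<W>' \<Longrightarrow> \<W>' \<subseteq> \<W> \<Longrightarrow> univ S \<inter> \<Inter>\<W>' \<noteq> {}"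
  shows "univ S \<inter> \<Inter>\<W> \<noteq> {}"
proof -
  define \<Phi> where "\<Phi> = {(\<phi>, cs). set cs \<subseteq> A \<and> form L (Suc (length cs)) \<phi> \<and>
      {x \<in> univ S. holds S \<phi> (x # cs)} \<in> \<W>}"
  have "\<exists>a\<in>univ S. \<forall>(\<phi>, cs)\<in>\<Phi>. holds S \<phi> (a # cs)"
  proof (rule assms(1)[unfolded saturated_def, rule_format, OF assms(2)], intro conjI allI impI)
    show "\<forall>(\<phi>, cs)\<in>\<Phi>. set cs \<subseteq> A \<and> form L (Suc (length cs)) \<phi>" unfolding \<Phi>_def by blast
    fix \<Phi>' assume "finite \<Phi>' \<and> \<Phi>' \<subseteq> \<Phi>"
    then have "finite ((\<lambda>(\<phi>, cs). {x \<in> univ S. holds S \<phi> (x # cs)}) ` \<Phi>')"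
      "(\<lambda>(\<phi>, cs). {x \<in> univ S. holds S \<phi> (x # cs)}) ` \<Phi>' \<subseteq> \<W>"
      unfolding \<Phi>_def by auto
    from assms(4)[OF this] show "\<exists>a\<in>univ S. \<forall>(\<phi>, cs)\<in>\<Phi>'. holds S \<phi> (a # cs)" by blast
  qed
  then obtain a where a: "a \<in> univ S" "\<And>\<phi> cs. (\<phi>, cs) \<in> \<Phi> \<Longrightarrow> holds S \<phi> (a # cs)" by blast
  have "a \<in> W" if W: "W \<in> \<W>" for W
  proof -
    obtain \<phi> cs where "set cs \<subseteq> A" "form L (Suc (length cs)) \<phi>"
      "W = {x \<in> univ S. holds S \<phi> (x # cs)}" using assms(3)[OF W] unfolding pdef_def by blast
    then show ?thesis using a(1) a(2)[of \<phi> cs] W unfolding \<Phi>_def by blast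
  qed
  then show ?thesis using a(1) by blast
qed

section \<open>Partial elementary maps\<close>

text \<open>A partial elementary map as a set of pairs, so that inverses, composites, restrictions
  and unions with an identity are operations on relations. The most frequent instance is
  \<open>insert (a, b) (Id_on C)\<close>: the elements \<open>a\<close> and \<open>b\<close> have
  the same type over \<open>C\<close>.\<close>

definition pe :: "('f, 'r) lang \<Rightarrow> ('f, 'r, 'a) struct \<Rightarrow> ('a \<times> 'a) set \<Rightarrow> bool" where
  "pe L S P \<longleftrightarrow> P \<subseteq> univ S \<times> univ S \<and>
     (\<forall>\<phi> v w. wf_fm L \<phi> \<and> (\<forall>i\<in>fv \<phi>. (v i, w i) \<in> P) \<longrightarrow> (sat S v \<phi> \<longleftrightarrow> sat S w \<phi>))"

lemma pe_subset: "pe L S P \<Longrightarrow> P \<subseteq> univ S \<times> univ S"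
  unfolding pe_def by blast

lemma pe_sat:
  "pe L S P \<Longrightarrow> wf_fm L \<phi> \<Longrightarrow> (\<And>i. i \<in> fv \<phi> \<Longrightarrow> (v i, w i) \<in> P) \<Longrightarrow> sat S v \<phi> \<longleftrightarrow> sat S w \<phi>"
  unfolding pe_def by blast

lemma pe_fdef:
  "pe L S P \<Longrightarrow> fdef L S F V \<Longrightarrow> (\<And>i. i \<in> F \<Longrightarrow> (v i, w i) \<in> P) \<Longrightarrow> v \<in> V \<longleftrightarrow> w \<in> V"
  unfolding pe_def fdef_def by blast

lemma pe_mono: "pe L S P \<Longrightarrow> Q \<subseteq> P \<Longrightarrow> pe L S Q"
  unfolding pe_def by blast

lemma pe_finite:
  assumes "P \<subseteq> univ S \<times> univ S" "\<And>Q. finite Q \<Longrightarrow> Q \<subseteq> P \<Longrightarrow> pe L S Q"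
  shows "pe L S P"
  unfolding pe_def
proof (intro conjI allI impI assms(1))
  fix \<phi> v w assume h: "wf_fm L \<phi> \<and> (\<forall>i\<in>fv \<phi>. (v i, w i) \<in> P)"
  have "pe L S ((\<lambda>i. (v i, w i)) ` fv \<phi>)" by (rule assms(2)) (use h in auto)
  then show "sat S v \<phi> \<longleftrightarrow> sat S w \<phi>" by (rule pe_sat) (use h in auto)
qed

lemma pe_Id_on: "A \<subseteq> univ S \<Longrightarrow> pe L S (Id_on A)"
  unfolding pe_def using sat_cong by (fastforce simp: Id_on_iff)

lemma pe_converse: "pe L S P \<Longrightarrow> pe L S (P\<inverse>)"
  unfolding pe_def by (metis converseD converse_Times converse_mono)

lemma pe_relcomp:
  assumes "pe L S P" "pe L S Q"
  shows "pe L S (P O Q)"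
  unfolding pe_def
proof (intro conjI allI impI)
  show "P O Q \<subseteq> univ S \<times> univ S" using assms unfolding pe_def by blast
  fix \<phi> v w assume h: "wf_fm L \<phi> \<and> (\<forall>i\<in>fv \<phi>. (v i, w i) \<in> P O Q)"
  then have "\<forall>i\<in>fv \<phi>. \<exists>x. (v i, x) \<in> P \<and> (x, w i) \<in> Q" by blast
  then obtain x where "\<forall>i\<in>fv \<phi>. (v i, x i) \<in> P \<and> (x i, w i) \<in> Q" by metis
  then show "sat S v \<phi> \<longleftrightarrow> sat S w \<phi>"
    using pe_sat[OF assms(1), of \<phi> v x] pe_sat[OF assms(2), of \<phi> x w] h by simp
qed

text \<open>Equality is a formula, so an elementary relation is single-valued; applied to the
  converse this gives injectivity.\<close>

lemma pe_fun: "pe L S P \<Longrightarrow> (a, b) \<in> P \<Longrightarrow> (a, c) \<in> P \<Longrightarrow> b = c"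
  using pe_sat[of L S P "Eq (Var 0) (Var (Suc 0))" "\<lambda>_. a" "\<lambda>i. if i = 0 then b else c"]
  by (auto split: if_splits)

text \<open>For the direction from types to elementary relations, the parameters from
  \<open>A\<close> that a formula uses are collected in a list \<open>cs\<close>. Each free variable
  is then renamed to a position of \<open>as @ cs\<close> where the right pair of values
  stands.\<close>

lemma pe_same_type:
  assumes "set as \<subseteq> univ S" "set bs \<subseteq> univ S" "A \<subseteq> univ S" "length as = length bs"
  shows "same_type L S A as bs \<longleftrightarrow> pe L S (set (zip as bs) \<union> Id_on A)"
proof
  assume t: "same_type L S A as bs"
  show "pe L S (set (zip as bs) \<union> Id_on A)"
    unfolding pe_def
  proof (intro conjI allI impI)
    show "set (zip as bs) \<union> Id_on A \<subseteq> univ S \<times> univ S"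
      using assms by (auto dest: set_zip_leftD set_zip_rightD)
    fix \<phi> v w assume h: "wf_fm L \<phi> \<and> (\<forall>i\<in>fv \<phi>. (v i, w i) \<in> set (zip as bs) \<union> Id_on A)"
    obtain cs where cs: "set cs = v ` fv \<phi> \<inter> A" using finite_list[of "v ` fv \<phi> \<inter> A"] by auto
    have "\<exists>k<length (as @ cs). (as @ cs) ! k = v i \<and> (bs @ cs) ! k = w i" if i: "i \<in> fv \<phi>" for i
    proof (cases "(v i, w i) \<in> set (zip as bs)")
      case True
      then obtain k where "k < length as" "as ! k = v i" "bs ! k = w i"
        by (auto simp: in_set_zip)
      then show ?thesis using assms(4) by (intro exI[of _ k]) (auto simp: nth_append)
    next
      case False
      then have "v i = w i" "v i \<in> set cs" using h i cs by auto
      then obtain k where "k < length cs" "cs ! k = v i" "cs ! k = w i"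
        by (metis in_set_conv_nth)
      then show ?thesis using assms(4) by (intro exI[of _ "length as + k"]) (auto simp: nth_append)
    qed
    then obtain \<sigma> where \<sigma>: "\<And>i. i \<in> fv \<phi> \<Longrightarrow> \<sigma> i < length as + length cs"
      "\<And>i. i \<in> fv \<phi> \<Longrightarrow> (as @ cs) ! \<sigma> i = v i" "\<And>i. i \<in> fv \<phi> \<Longrightarrow> (bs @ cs) ! \<sigma> i = w i"
      by (metis length_append)
    obtain \<phi>' where p: "wf_fm L \<phi>'" "fv \<phi>' \<subseteq> \<sigma> ` fv \<phi>"
      "\<And>v. sat S v \<phi>' \<longleftrightarrow> sat S (v \<circ> \<sigma>) \<phi>" using fm_rename[of L \<phi> \<sigma> S] h by blast
    have "\<sigma> ` fv \<phi> \<subseteq> {..<length as + length cs}" using \<sigma>(1) by auto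
    then have "form L (length as + length cs) \<phi>'" unfolding form_def using p(1,2) by blast
    moreover have "set cs \<subseteq> A" using cs by blast
    ultimately have "holds S \<phi>' (as @ cs) = holds S \<phi>' (bs @ cs)"
      using t unfolding same_type_def by blast
    moreover have "sat S ((!) (as @ cs) \<circ> \<sigma>) \<phi> = sat S v \<phi>" by (rule sat_cong) (simp add: \<sigma>)
    moreover have "sat S ((!) (bs @ cs) \<circ> \<sigma>) \<phi> = sat S w \<phi>" by (rule sat_cong) (simp add: \<sigma>)
    ultimately show "sat S v \<phi> \<longleftrightarrow> sat S w \<phi>" unfolding holds_def p(3) by simp
  qed
next
  assume p: "pe L S (set (zip as bs) \<union> Id_on A)"
  show "same_type L S A as bs"
    unfolding same_type_def holds_def
  proof (intro conjI allI impI assms(4))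
    fix \<phi> cs assume h: "set cs \<subseteq> A \<and> form L (length as + length cs) \<phi>"
    show "sat S ((!) (as @ cs)) \<phi> = sat S ((!) (bs @ cs)) \<phi>"
    proof (rule pe_sat[OF p])
      show "wf_fm L \<phi>" using h by (simp add: form_def)
      fix i assume "i \<in> fv \<phi>"
      then have i: "i < length as + length cs" using h by (auto simp: form_def)
      show "((as @ cs) ! i, (bs @ cs) ! i) \<in> set (zip as bs) \<union> Id_on A"
      proof (cases "i < length as")
        case True
        then show ?thesis using assms(4) by (auto simp: nth_append in_set_zip)
      next
        case False
        then have "cs ! (i - length as) \<in> A" using i h nth_mem[of "i - length as" cs] by auto
        then show ?thesis using False assms(4) by (auto simp: nth_append)
      qed
    qed
  qed
qed

lemma pdef_invariant:
  assumes W: "pdef L S C W" and x: "x \<in> W" and p: "pe L S (insert (x, y) (Id_on C))"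
  shows "y \<in> W"
proof -
  obtain V n cs where V: "fdef L S {..n} V" "length cs = n" "set cs \<subseteq> C"
    "\<And>v. (\<And>i. i < n \<Longrightarrow> v (Suc i) = cs ! i) \<Longrightarrow> W = {x \<in> univ S. v(0 := x) \<in> V}"
    using pdefE[OF W] by metis
  have W': "W = {x \<in> univ S. (\<lambda>i. cs ! (i - 1))(0 := x) \<in> V}" by (rule V(4)) simp
  have "(\<lambda>i. cs ! (i - 1))(0 := x) \<in> V \<longleftrightarrow> (\<lambda>i. cs ! (i - 1))(0 := y) \<in> V"
    by (rule pe_fdef[OF p V(1)]) (use V(2,3) in \<open>auto simp: Id_on_iff subset_iff\<close>)
  moreover have "y \<in> univ S" using pe_subset[OF p] by blast
  ultimately show ?thesis using W' x by blast
qed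

text \<open>If a definable set meets only finitely many types over \<open>C\<close>, each of these
  is isolated: separate \<open>a\<close> by a formula from every representative of another type, and
  intersect.\<close>

lemma orbit_pdef:
  assumes "a \<in> D" "pdef L S C D" "C \<subseteq> univ S" "finite R" "R \<subseteq> univ S"
    and R: "\<And>x. x \<in> D \<Longrightarrow> \<exists>r\<in>R. pe L S (insert (x, r) (Id_on C))"
  shows "pdef L S C {x. pe L S (insert (a, x) (Id_on C))}"
proof -
  let ?O = "\<lambda>a. {x. pe L S (insert (a, x) (Id_on C))}"
  have tr: "pe L S (insert (x, z) (Id_on C))"
    if "pe L S (insert (x, y) (Id_on C))" "pe L S (insert (y, z) (Id_on C))" for x y z
    by (rule pe_mono[OF pe_relcomp[OF that]]) auto
  have sy: "pe L S (insert (y, x) (Id_on C))" if "pe L S (insert (x, y) (Id_on C))" for x y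
    using pe_converse[OF that] by (rule pe_mono) auto
  have aU: "a \<in> univ S" using assms(1,2) pdef_subset by blast
  have sep: "\<exists>W. pdef L S C W \<and> a \<in> W \<and> r \<notin> W" if r: "r \<in> R" "r \<notin> ?O a" for r
  proof -
    have "\<not> same_type L S C [a] [r]"
      using pe_same_type[of "[a]" S "[r]" C L] assms(3,5) r aU by auto
    then obtain \<phi> cs where p: "set cs \<subseteq> C" "form L (Suc (length cs)) \<phi>"
      "holds S \<phi> (a # cs) \<noteq> holds S \<phi> (r # cs)" unfolding same_type_def by auto
    define W where "W = {x \<in> univ S. holds S \<phi> (x # cs)}"
    have W: "pdef L S C W" unfolding W_def pdef_def using p by blast
    have "r \<in> univ S" using r(1) assms(5) by blast
    then show ?thesis using W pdef_compl[OF W] p(3) aU unfolding W_def by blast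
  qed
  then obtain W where W: "\<And>r. r \<in> R - ?O a \<Longrightarrow> pdef L S C (W r) \<and> a \<in> W r \<and> r \<notin> W r"
    by (metis DiffE)
  have "pdef L S C (D \<inter> (univ S \<inter> (\<Inter>r\<in>R - ?O a. W r)))"
    by (intro pdef_Int pdef_INT assms(2)) (use W assms(4) in auto)
  moreover have "D \<inter> (univ S \<inter> (\<Inter>r\<in>R - ?O a. W r)) = ?O a"
  proof (intro set_eqI iffI)
    fix x assume x: "x \<in> D \<inter> (univ S \<inter> (\<Inter>r\<in>R - ?O a. W r))"
    then obtain r where r: "r \<in> R" "pe L S (insert (x, r) (Id_on C))" using R by blast
    have "r \<in> ?O a"
    proof (rule ccontr)
      assume "r \<notin> ?O a"
      then have "r \<in> R - ?O a" using r by blast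
      then show False using pdef_invariant[of L S C "W r" x r] W r x by blast
    qed
    then show "x \<in> ?O a" using tr sy r(2) by blast
  next
    fix x assume x: "x \<in> ?O a"
    then have "x \<in> univ S" using pe_subset by blast
    then show "x \<in> D \<inter> (univ S \<inter> (\<Inter>r\<in>R - ?O a. W r))"
      using pdef_invariant[OF assms(2) assms(1)]
        pdef_invariant[of L S C "W _" a x] W x by blast
  qed
  ultimately show ?thesis by simp
qed

text \<open>An elementary map extends to any element whose type over its domain is isolated:
  transport the isolating formula and take any solution of it.\<close>

lemma pe_forth:
  assumes P: "pe L S P" "finite P" and d: "d \<in> univ S"
    and iso: "pdef L S (Domain P) {x. pe L S (insert (d, x) (Id_on (Domain P)))}"
  shows "\<exists>d'. pe L S (insert (d, d') P)"
proof -
  let ?O = "{x. pe L S (insert (d, x) (Id_on (Domain P)))}"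
  obtain V n cs where V: "fdef L S {..n} V" "length cs = n" "set cs \<subseteq> Domain P"
    "\<forall>v. (\<forall>i<n. v (Suc i) = cs ! i) \<longrightarrow> ?O = {x \<in> univ S. v(0 := x) \<in> V}"
    using pdefE[OF iso] by blast
  let ?v = "\<lambda>i. cs ! (i - 1)"
  have O: "?O = {x \<in> univ S. ?v(0 := x) \<in> V}" by (rule V(4)[rule_format]) simp
  have DU: "Domain P \<subseteq> univ S" using pe_subset[OF P(1)] by blast
  have "insert (d, d) (Id_on (Domain P)) = Id_on (insert d (Domain P))" by auto
  then have dO: "d \<in> ?O" using pe_Id_on[of "insert d (Domain P)" S L] d DU by simp
  have "\<forall>c\<in>Domain P. \<exists>c'. (c, c') \<in> P" by blast
  then obtain f where f: "\<And>c. c \<in> Domain P \<Longrightarrow> (c, f c) \<in> P" by metis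
  let ?w = "\<lambda>i. f (?v i)"
  have fv: "(?v i, ?w i) \<in> P" if "i \<in> {..n} - {0}" for i
    by (rule f) (use that V(2,3) in \<open>auto simp: subset_iff\<close>)
  \<comment> \<open>Satisfiability of the isolating formula is itself a formula about the
    parameters, so it passes through \<open>P\<close>. The witness on the range side is
    \<open>d'\<close>.\<close>
  have "?v \<in> {v. \<exists>a\<in>univ S. v(0 := a) \<in> V} \<longleftrightarrow> ?w \<in> {v. \<exists>a\<in>univ S. v(0 := a) \<in> V}"
    by (rule pe_fdef[OF P(1) fdef_ex[OF V(1), of 0]]) (rule fv)
  moreover have "?v \<in> {v. \<exists>a\<in>univ S. v(0 := a) \<in> V}" using O dO by blast
  ultimately obtain d' where d': "d' \<in> univ S" "?w(0 := d') \<in> V" by blast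
  have main: "y \<in> X"
    if X: "fdef L S F X" "finite F" "\<And>i. i \<in> F \<Longrightarrow> (x i, y i) \<in> insert (d, d') P" "x \<in> X" for F X x y
  proof -
    \<comment> \<open>On \<open>J\<close> the pair of values must be \<open>(d, d')\<close>. These
      variables are merged into the object variable 0 of the isolating formula; the others are
      shifted past its parameters.\<close>
    define J where "J = {i \<in> F. (x i, y i) \<notin> P}"
    define \<sigma> where "\<sigma> i = (if i \<in> J then 0 else Suc (n + i))" for i
    let ?X = "{v. v \<circ> \<sigma> \<in> X}"
    \<comment> \<open>\<open>?T\<close> says that the isolating formula does not imply
      \<open>X\<close>. This is false on the domain side, hence on the range side as well, where
      \<open>d'\<close> satisfies the isolating formula.\<close>
    let ?T = "{v. \<exists>a\<in>univ S. v(0 := a) \<in> V \<inter> - ?X}"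
    have T: "fdef L S (({..n} \<union> \<sigma> ` F) - {0}) ?T"
      by (intro fdef_ex fdef_Int fdef_compl fdef_rename V X)
    define v' where "v' i = (if i \<le> n then ?v i else x (i - Suc n))" for i
    define w' where "w' i = (if i \<le> n then ?w i else y (i - Suc n))" for i
    have "v' \<in> ?T \<longleftrightarrow> w' \<in> ?T"
    proof (rule pe_fdef[OF P(1) T])
      fix i assume i: "i \<in> {..n} \<union> \<sigma> ` F - {0}"
      show "(v' i, w' i) \<in> P"
      proof (cases "i \<le> n")
        case True then show ?thesis using fv[of i] i by (simp add: v'_def w'_def)
      next
        case False
        then obtain j where j: "i = \<sigma> j" "j \<in> F" using i by auto
        then have "j \<notin> J" "i = Suc (n + j)" using i by (auto simp: \<sigma>_def split: if_splits)
        then show ?thesis using j by (simp add: v'_def w'_def J_def)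
      qed
    qed
    moreover have "v' \<notin> ?T"
    proof
      assume "v' \<in> ?T"
      then obtain a where a: "a \<in> univ S" "v'(0 := a) \<in> V" "v'(0 := a) \<circ> \<sigma> \<notin> X" by blast
      have "v'(0 := a) \<in> V \<longleftrightarrow> ?v(0 := a) \<in> V"
        by (rule fdef_cong[OF V(1)]) (simp add: v'_def)
      then have aO: "a \<in> ?O" using O a by blast
      have "x \<in> X \<longleftrightarrow> v'(0 := a) \<circ> \<sigma> \<in> X"
      proof (rule pe_fdef[OF _ X(1)])
        show "pe L S (insert (d, a) (Id_on (Domain P)))" using aO by simp
        fix i assume i: "i \<in> F"
        show "(x i, (v'(0 := a) \<circ> \<sigma>) i) \<in> insert (d, a) (Id_on (Domain P))"
        proof (cases "i \<in> J")
          case True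
          then have "x i = d" using X(3)[OF i] by (auto simp: J_def)
          then show ?thesis using True by (simp add: \<sigma>_def)
        next
          case False
          then have "(x i, y i) \<in> P" using i by (simp add: J_def)
          then have "x i \<in> Domain P" by blast
          then show ?thesis using False by (simp add: \<sigma>_def v'_def Id_on_iff)
        qed
      qed
      then show False using a X(4) by blast
    qed
    ultimately have "w' \<notin> ?T" by blast
    moreover have "w'(0 := d') \<in> V"
    proof -
      have "w'(0 := d') \<in> V \<longleftrightarrow> ?w(0 := d') \<in> V"
        by (rule fdef_cong[OF V(1)]) (simp add: w'_def)
      then show ?thesis using d' by blast
    qed
    ultimately have "w'(0 := d') \<circ> \<sigma> \<in> X" using d'(1) by blast
    moreover have "w'(0 := d') \<circ> \<sigma> \<in> X \<longleftrightarrow> y \<in> X"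
    proof (rule fdef_cong[OF X(1)])
      fix i assume i: "i \<in> F"
      show "(w'(0 := d') \<circ> \<sigma>) i = y i"
      proof (cases "i \<in> J")
        case True
        then have "y i = d'" using X(3)[OF i] by (auto simp: J_def)
        then show ?thesis using True by (simp add: \<sigma>_def)
      qed (simp add: \<sigma>_def w'_def)
    qed
    ultimately show ?thesis by blast
  qed
  have "pe L S (insert (d, d') P)"
    unfolding pe_def
  proof (intro conjI allI impI)
    show "insert (d, d') P \<subseteq> univ S \<times> univ S" using d d' pe_subset[OF P(1)] by blast
    fix \<phi> v w assume h: "wf_fm L \<phi> \<and> (\<forall>i\<in>fv \<phi>. (v i, w i) \<in> insert (d, d') P)"
    have f: "fdef L S (fv \<phi>) {v. sat S v \<phi>}" by (rule fdefI) (use h in auto)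
    from main[OF f, of v w] main[OF fdef_compl[OF f], of v w]
    show "sat S v \<phi> \<longleftrightarrow> sat S w \<phi>" using h by auto
  qed
  then show ?thesis by blast
qed

section \<open>Realising countably many variables\<close>

definition vals :: "('f, 'r, 'a) struct \<Rightarrow> (nat \<Rightarrow> 'a) set" where
  "vals S = {v. range v \<subseteq> univ S}"

lemma vals_iff: "v \<in> vals S \<longleftrightarrow> (\<forall>i. v i \<in> univ S)"
  unfolding vals_def by auto

lemma small_finite: "natLeq <o \<kappa> \<Longrightarrow> finite A \<Longrightarrow> A \<subseteq> univ S \<Longrightarrow> small \<kappa> S A"
  unfolding small_def using finite_iff_ordLess_natLeq ordLess_transitive by blast

lemma fdef_Inter_finite:
  assumes "univ S \<noteq> {}" "finite \<V>" "\<And>V. V \<in> \<V> \<Longrightarrow> fdef L S UNIV V"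
  shows "\<exists>F. finite F \<and> fdef L S F (\<Inter>\<V>)"
proof -
  have "\<exists>F. \<forall>V\<in>\<V>. finite (F V) \<and> fdef L S (F V) V"
    using fdef_finite[OF assms(3)] by (intro bchoice) blast
  then obtain F where F: "\<And>V. V \<in> \<V> \<Longrightarrow> finite (F V) \<and> fdef L S (F V) V" by blast
  have "fdef L S (\<Union>(F ` \<V>)) (\<Inter>\<V>)"
    by (rule fdef_INT[OF assms(1,2)]) (use F in \<open>blast intro: fdef_mono\<close>)
  then show ?thesis using F assms(2) by blast
qed

text \<open>Values for the variables 0, 1, 2, ... are chosen one at a time, keeping the family
  finitely satisfiable. At each stage only finitely many parameters occur, so saturation for one
  variable suffices.\<close>

lemma omega_saturated:
  assumes sat: "saturated \<kappa> L S" and k: "natLeq <o \<kappa>" and ne: "univ S \<noteq> {}"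
    and def: "\<And>V. V \<in> \<V> \<Longrightarrow> fdef L S UNIV V"
    and fip: "\<And>\<V>'. finite \<V>' \<Longrightarrow> \<V>' \<subseteq> \<V> \<Longrightarrow> vals S \<inter> \<Inter>\<V>' \<noteq> {}"
  shows "vals S \<inter> \<Inter>\<V> \<noteq> {}"
proof -
  \<comment> \<open>The first \<open>k\<close> values of \<open>v\<close> are compatible with every
    finite part of the family; later values of \<open>v\<close> are irrelevant.\<close>
  define Q where "Q k v \<longleftrightarrow> v \<in> vals S \<and>
     (\<forall>\<V>'. finite \<V>' \<and> \<V>' \<subseteq> \<V> \<longrightarrow> (\<exists>u\<in>vals S \<inter> \<Inter>\<V>'. \<forall>i<k. u i = v i))" for k :: nat and v
  have step: "\<exists>v'. Q (Suc k) v' \<and> (\<forall>i<k. v' i = v i)" if q: "Q k v" for k v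
  proof -
    define W where "W \<V>' = {a \<in> univ S. \<exists>u\<in>vals S \<inter> \<Inter>\<V>'. (\<forall>i<k. u i = v i) \<and> u k = a}" for \<V>'
    have v: "\<And>i. v i \<in> univ S" using q by (simp add: Q_def vals_iff)
    have W: "pdef L S (v ` {..<k}) (W \<V>')" if V': "finite \<V>'" "\<V>' \<subseteq> \<V>" for \<V>'
    proof -
      obtain F where F: "finite F" "fdef L S F (\<Inter>\<V>')"
        using fdef_Inter_finite[OF ne V'(1)] def V'(2) by blast
      \<comment> \<open>Variables below \<open>k\<close> are parameters, \<open>k\<close> is the
        object variable, and those above \<open>k\<close> are quantified away.\<close>
      define I where "I = F - {..k}"
      define X where "X = {v. \<exists>w. (\<forall>i\<in>I. w i \<in> univ S) \<and> (\<forall>i. i \<notin> I \<longrightarrow> w i = v i) \<and> w \<in> \<Inter>\<V>'}"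
      have "fdef L S (F - I) X" unfolding X_def using F I_def by (intro fdef_ex_finite) auto
      then have "fdef L S (insert k {..<k}) X" by (rule fdef_mono) (auto simp: I_def)
      then have "pdef L S (v ` {..<k}) {x \<in> univ S. v(k := x) \<in> X}" by (rule pdefI) auto
      moreover have "{x \<in> univ S. v(k := x) \<in> X} = W \<V>'"
      proof (intro set_eqI iffI)
        fix a assume "a \<in> {x \<in> univ S. v(k := x) \<in> X}"
        then obtain w where w: "a \<in> univ S" "\<forall>i\<in>I. w i \<in> univ S"
          "\<forall>i. i \<notin> I \<longrightarrow> w i = (v(k := a)) i" "w \<in> \<Inter>\<V>'" unfolding X_def by blast
        have "w i \<in> univ S" for i using w v by (cases "i \<in> I") auto
        moreover have "\<forall>i<k. w i = v i" "w k = a" using w(3) by (auto simp: I_def)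
        ultimately show "a \<in> W \<V>'" unfolding W_def using w by (auto simp: vals_iff)
      next
        fix a assume "a \<in> W \<V>'"
        then obtain u where u: "a \<in> univ S" "u \<in> vals S" "u \<in> \<Inter>\<V>'" "\<forall>i<k. u i = v i" "u k = a"
          unfolding W_def by blast
        define w where "w i = (if i \<in> I then u i else (v(k := a)) i)" for i
        have "w \<in> \<Inter>\<V>' \<longleftrightarrow> u \<in> \<Inter>\<V>'"
          by (rule fdef_cong[OF F(2)]) (use u(4,5) in \<open>auto simp: w_def I_def\<close>)
        then have "v(k := a) \<in> X" unfolding X_def using u(1,2,3)
          by (auto simp: vals_iff w_def intro!: exI[of _ w])
        then show "a \<in> {x \<in> univ S. v(k := x) \<in> X}" using u(1) by blast
      qed
      ultimately show ?thesis by simp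
    qed
    define \<W> where "\<W> = W ` {\<V>'. finite \<V>' \<and> \<V>' \<subseteq> \<V>}"
    have "univ S \<inter> \<Inter>\<W> \<noteq> {}"
    proof (rule saturated_pdef[OF sat, of "v ` {..<k}"])
      show "small \<kappa> S (v ` {..<k})" using v by (intro small_finite k) auto
      show "pdef L S (v ` {..<k}) X" if "X \<in> \<W>" for X using that W unfolding \<W>_def by auto
      fix \<W>' assume w: "finite \<W>'" "\<W>' \<subseteq> \<W>"
      then obtain J where J: "J \<subseteq> {\<V>'. finite \<V>' \<and> \<V>' \<subseteq> \<V>}" "finite J" "\<W>' = W ` J"
        using finite_subset_image[OF w(1) w(2)[unfolded \<W>_def]] by metis
      then have "finite (\<Union>J) \<and> \<Union>J \<subseteq> \<V>" by auto
      then obtain u where "u \<in> vals S \<inter> \<Inter>(\<Union>J)" "\<forall>i<k. u i = v i"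
        using q unfolding Q_def by meson
      then have "u k \<in> univ S \<inter> \<Inter>\<W>'" unfolding J(3) W_def by (auto simp: vals_iff)
      then show "univ S \<inter> \<Inter>\<W>' \<noteq> {}" by blast
    qed
    then obtain a where a: "a \<in> univ S" "a \<in> \<Inter>\<W>" by blast
    have "Q (Suc k) (v(k := a))"
      unfolding Q_def
    proof (intro conjI allI impI)
      show "v(k := a) \<in> vals S" using v a by (simp add: vals_iff)
      fix \<V>' assume "finite \<V>' \<and> \<V>' \<subseteq> \<V>"
      then have "a \<in> W \<V>'" using a unfolding \<W>_def by blast
      then obtain u where "u \<in> vals S \<inter> \<Inter>\<V>'" "\<forall>i<k. u i = v i" "u k = a"
        unfolding W_def by blast
      then show "\<exists>u\<in>vals S \<inter> \<Inter>\<V>'. \<forall>i<Suc k. u i = (v(k := a)) i"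
        by (intro bexI[of _ u]) (auto simp: less_Suc_eq)
    qed
    then show ?thesis by (intro exI[of _ "v(k := a)"]) simp
  qed
  obtain d where "d \<in> univ S" using ne by blast
  then have "(\<lambda>_. d) \<in> vals S" by (simp add: vals_iff)
  moreover have "\<exists>u\<in>vals S \<inter> \<Inter>\<V>'. \<forall>i<0. u i = d" if "finite \<V>'" "\<V>' \<subseteq> \<V>" for \<V>'
    using fip[OF that] by auto
  ultimately have "\<exists>v. Q 0 v" unfolding Q_def by meson
  then obtain f where f: "\<And>k. Q k (f k)" "\<And>k i. i < k \<Longrightarrow> f (Suc k) i = f k i"
    using dependent_nat_choice[of Q "\<lambda>k v v'. \<forall>i<k. v' i = v i"] step by metis
  \<comment> \<open>Value \<open>i\<close> is settled from stage \<open>Suc i\<close> on, so the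
    diagonal agrees with every later stage.\<close>
  define w where "w i = f (Suc i) i" for i
  have fw: "f k i = w i" if "i < k" for k i
    using that
  proof (induction k)
    case (Suc k)
    then show ?case using f(2)[of i k] by (cases "i = k") (auto simp: w_def)
  qed simp
  have "w \<in> vals S" using f(1) unfolding Q_def w_def by (simp add: vals_iff)
  moreover have "w \<in> V" if V: "V \<in> \<V>" for V
  proof -
    obtain F where F: "finite F" "fdef L S F V" using fdef_finite[OF def[OF V]] by blast
    then obtain k where k: "\<forall>i\<in>F. i < k" using finite_nat_set_iff_bounded by blast
    obtain u where u: "u \<in> V" "\<forall>i<k. u i = f k i"
      using f(1)[of k] V unfolding Q_def
      by (metis (no_types, lifting) IntE InterE empty_subsetI finite.emptyI finite.insertI insertI1 insert_subset)
    have "w \<in> V \<longleftrightarrow> u \<in> V" by (rule fdef_cong[OF F(2)]) (use k u fw in auto)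
    then show ?thesis using u by simp
  qed
  ultimately show ?thesis by blast
qed

text \<open>A Baire category argument, with the satisfiable definable sets as basic open sets.\<close>
lemma generic_valuation:
  assumes sat: "saturated \<kappa> L S" and k: "natLeq <o \<kappa>" and ne: "univ S \<noteq> {}"
    and c: "countable \<R>"
    and dense: "\<And>\<rho> V. \<rho> \<in> \<R> \<Longrightarrow> fdef L S UNIV V \<Longrightarrow> vals S \<inter> V \<noteq> {} \<Longrightarrow>
      \<exists>V'. fdef L S UNIV V' \<and> V' \<subseteq> V \<and> vals S \<inter> V' \<noteq> {} \<and> (\<forall>v\<in>vals S \<inter> V'. \<rho> v)"
  shows "\<exists>v\<in>vals S. \<forall>\<rho>\<in>\<R>. \<rho> v"
proof (cases "\<R> = {}")
  case True
  then show ?thesis using ne by (auto simp: vals_iff)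
next
  case False
  define P where "P V \<longleftrightarrow> fdef L S UNIV V \<and> vals S \<inter> V \<noteq> {}" for V
  have "vals S \<noteq> {}" using ne by (auto simp: vals_iff)
  then have P0: "\<exists>V. P V" using fdef_UNIV[OF ne] unfolding P_def by (intro exI[of _ UNIV]) simp
  have "\<exists>f. \<forall>n. P (f n) \<and> (f (Suc n) \<subseteq> f n \<and>
      (\<forall>v\<in>vals S \<inter> f (Suc n). from_nat_into \<R> n v))"
  proof (rule dependent_nat_choice)
    show "\<exists>x. P x" by (rule P0)
    show "\<exists>y. P y \<and> (y \<subseteq> x \<and> (\<forall>v\<in>vals S \<inter> y. from_nat_into \<R> n v))" if "P x" for x n
      using dense[OF from_nat_into[OF False], of x n] that unfolding P_def by blast
  qed
  then obtain f where f: "\<And>n. P (f n)"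
    "\<And>n. f (Suc n) \<subseteq> f n \<and> (\<forall>v\<in>vals S \<inter> f (Suc n). from_nat_into \<R> n v)" by blast
  have anti: "f n \<subseteq> f m" if "m \<le> n" for m n
    using lift_Suc_antimono_le[of f m n] f(2) that by blast
  have "vals S \<inter> \<Inter>(range f) \<noteq> {}"
  proof (rule omega_saturated[OF sat k ne])
    show "fdef L S UNIV V" if "V \<in> range f" for V using that f(1) unfolding P_def by blast
    fix \<V>' assume "finite \<V>'" "\<V>' \<subseteq> range f"
    then obtain J where J: "finite J" "\<V>' = f ` J" by (meson finite_subset_image)
    then obtain n where "\<forall>m\<in>J. m \<le> n" using finite_nat_set_iff_bounded_le by blast
    then have "f n \<subseteq> \<Inter>\<V>'" using anti J by blast
    then show "vals S \<inter> \<Inter>\<V>' \<noteq> {}" using f(1)[of n] unfolding P_def by blast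
  qed
  then obtain v where v: "v \<in> vals S" "\<And>n. v \<in> f n" by blast
  have "\<rho> v" if "\<rho> \<in> \<R>" for \<rho>
    using f(2) v from_nat_into_surj[OF c that] by (metis IntI)
  then show ?thesis using v by blast
qed

section \<open>Countable elementary substructures\<close>

text \<open>The Tarski-Vaught criterion for \<open>N\<close> to be the universe of an elementary
  substructure. It is phrased with total valuations into \<open>N\<close>, which serve as the
  parameters.\<close>

definition tv_closed :: "('f, 'r) lang \<Rightarrow> ('f, 'r, 'a) struct \<Rightarrow> 'a set \<Rightarrow> bool" where
  "tv_closed L S N \<longleftrightarrow> N \<subseteq> univ S \<and> N \<noteq> {} \<and>
     (\<forall>\<phi> i u. wf_fm L \<phi> \<and> range u \<subseteq> N \<and> (\<exists>a\<in>univ S. sat S (u(i := a)) \<phi>) \<longrightarrow>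
        (\<exists>a\<in>N. sat S (u(i := a)) \<phi>))"

lemma eval_tm_univ [simp]: "eval_tm (S\<lparr>univ := N\<rparr>) v t = eval_tm S v t"
  by (induction t) (simp_all cong: map_cong)

lemma tv_closed_sat:
  assumes "tv_closed L S N"
  shows "wf_fm L \<phi> \<Longrightarrow> range u \<subseteq> N \<Longrightarrow> sat (S\<lparr>univ := N\<rparr>) u \<phi> \<longleftrightarrow> sat S u \<phi>"
proof (induction \<phi> arbitrary: u)
  case (Exists i \<phi>)
  have "range (u(i := a)) \<subseteq> N" if "a \<in> N" for a using Exists.prems that by auto
  then have "sat (S\<lparr>univ := N\<rparr>) (u(i := a)) \<phi> \<longleftrightarrow> sat S (u(i := a)) \<phi>" if "a \<in> N" for a
    using Exists.IH Exists.prems that by simp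
  moreover have "(\<exists>a\<in>univ S. sat S (u(i := a)) \<phi>) \<longrightarrow> (\<exists>a\<in>N. sat S (u(i := a)) \<phi>)"
    using assms Exists.prems unfolding tv_closed_def by simp
  moreover have "N \<subseteq> univ S" using assms unfolding tv_closed_def by simp
  ultimately show ?case by auto
qed (simp_all cong: map_cong)

text \<open>Closure under a function symbol is the criterion applied to the formula saying that a
  variable equals the value of the function.\<close>

lemma tv_closed_struct:
  assumes "tv_closed L S N" "is_struct L S"
  shows "is_struct L (S\<lparr>univ := N\<rparr>)"
  unfolding is_struct_def
proof (intro conjI ballI allI impI)
  show "univ (S\<lparr>univ := N\<rparr>) \<noteq> {}" using assms(1) unfolding tv_closed_def by simp
  fix f as assume f: "f \<in> funs L"
    and as: "set as \<subseteq> univ (S\<lparr>univ := N\<rparr>) \<and> length as = farity L f"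
  obtain d where d: "d \<in> N" using assms(1) unfolding tv_closed_def by blast
  define u where "u i = (if i < length as then as ! i else d)" for i
  let ?n = "length as"
  let ?\<phi> = "Eq (App f (map Var [0..<?n])) (Var ?n)"
  have ev: "sat S (u(?n := a)) ?\<phi> \<longleftrightarrow> funI S f as = a" for a
  proof -
    have "map (eval_tm S (u(?n := a))) (map Var [0..<?n]) = as"
      by (rule nth_equalityI) (auto simp: u_def)
    then show ?thesis by (simp del: map_map)
  qed
  have "set as \<subseteq> univ S" using as assms(1) unfolding tv_closed_def by auto
  then have "funI S f as \<in> univ S" using assms(2) f as unfolding is_struct_def by blast
  then have "\<exists>a\<in>univ S. sat S (u(?n := a)) ?\<phi>" using ev by blast
  moreover have "range u \<subseteq> N" using as d by (auto simp: u_def)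
  moreover have "wf_fm L ?\<phi>" using f as by auto
  ultimately have "\<exists>a\<in>N. sat S (u(?n := a)) ?\<phi>" using assms(1) unfolding tv_closed_def by blast
  then show "funI (S\<lparr>univ := N\<rparr>) f as \<in> univ (S\<lparr>univ := N\<rparr>)" using ev by auto
qed

text \<open>If \<open>N\<close> were finite, "to differ from every element of \<open>N\<close>"
  would be a formula with parameters in \<open>N\<close>, satisfied in \<open>S\<close> but not in
  \<open>N\<close>.\<close>

lemma tv_closed_infinite:
  assumes "tv_closed L S N" "infinite (univ S)"
  shows "infinite N"
proof
  assume "finite N"
  then obtain ns where ns: "set ns = N" using finite_list by blast
  then have "ns \<noteq> []" using assms(1) unfolding tv_closed_def by auto
  \<comment> \<open>Variable \<open>Suc k\<close> holds the \<open>k\<close>-th element of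
    \<open>N\<close>; the first element is the default beyond the list.\<close>
  define u where "u i = (if i - 1 < length ns then ns ! (i - 1) else ns ! 0)" for i
  have ne: "univ S \<noteq> {}" using assms(2) by auto
  have "fdef L S (insert 0 {1..length ns})
      (\<Inter>((\<lambda>i. {v :: nat \<Rightarrow> 'c. v 0 \<noteq> v i}) ` {1..length ns}))"
  proof (rule fdef_INT[OF ne])
    fix V assume "V \<in> (\<lambda>i. {v :: nat \<Rightarrow> 'c. v 0 \<noteq> v i}) ` {1..length ns}"
    then obtain i where i: "i \<in> {1..length ns}" "V = {v. v 0 \<noteq> v i}" by blast
    have "fdef L S (insert 0 {1..length ns}) {v. sat S v (Neg (Eq (Var 0) (Var i)))}"
      using i(1) by (intro fdefI) auto
    then show "fdef L S (insert 0 {1..length ns}) V" using i(2) by simp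
  qed simp
  then obtain \<phi> where \<phi>0: "wf_fm L \<phi>"
    "(\<Inter>((\<lambda>i. {v :: nat \<Rightarrow> 'c. v 0 \<noteq> v i}) ` {1..length ns})) = {v. sat S v \<phi>}"
    unfolding fdef_def by metis
  have \<phi>: "sat S v \<phi> \<longleftrightarrow> (\<forall>i\<in>{1..length ns}. v 0 \<noteq> v i)" for v
  proof -
    have "v \<in> {v. sat S v \<phi>} \<longleftrightarrow> (\<forall>i\<in>{1..length ns}. v 0 \<noteq> v i)"
      unfolding \<phi>0(2)[symmetric] by simp
    then show ?thesis by simp
  qed
  have u: "(\<forall>i\<in>{1..length ns}. (u(0 := a)) 0 \<noteq> (u(0 := a)) i) \<longleftrightarrow> a \<notin> N" for a
  proof
    assume l: "\<forall>i\<in>{1..length ns}. (u(0 := a)) 0 \<noteq> (u(0 := a)) i"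
    show "a \<notin> N"
    proof
      assume "a \<in> N"
      then obtain k where "k < length ns" "ns ! k = a" using ns by (auto simp: in_set_conv_nth)
      then show False using bspec[OF l, of "Suc k"] by (simp add: u_def)
    qed
  next
    assume "a \<notin> N"
    moreover have "u i \<in> N" if "i \<in> {1..length ns}" for i
      unfolding ns[symmetric] u_def using that by auto
    ultimately show "\<forall>i\<in>{1..length ns}. (u(0 := a)) 0 \<noteq> (u(0 := a)) i" by auto
  qed
  obtain a where "a \<in> univ S" "a \<notin> N" using assms(2) \<open>finite N\<close>
    by (metis finite_subset subsetI)
  moreover have "range u \<subseteq> N" using ns \<open>ns \<noteq> []\<close> by (auto simp: u_def)
  moreover from calculation have "\<exists>a\<in>univ S. sat S (u(0 := a)) \<phi>" using \<phi> u by blast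
  ultimately have "\<exists>a\<in>N. sat S (u(0 := a)) \<phi>"
    using assms(1) \<phi>0(1) unfolding tv_closed_def by blast
  then show False using \<phi> u by blast
qed

lemma iso_sat:
  assumes A: "is_struct L A" and h: "bij_betw h (univ A) (univ B)"
    and hf: "\<forall>f\<in>funs L. \<forall>as\<in>tuples A (farity L f). h (funI A f as) = funI B f (map h as)"
    and hr: "\<forall>R\<in>rels L. \<forall>as\<in>tuples A (rarity L R). relI A R as \<longleftrightarrow> relI B R (map h as)"
  shows "wf_fm L \<phi> \<Longrightarrow> u \<in> vals A \<Longrightarrow> sat A u \<phi> \<longleftrightarrow> sat B (h \<circ> u) \<phi>"
proof (induction \<phi> arbitrary: u)
  have ev: "eval_tm A u t \<in> univ A \<and> h (eval_tm A u t) = eval_tm B (h \<circ> u) t"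
    if "wf_tm L t" "u \<in> vals A" for u t
    using that
  proof (induction t)
    case (App f ts)
    have ts: "\<forall>t\<in>set ts. eval_tm A u t \<in> univ A \<and> h (eval_tm A u t) = eval_tm B (h \<circ> u) t"
      using App.IH App.prems unfolding wf_tm.simps by blast
    then have tp: "map (eval_tm A u) ts \<in> tuples A (farity L f)"
      using App.prems by (auto simp: tuples_def)
    moreover have "map h (map (eval_tm A u) ts) = map (eval_tm B (h \<circ> u)) ts"
      using ts by simp
    moreover from tp have "funI A f (map (eval_tm A u) ts) \<in> univ A"
      using App.prems A unfolding is_struct_def tuples_def by auto
    ultimately show ?case using App.prems hf tp
      by (metis eval_tm.simps(2) wf_tm.simps(2))
  qed (simp add: vals_iff)
  {
    case (Eq s t)
    have "eval_tm A u s = eval_tm A u t \<longleftrightarrow> h (eval_tm A u s) = h (eval_tm A u t)"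
      using h ev Eq unfolding bij_betw_def inj_on_def by (metis wf_fm.simps(1))
    then show ?case using ev Eq by (simp add: comp_def)
  next
    case (Rel R ts)
    then have "map (eval_tm A u) ts \<in> tuples A (rarity L R)"
      using ev by (auto simp: tuples_def)
    moreover have "map h (map (eval_tm A u) ts) = map (eval_tm B (h \<circ> u)) ts"
      using ev Rel by simp
    ultimately show ?case using Rel hr by (metis sat.simps(2) wf_fm.simps(2))
  next
    case (Exists i \<phi>)
    have "sat A (u(i := a)) \<phi> \<longleftrightarrow> sat B ((h \<circ> u)(i := h a)) \<phi>" if "a \<in> univ A" for a
    proof -
      have "u(i := a) \<in> vals A" using Exists.prems that by (simp add: vals_iff)
      then have "sat A (u(i := a)) \<phi> \<longleftrightarrow> sat B (h \<circ> u(i := a)) \<phi>"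
        using Exists by (simp add: comp_def)
      then show ?thesis by (simp add: fun_upd_comp)
    qed
    moreover have "univ B = h ` univ A" using h by (simp add: bij_betw_def)
    ultimately show ?case by (simp add: comp_def)
  }
qed simp_all

text \<open>Categoricity is stated for models of natural numbers, so a countable elementary
  substructure has to be copied there along an enumeration \<open>h\<close> of its elements.\<close>

lemma nat_model:
  assumes M: "models L M T" and T: "\<forall>\<phi>\<in>T. form L 0 \<phi>" and N: "tv_closed L M N" "countable N"
    and inf: "infinite (univ M)"
  shows "\<exists>(N' :: ('f, 'r, nat) struct) h. bij_betw h N (univ N') \<and> infinite (univ N') \<and>
     models L N' T \<and>
     (\<forall>\<phi> u. wf_fm L \<phi> \<and> range u \<subseteq> N \<longrightarrow> (sat M u \<phi> \<longleftrightarrow> sat N' (h \<circ> u) \<phi>))"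
proof -
  let ?A = "M\<lparr>univ := N\<rparr>"
  define h where "h = to_nat_on N"
  have iN: "infinite N" by (rule tv_closed_infinite[OF N(1) inf])
  then have h: "bij_betw h N UNIV" unfolding h_def using N(2) by (rule to_nat_on_infinite[rotated])
  then have inv: "map (inv_into N h) (map h as) = as" if "set as \<subseteq> N" for as
    using that by (induction as) (auto simp: bij_betw_def)
  define N' :: "('f, 'r, nat) struct" where "N' = \<lparr>univ = UNIV,
     funI = (\<lambda>f as. h (funI M f (map (inv_into N h) as))),
     relI = (\<lambda>R as. relI M R (map (inv_into N h) as))\<rparr>"
  have sA: "is_struct L ?A" using M N(1) unfolding models_def by (intro tv_closed_struct) auto
  have iso: "sat ?A u \<phi> \<longleftrightarrow> sat N' (h \<circ> u) \<phi>" if "wf_fm L \<phi>" "u \<in> vals ?A" for \<phi> u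
  proof (rule iso_sat[OF sA _ _ _ that])
    show "bij_betw h (univ ?A) (univ N')" using h by (simp add: N'_def)
    show "\<forall>f\<in>funs L. \<forall>as\<in>tuples ?A (farity L f). h (funI ?A f as) = funI N' f (map h as)"
      using inv by (auto simp: N'_def tuples_def simp del: map_map)
    show "\<forall>R\<in>rels L. \<forall>as\<in>tuples ?A (rarity L R). relI ?A R as \<longleftrightarrow> relI N' R (map h as)"
      using inv by (auto simp: N'_def tuples_def simp del: map_map)
  qed
  have main: "sat M u \<phi> \<longleftrightarrow> sat N' (h \<circ> u) \<phi>" if "wf_fm L \<phi>" "range u \<subseteq> N" for \<phi> u
    using iso[of \<phi> u] tv_closed_sat[OF N(1) that] that by (simp add: vals_def)
  obtain d where d: "d \<in> N" using iN by (metis finite.emptyI equals0I)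
  have "models L N' T"
    unfolding models_def
  proof (intro conjI ballI)
    show "is_struct L N'" by (simp add: is_struct_def N'_def)
    fix \<phi> assume p: "\<phi> \<in> T"
    then have f: "wf_fm L \<phi>" "fv \<phi> = {}" using T by (auto simp: form_def)
    have "sat M (\<lambda>_. d) \<phi>" using M p sat_cong[of \<phi> "(!) []" "\<lambda>_. d" M] f(2)
      unfolding models_def holds_def by auto
    then have "sat N' (h \<circ> (\<lambda>_. d)) \<phi>" using main[OF f(1), of "\<lambda>_. d"] d by auto
    then show "holds N' \<phi> []" unfolding holds_def
      using sat_cong[of \<phi> "(!) []" "h \<circ> (\<lambda>_. d)" N'] f(2) by auto
  qed
  then show ?thesis using main h by (intro exI[of _ N'] exI[of _ h]) (simp add: N'_def)
qed

instance tm :: (countable) countable by countable_datatype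

instance fm :: (countable, countable) countable by countable_datatype

text \<open>The symbol types are arbitrary, only the symbols of \<open>L\<close> are countably many;
  injections into the natural numbers move well-formed formulas into a countable type.\<close>

lemma countable_wf_fm:
  assumes "countable_lang L"
  shows "countable {\<phi>. wf_fm L \<phi>}"
proof -
  obtain f :: "'a \<Rightarrow> nat" where f: "inj_on f (funs L)"
    using assms unfolding countable_lang_def countable_def by blast
  obtain g :: "'b \<Rightarrow> nat" where g: "inj_on g (rels L)"
    using assms unfolding countable_lang_def countable_def by blast
  have tm: "set_tm t \<subseteq> funs L" if "wf_tm L t" for t
    using that by (induction t) auto
  have fm: "set1_fm \<phi> \<subseteq> funs L \<and> set2_fm \<phi> \<subseteq> rels L" if "wf_fm L \<phi>" for \<phi>
    using that by (induction \<phi>) (use tm in auto)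
  have "inj_on (map_fm f g) {\<phi>. wf_fm L \<phi>}"
  proof (rule inj_onI)
    fix x y assume "x \<in> {\<phi>. wf_fm L \<phi>}" "y \<in> {\<phi>. wf_fm L \<phi>}" "map_fm f g x = map_fm f g y"
    then show "x = y" using fm[of x] fm[of y] f g
      by (intro fm.inj_map_strong[of x y f f g g]) (auto dest: inj_onD)
  qed
  then show ?thesis by (rule countableI')
qed

text \<open>Witnesses are added for all formulas and all finite lists of parameters, and this is
  iterated countably often. A formula has finitely many free variables, so all the values it sees
  appear at a common stage.\<close>

lemma loewenheim_skolem:
  assumes "countable_lang L" "countable X" "X \<subseteq> univ S" "X \<noteq> {}"
  shows "\<exists>N. X \<subseteq> N \<and> countable N \<and> tv_closed L S N"
proof -
  obtain d where d: "d \<in> X" using assms(4) by blast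
  \<comment> \<open>Extends a finite list to a total valuation, with the default \<open>d\<close>
    past its end.\<close>
  define val where "val cs j = (if j < length cs then cs ! j else d)" for cs :: "'c list" and j
  define wit where "wit = (\<lambda>(\<phi>, i, cs). SOME a. a \<in> univ S \<and> sat S ((val cs)(i := a)) \<phi>)"
  define g where "g A = A \<union> (wit ` ({\<phi>. wf_fm L \<phi>} \<times> UNIV \<times> lists A) \<inter> univ S)" for A
  define N where "N = (\<Union>k. (g ^^ k) X)"
  have gc: "countable (g A)" if "countable A" for A
    unfolding g_def using that countable_wf_fm[OF assms(1)]
    by (intro countable_Un countable_Int1 countable_image countable_SIGMA countable_lists) auto
  have "countable ((g ^^ k) X)" for k by (induction k) (use assms(2) gc in auto)
  then have "countable N" unfolding N_def by auto
  moreover have "X \<subseteq> N" unfolding N_def using funpow_0[of g X] by blast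
  moreover have "tv_closed L S N"
    unfolding tv_closed_def
  proof (intro conjI allI impI)
    have "(g ^^ k) X \<subseteq> univ S" for k by (induction k) (use assms(3) in \<open>auto simp: g_def\<close>)
    then show "N \<subseteq> univ S" unfolding N_def by blast
    show "N \<noteq> {}" using \<open>X \<subseteq> N\<close> assms(4) by blast
    fix \<phi> i u assume h: "wf_fm L \<phi> \<and> range u \<subseteq> N \<and> (\<exists>a\<in>univ S. sat S (u(i := a)) \<phi>)"
    obtain m where m: "\<forall>j\<in>fv \<phi>. j < m" using finite_nat_set_iff_bounded finite_fv by blast
    have mono: "(g ^^ j) X \<subseteq> (g ^^ k) X" if "j \<le> k" for j k
      by (rule lift_Suc_mono_le[OF _ that]) (auto simp: g_def)
    have "\<forall>j. \<exists>k. u j \<in> (g ^^ k) X" using h unfolding N_def by blast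
    then obtain K where K: "\<And>j. u j \<in> (g ^^ (K j)) X" by metis
    define k where "k = Max (insert 0 (K ` {..<m}))"
    have k: "u j \<in> (g ^^ k) X" if "j < m" for j
      using K[of j] mono[of "K j" k] that by (auto simp: k_def intro: Max_ge)
    define cs where "cs = map u [0..<m]"
    have eq: "sat S ((val cs)(i := a)) \<phi> \<longleftrightarrow> sat S (u(i := a)) \<phi>" for a
      by (rule sat_cong) (use m in \<open>auto simp: val_def cs_def\<close>)
    then have "\<exists>a. a \<in> univ S \<and> sat S ((val cs)(i := a)) \<phi>" using h by blast
    from someI_ex[OF this] have "wit (\<phi>, i, cs) \<in> univ S \<and> sat S ((val cs)(i := wit (\<phi>, i, cs))) \<phi>"
      by (simp only: wit_def prod.case)
    then have w: "wit (\<phi>, i, cs) \<in> univ S" "sat S (u(i := wit (\<phi>, i, cs))) \<phi>"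
      unfolding eq by auto
    have "cs \<in> lists ((g ^^ k) X)" using k by (auto simp: cs_def)
    then have "wit (\<phi>, i, cs) \<in> (g ^^ (Suc k)) X" using w(1) h by (auto simp: g_def)
    then show "\<exists>a\<in>N. sat S (u(i := a)) \<phi>" using w(2) unfolding N_def by blast
  qed
  ultimately show ?thesis by blast
qed

text \<open>Any valuation into the range of \<open>v\<close> is \<open>v\<close> composed with a
  renaming, so it is enough to find witnesses for formulas evaluated at \<open>v\<close> itself.
  That makes the requirements on \<open>v\<close> countable in number.\<close>

lemma tv_closed_range:
  assumes v: "v \<in> vals S"
    and w: "\<And>\<phi> i. wf_fm L \<phi> \<Longrightarrow> \<exists>a\<in>univ S. sat S (v(i := a)) \<phi> \<Longrightarrow> \<exists>k. sat S (v(i := v k)) \<phi>"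
  shows "tv_closed L S (range v)"
  unfolding tv_closed_def
proof (intro conjI allI impI)
  show "range v \<subseteq> univ S" using v by (simp add: vals_def)
  show "range v \<noteq> {}" by simp
  fix \<phi> i u assume h: "wf_fm L \<phi> \<and> range u \<subseteq> range v \<and> (\<exists>a\<in>univ S. sat S (u(i := a)) \<phi>)"
  then have "\<forall>j. \<exists>k. u j = v k" by blast
  then obtain \<sigma> where \<sigma>: "\<And>j. u j = v (\<sigma> j)" by metis
  obtain m where m: "m \<notin> \<sigma> ` fv \<phi>" using ex_new_if_finite[of "\<sigma> ` fv \<phi>"] by auto
  obtain \<phi>' where p: "wf_fm L \<phi>'" "\<And>x. sat S x \<phi>' \<longleftrightarrow> sat S (x \<circ> \<sigma>(i := m)) \<phi>"
    using fm_rename[of L \<phi> "\<sigma>(i := m)" S] h by blast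
  have eq: "sat S (v(m := a)) \<phi>' \<longleftrightarrow> sat S (u(i := a)) \<phi>" for a
    unfolding p(2) by (rule sat_cong) (use m \<sigma> in auto)
  then have "\<exists>k. sat S (v(m := v k)) \<phi>'" using w[OF p(1), of m] h by blast
  then show "\<exists>a\<in>range v. sat S (u(i := a)) \<phi>" using eq by blast
qed

section \<open>The theorem of Ryll-Nardzewski\<close>

lemma same_type_empty:
  "same_type L S {} as bs \<longleftrightarrow> length as = length bs \<and>
     (\<forall>\<phi>. form L (length as) \<phi> \<longrightarrow> holds S \<phi> as = holds S \<phi> bs)"
  unfolding same_type_def by auto

lemma holds_map:
  assumes "form L (length is) \<psi>"
  shows "holds S \<psi> (map v is) \<longleftrightarrow> sat S (v \<circ> (!) is) \<psi>"
  unfolding holds_def by (rule sat_cong) (use assms in \<open>auto simp: form_def\<close>)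

lemma holds_upt:
  assumes "form L n \<psi>"
  shows "holds S \<psi> (map v [0..<n]) \<longleftrightarrow> sat S v \<psi>"
  unfolding holds_def by (rule sat_cong) (use assms in \<open>auto simp: form_def\<close>)

text \<open>Suppose every type of an \<open>n\<close>-tuple is isolated by a formula
  \<open>\<theta> p\<close>. If there are infinitely many types, the negations of these formulas are
  finitely satisfiable, hence jointly satisfied by saturation; the resulting tuple has a type that
  none of the formulas isolates, not even its own.\<close>

lemma nonisolated_type:
  assumes sat: "saturated \<kappa> L S" and k: "natLeq <o \<kappa>" and ne: "univ S \<noteq> {}"
    and inf: "\<nexists>R. finite R \<and> R \<subseteq> tuples S n \<and> (\<forall>x\<in>tuples S n. \<exists>r\<in>R. same_type L S {} x r)"
  shows "\<exists>p\<in>tuples S n. \<forall>\<theta>. form L n \<theta> \<and> holds S \<theta> p \<longrightarrow>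
     (\<exists>q\<in>tuples S n. holds S \<theta> q \<and> \<not> same_type L S {} p q)"
proof (rule ccontr)
  assume c: "\<not> ?thesis"
  have "\<forall>p\<in>tuples S n. \<exists>\<theta>. form L n \<theta> \<and> holds S \<theta> p \<and>
      (\<forall>q\<in>tuples S n. holds S \<theta> q \<longrightarrow> same_type L S {} p q)" using c by blast
  then obtain \<theta> where \<theta>: "\<And>p. p \<in> tuples S n \<Longrightarrow> form L n (\<theta> p)"
    "\<And>p. p \<in> tuples S n \<Longrightarrow> holds S (\<theta> p) p"
    "\<And>p q. p \<in> tuples S n \<Longrightarrow> q \<in> tuples S n \<Longrightarrow> holds S (\<theta> p) q \<Longrightarrow> same_type L S {} p q"
    by metis
  define X where "X p = {v. \<not> sat S v (\<theta> p)}" for p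
  have up: "map v [0..<n] \<in> tuples S n" if "v \<in> vals S" for v
    using that by (auto simp: vals_iff tuples_def)
  have "vals S \<inter> \<Inter>(X ` tuples S n) \<noteq> {}"
  proof (rule omega_saturated[OF sat k ne])
    show "fdef L S UNIV V" if V: "V \<in> X ` tuples S n" for V
    proof -
      obtain p where p: "p \<in> tuples S n" "V = X p" using V by blast
      have "fdef L S UNIV (- {v. sat S v (\<theta> p)})"
        using \<theta>(1)[OF p(1)] by (intro fdef_compl fdefI) (auto simp: form_def)
      moreover have "- {v. sat S v (\<theta> p)} = V" unfolding p(2) X_def by auto
      ultimately show ?thesis by simp
    qed
    fix \<V>' assume "finite \<V>'" "\<V>' \<subseteq> X ` tuples S n"
    then obtain J where J: "J \<subseteq> tuples S n" "finite J" "\<V>' = X ` J" by (meson finite_subset_image)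
    then have "\<not> (\<forall>x\<in>tuples S n. \<exists>r\<in>J. same_type L S {} x r)" using inf by metis
    then obtain q where q: "q \<in> tuples S n" "\<And>r. r \<in> J \<Longrightarrow> \<not> same_type L S {} q r"
      by metis
    obtain d where d: "d \<in> univ S" using ne by blast
    define v where "v i = (if i < n then q ! i else d)" for i
    have v: "v \<in> vals S" "map v [0..<n] = q"
      using q(1) d by (auto simp: v_def vals_iff tuples_def subset_iff intro!: nth_equalityI)
    have "v \<in> X r" if r: "r \<in> J" for r
    proof (rule ccontr)
      assume "v \<notin> X r"
      then have "holds S (\<theta> r) q"
        using holds_upt[of L n "\<theta> r" S v] v(2) \<theta>(1) J(1) r unfolding X_def by auto
      then have "same_type L S {} r q" using \<theta>(3) J(1) r q(1) by blast
      then show False using q(2)[OF r] by (auto simp: same_type_empty)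
    qed
    then show "vals S \<inter> \<Inter>\<V>' \<noteq> {}" using v(1) J(3) by blast
  qed
  then obtain v where v: "v \<in> vals S" "\<And>p. p \<in> tuples S n \<Longrightarrow> \<not> sat S v (\<theta> p)"
    unfolding X_def by blast
  show False using v(2)[OF up[OF v(1)]] \<theta>(1,2)[OF up[OF v(1)]] holds_upt by blast
qed

text \<open>A generic valuation meets two countable lists of requirements: \<open>tv\<close> makes
  its range an elementary substructure, and \<open>om\<close> keeps every \<open>n\<close>-tuple of
  its values from realising the type of \<open>p\<close>.\<close>

lemma omitting_types:
  fixes S :: "('f, 'r, 'a) struct"
  assumes sat: "saturated \<kappa> L S" and k: "natLeq <o \<kappa>" and ne: "univ S \<noteq> {}"
    and cl: "countable_lang L" and p: "p \<in> tuples S n"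
    and ni: "\<And>\<theta>. form L n \<theta> \<Longrightarrow> holds S \<theta> p \<Longrightarrow>
       \<exists>q\<in>tuples S n. holds S \<theta> q \<and> \<not> same_type L S {} p q"
  shows "\<exists>N. tv_closed L S N \<and> countable N \<and> (\<forall>q. set q \<subseteq> N \<longrightarrow> \<not> same_type L S {} p q)"
proof -
  define tv where "tv = (\<lambda>(\<phi>, i) v. (\<exists>a\<in>univ S. sat S (v(i := a)) \<phi>) \<longrightarrow> (\<exists>k :: nat. sat S (v(i := v k)) \<phi>))"
  define om where "om is v \<longleftrightarrow> \<not> same_type L S {} p (map v is)" for "is" :: "nat list" and v
  define \<R> where "\<R> = tv ` ({\<phi>. wf_fm L \<phi>} \<times> (UNIV :: nat set)) \<union> om ` {is. length is = n}"
  have "\<exists>v\<in>vals S. \<forall>\<rho>\<in>\<R>. \<rho> v"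
  proof (rule generic_valuation[OF sat k ne])
    show "countable \<R>" unfolding \<R>_def
      by (intro countable_Un countable_image countable_SIGMA countable_wf_fm[OF cl]) auto
    fix \<rho> V assume r: "\<rho> \<in> \<R>" and V0: "fdef L S UNIV V" and Vne: "vals S \<inter> V \<noteq> {}"
    obtain F where F: "finite F" "fdef L S F V" using fdef_finite[OF V0] by blast
    show "\<exists>V'. fdef L S UNIV V' \<and> V' \<subseteq> V \<and> vals S \<inter> V' \<noteq> {} \<and> (\<forall>v\<in>vals S \<inter> V'. \<rho> v)"
    proof (cases "\<rho> \<in> tv ` ({\<phi>. wf_fm L \<phi>} \<times> (UNIV :: nat set))")
      case True
      then obtain \<phi> i where \<phi>: "wf_fm L \<phi>" "\<rho> = tv (\<phi>, i)" by blast
      \<comment> \<open>Variable \<open>m\<close> is free for use as a witness: changing it affects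
        neither membership in \<open>V\<close> nor the formula.\<close>
      obtain m where m: "m \<notin> F \<union> fv \<phi> \<union> {i}" using ex_new_if_finite[of "F \<union> fv \<phi> \<union> {i}"] F by auto
      let ?E = "{v. \<exists>a\<in>univ S. v(i := a) \<in> {v. sat S v \<phi>}}"
      let ?R = "{v. v \<circ> id(i := m) \<in> {v. sat S v \<phi>}}"
      define V' where "V' = V \<inter> - (?E \<inter> - ?R)"
      have f: "fdef L S UNIV {v. sat S v \<phi>}" using \<phi> by (intro fdefI) auto
      have e: "fdef L S UNIV ?E" by (rule fdef_mono[OF fdef_ex[OF f]]) simp
      have rr: "fdef L S UNIV ?R" by (rule fdef_mono[OF fdef_rename[OF f]]) simp
      have "fdef L S (UNIV \<union> (UNIV \<union> UNIV)) V'"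
        unfolding V'_def by (intro fdef_Int fdef_compl V0 e rr)
      then have "fdef L S UNIV V'" by simp
      moreover have "\<rho> v" if v: "v \<in> V'" for v
        unfolding \<phi>(2) tv_def prod.case
      proof
        assume "\<exists>a\<in>univ S. sat S (v(i := a)) \<phi>"
        then have "sat S (v \<circ> id(i := m)) \<phi>" using v unfolding V'_def by blast
        moreover have "v \<circ> id(i := m) = v(i := v m)" by auto
        ultimately show "\<exists>k. sat S (v(i := v k)) \<phi>" by auto
      qed
      moreover have "vals S \<inter> V' \<noteq> {}"
      proof -
        obtain v where v: "v \<in> vals S" "v \<in> V" using Vne by blast
        show ?thesis
        proof (cases "v \<in> ?E")
          case False
          then show ?thesis using v unfolding V'_def by blast
        next
          case True
          then obtain a where a: "a \<in> univ S" "sat S (v(i := a)) \<phi>" by blast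
          have "v(m := a) \<in> V \<longleftrightarrow> v \<in> V" by (rule fdef_cong[OF F(2)]) (use m in auto)
          moreover have "sat S ((v(m := a)) \<circ> id(i := m)) \<phi> \<longleftrightarrow> sat S (v(i := a)) \<phi>"
            by (rule sat_cong) (use m in auto)
          moreover have "v(m := a) \<in> vals S" using v a by (simp add: vals_iff)
          ultimately have "v(m := a) \<in> vals S \<inter> V'" using v a unfolding V'_def by blast
          then show ?thesis by blast
        qed
      qed
      moreover have "V' \<subseteq> V" unfolding V'_def by blast
      ultimately show ?thesis by blast
    next
      case False
      then obtain "is" where i: "length is = n" "\<rho> = om is" using r unfolding \<R>_def by blast
      have mt: "map v is \<in> tuples S n" if "v \<in> vals S" for v
        using that i by (auto simp: tuples_def vals_iff)
      have "\<exists>v\<in>vals S \<inter> V. \<not> same_type L S {} p (map v is)"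
      proof (rule ccontr)
        assume c: "\<not> ?thesis"
        \<comment> \<open>If \<open>V\<close> forced the variables \<open>is\<close> to realise the
          type of \<open>p\<close>, its projection to them would isolate this type. To write the
          projection down, all variables of \<open>V\<close> are shifted by \<open>n\<close> and the
          first \<open>n\<close> variables are equated with the shifted copies of
          \<open>is\<close>.\<close>
        define G where "G = F \<union> set is"
        define I where "I = (+) n ` G"
        let ?V1 = "{v. v \<circ> (+) n \<in> V}"
        let ?V2 = "\<Inter>((\<lambda>j. {v :: nat \<Rightarrow> 'a. v (n + is ! j) = v j}) ` {..<n})"
        let ?Z = "{..<n} \<union> I"
        have "fdef L S ?Z ?V1" by (rule fdef_mono[OF fdef_rename[OF F(2)]]) (auto simp: I_def G_def)
        moreover have "fdef L S ?Z ?V2"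
        proof (rule fdef_INT[OF ne])
          fix W assume "W \<in> (\<lambda>j. {v :: nat \<Rightarrow> 'a. v (n + is ! j) = v j}) ` {..<n}"
          then obtain j where j: "j < n" "W = {v. v (n + is ! j) = v j}" by auto
          have "fdef L S ?Z {v. sat S v (Eq (Var (n + is ! j)) (Var j))}"
            using j i by (intro fdefI) (auto simp: I_def G_def)
          then show "fdef L S ?Z W" using j by simp
        qed simp
        ultimately have "fdef L S (?Z \<union> ?Z) (?V1 \<inter> ?V2)" by (rule fdef_Int)
        then have "fdef L S ?Z (?V1 \<inter> ?V2)" by simp
        from fdef_ex_finite[OF this, of I]
        have "fdef L S (?Z - I) {v. \<exists>w. (\<forall>i\<in>I. w i \<in> univ S) \<and> (\<forall>i. i \<notin> I \<longrightarrow> w i = v i) \<and>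
            w \<in> ?V1 \<inter> ?V2}" (is "fdef _ _ _ ?X")
          using F by (simp add: I_def G_def)
        then have "fdef L S {..<n} ?X" by (rule fdef_mono) auto
        then obtain \<theta> where \<theta>: "form L n \<theta>" "{v. sat S v \<theta>} = ?X" unfolding fdef_def form_def by metis
        have th: "holds S \<theta> q \<longleftrightarrow> (\<exists>v\<in>vals S \<inter> V. map v is = q)" if q: "q \<in> tuples S n" for q
        proof
          assume "holds S \<theta> q"
          then have "(!) q \<in> ?X" using \<theta>(2) unfolding holds_def by blast
          then obtain w where w: "\<forall>i\<in>I. w i \<in> univ S" "\<forall>i. i \<notin> I \<longrightarrow> w i = q ! i" "w \<in> ?V1 \<inter> ?V2"
            by blast
          obtain d where d: "d \<in> univ S" using ne by blast
          define v where "v i = (if i \<in> G then w (n + i) else d)" for i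
          have "v \<in> V \<longleftrightarrow> w \<circ> (+) n \<in> V" by (rule fdef_cong[OF F(2)]) (auto simp: v_def G_def)
          moreover have "v \<in> vals S" using w(1) d by (auto simp: vals_iff v_def I_def)
          moreover have "map v is = q"
          proof (rule nth_equalityI)
            show "length (map v is) = length q" using q i by (simp add: tuples_def)
            fix j assume j: "j < length (map v is)"
            then have "v (is ! j) = w (n + is ! j)" by (simp add: v_def G_def)
            also have "\<dots> = w j" using w(3) j i by auto
            also have "\<dots> = q ! j"
            proof -
              have "j \<notin> I" using j i by (auto simp: I_def)
              then show ?thesis using w(2) by blast
            qed
            finally show "map v is ! j = q ! j" using j by simp
          qed
          ultimately show "\<exists>v\<in>vals S \<inter> V. map v is = q" using w(3) by blast
        next
          assume "\<exists>v\<in>vals S \<inter> V. map v is = q"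
          then obtain v where v: "v \<in> vals S" "v \<in> V" "map v is = q" by blast
          define w where "w i = (if i \<in> I then v (i - n) else q ! i)" for i
          have "w \<circ> (+) n \<in> V \<longleftrightarrow> v \<in> V"
            by (rule fdef_cong[OF F(2)]) (auto simp: w_def I_def G_def)
          moreover have "w (n + is ! j) = w j" if "j < n" for j
            using that i v(3) by (auto simp: w_def I_def G_def)
          ultimately have "(!) q \<in> ?X" using v(1,2)
            by (auto simp: w_def vals_iff intro!: exI[of _ w])
          then show "holds S \<theta> q" using \<theta>(2) unfolding holds_def by blast
        qed
        obtain u where u: "u \<in> vals S \<inter> V" using Vne by blast
        then have "same_type L S {} p (map u is)" using c by blast
        moreover have "holds S \<theta> (map u is)" using th[OF mt] u by blast
        \<comment> \<open>Hence some \<open>q\<close> of another type satisfies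
          \<open>\<theta>\<close> too, and \<open>q\<close> is then the value of \<open>is\<close>
          under a valuation in \<open>V\<close>, against the assumption \<open>c\<close>.\<close>
        ultimately have "holds S \<theta> p" using \<theta>(1) p by (auto simp: same_type_empty tuples_def)
        from ni[OF \<theta>(1) this] obtain q where q: "q \<in> tuples S n" "holds S \<theta> q"
          "\<not> same_type L S {} p q" by blast
        then show False using th[OF q(1)] c by blast
      qed
      then obtain v where v: "v \<in> vals S" "v \<in> V" "\<not> same_type L S {} p (map v is)" by blast
      then obtain \<psi>0 where "form L n \<psi>0" "holds S \<psi>0 p \<noteq> holds S \<psi>0 (map v is)"
        using p i by (auto simp: same_type_empty tuples_def)
      then obtain \<psi> where \<psi>: "form L n \<psi>" "holds S \<psi> p" "\<not> holds S \<psi> (map v is)"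
      proof (cases "holds S \<psi>0 p")
        case False
        then show ?thesis using that[of "Neg \<psi>0"] \<open>form L n \<psi>0\<close>
            \<open>holds S \<psi>0 p \<noteq> holds S \<psi>0 (map v is)\<close> by (auto simp: form_def holds_def)
      qed (use that in blast)
      define V' where "V' = V \<inter> - {v. v \<circ> (!) is \<in> {v. sat S v \<psi>}}"
      have "fdef L S UNIV {v. v \<circ> (!) is \<in> {v. sat S v \<psi>}}"
        by (rule fdef_mono[OF fdef_rename[OF fdefI[of L \<psi> UNIV S]]])
          (use \<psi>(1) in \<open>auto simp: form_def\<close>)
      then have "fdef L S (UNIV \<union> UNIV) V'" unfolding V'_def by (intro fdef_Int V0 fdef_compl)
      moreover have "v \<in> V'"
        using v(2) \<psi>(1,3) holds_map[of L "is" \<psi> S v] i(1) unfolding V'_def by auto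
      moreover have "\<rho> v'" if "v' \<in> V'" for v'
        using that \<psi>(1,2) holds_map[of L "is" \<psi> S v'] i p unfolding V'_def i(2) om_def
        by (auto simp: same_type_empty tuples_def)
      ultimately show ?thesis using v(1) unfolding V'_def by (intro exI[of _ V']) (auto simp: V'_def)
    qed
  qed
  then obtain v where v: "v \<in> vals S" "\<And>\<rho>. \<rho> \<in> \<R> \<Longrightarrow> \<rho> v" by blast
  have "tv (\<phi>, i) v" if "wf_fm L \<phi>" for \<phi> i using that v(2) unfolding \<R>_def by blast
  then have "tv_closed L S (range v)"
    by (intro tv_closed_range[OF v(1)]) (auto simp: tv_def)
  moreover have "\<not> same_type L S {} p q" if q: "set q \<subseteq> range v" for q
  proof
    assume s: "same_type L S {} p q"
    have "\<forall>x\<in>set q. \<exists>i. x = v i" using q by blast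
    then obtain g where "\<forall>x\<in>set q. x = v (g x)" by metis
    then have "map v (map g q) = q" by (simp add: map_idI)
    moreover have "length (map g q) = n" using s p by (simp add: same_type_empty tuples_def)
    then have "om (map g q) v" using v(2) unfolding \<R>_def by blast
    ultimately show False using s unfolding om_def by simp
  qed
  ultimately show ?thesis by (intro exI[of _ "range v"]) auto
qed

theorem ryll_nardzewski:
  fixes L :: "('f, 'r) lang" and T :: "('f, 'r) fm set" and M :: "('f, 'r, 'a) struct"
  assumes cl: "countable_lang L" and ct: "complete_theory L T" and cat: "omega_categorical L T"
    and k: "natLeq <o \<kappa>" and M: "models L M T" and sat: "saturated \<kappa> L M"
  shows "\<exists>R. finite R \<and> R \<subseteq> tuples M n \<and> (\<forall>x\<in>tuples M n. \<exists>r\<in>R. same_type L M {} x r)"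
proof (cases "finite (univ M)")
  case True
  then have "finite (tuples M n)" unfolding tuples_def by (rule finite_lists_length_eq)
  then show ?thesis by (intro exI[of _ "tuples M n"]) (auto simp: same_type_empty)
next
  case inf: False
  show ?thesis
  proof (rule ccontr)
    assume c: "\<not> ?thesis"
    have ne: "univ M \<noteq> {}" using inf by auto
    have T: "\<forall>\<phi>\<in>T. form L 0 \<phi>" using ct by (simp add: complete_theory_def)
    obtain p where p: "p \<in> tuples M n" "\<And>\<theta>. form L n \<theta> \<Longrightarrow> holds M \<theta> p \<Longrightarrow>
       \<exists>q\<in>tuples M n. holds M \<theta> q \<and> \<not> same_type L M {} p q"
      using nonisolated_type[OF sat k ne c] by blast
    obtain N1 where N1: "tv_closed L M N1" "countable N1"
      "\<And>q. set q \<subseteq> N1 \<Longrightarrow> \<not> same_type L M {} p q"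
      using omitting_types[OF sat k ne cl p] by blast
    obtain d where "d \<in> univ M" using ne by blast
    then obtain N2 where N2: "insert d (set p) \<subseteq> N2" "countable N2" "tv_closed L M N2"
      using loewenheim_skolem[OF cl, of "insert d (set p)" M] p(1)
      by (auto simp: tuples_def countable_finite)
    obtain A1 :: "('f, 'r, nat) struct" and h1 where A1: "bij_betw h1 N1 (univ A1)"
      "infinite (univ A1)" "models L A1 T"
      "\<And>\<phi> u. wf_fm L \<phi> \<Longrightarrow> range u \<subseteq> N1 \<Longrightarrow> sat M u \<phi> \<longleftrightarrow> sat A1 (h1 \<circ> u) \<phi>"
      using nat_model[OF M T N1(1,2) inf] by blast
    obtain A2 :: "('f, 'r, nat) struct" and h2 where A2: "bij_betw h2 N2 (univ A2)"
      "infinite (univ A2)" "models L A2 T"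
      "\<And>\<phi> u. wf_fm L \<phi> \<Longrightarrow> range u \<subseteq> N2 \<Longrightarrow> sat M u \<phi> \<longleftrightarrow> sat A2 (h2 \<circ> u) \<phi>"
      using nat_model[OF M T N2(3,2) inf] by blast
    have "isomorphic L A2 A1" using cat A1 A2 unfolding omega_categorical_def by blast
    then obtain g where g: "bij_betw g (univ A2) (univ A1)"
      "\<forall>f\<in>funs L. \<forall>as\<in>tuples A2 (farity L f). g (funI A2 f as) = funI A1 f (map g as)"
      "\<forall>R\<in>rels L. \<forall>as\<in>tuples A2 (rarity L R). relI A2 R as \<longleftrightarrow> relI A1 R (map g as)"
      unfolding isomorphic_def by blast
    have sA2: "is_struct L A2" using A2(3) by (simp add: models_def)
    \<comment> \<open>The composite through both copies and the isomorphism is an elementary map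
      from \<open>N2\<close> to \<open>N1\<close>, so it carries \<open>p\<close> to a realisation
      of its type in \<open>N1\<close>.\<close>
    define h where "h x = inv_into N1 h1 (g (h2 x))" for x
    have hN: "h x \<in> N1" "h1 (h x) = g (h2 x)" if "x \<in> N2" for x
    proof -
      have "h2 x \<in> univ A2" using A2(1) that by (auto simp: bij_betw_def)
      then have "g (h2 x) \<in> univ A1" using g(1) by (auto simp: bij_betw_def)
      then have *: "g (h2 x) \<in> h1 ` N1" using A1(1) by (simp add: bij_betw_def)
      show "h x \<in> N1" "h1 (h x) = g (h2 x)"
        unfolding h_def using inv_into_into[OF *] f_inv_into_f[OF *] by auto
    qed
    have "same_type L M {} p (map h p)"
      unfolding same_type_empty
    proof (intro conjI allI impI)
      fix \<psi> assume \<psi>: "form L (length p) \<psi>"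
      define u where "u i = (if i < length p then p ! i else d)" for i
      have u: "range u \<subseteq> N2" using N2(1) by (auto simp: u_def)
      have wf: "wf_fm L \<psi>" using \<psi> by (simp add: form_def)
      have "holds M \<psi> p \<longleftrightarrow> sat M u \<psi>"
        unfolding holds_def by (rule sat_cong) (use \<psi> in \<open>auto simp: form_def u_def\<close>)
      also have "\<dots> \<longleftrightarrow> sat A2 (h2 \<circ> u) \<psi>" by (rule A2(4)[OF wf u])
      also have "\<dots> \<longleftrightarrow> sat A1 (g \<circ> (h2 \<circ> u)) \<psi>"
        by (rule iso_sat[OF sA2 g wf]) (use u A2(1) in \<open>auto simp: vals_iff bij_betw_def\<close>)
      also have "g \<circ> (h2 \<circ> u) = h1 \<circ> (h \<circ> u)"
      proof
        fix i show "(g \<circ> (h2 \<circ> u)) i = (h1 \<circ> (h \<circ> u)) i" using hN(2)[of "u i"] range_subsetD[OF u, of i] by simp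
      qed
      also have "sat A1 (h1 \<circ> (h \<circ> u)) \<psi> \<longleftrightarrow> sat M (h \<circ> u) \<psi>"
        by (rule A1(4)[OF wf, symmetric]) (use u hN(1) in auto)
      also have "\<dots> \<longleftrightarrow> holds M \<psi> (map h p)"
        unfolding holds_def by (rule sat_cong) (use \<psi> in \<open>auto simp: form_def u_def\<close>)
      finally show "holds M \<psi> p = holds M \<psi> (map h p)" .
    qed simp
    moreover have "set (map h p) \<subseteq> N1" using hN(1) N2(1) by auto
    ultimately show False using N1(3) by blast
  qed
qed

section \<open>Algebraic closure and dimension\<close>

text \<open>What is used of the structure of imaginaries, free of formulas. Finiteness of types and
  compactness are relative to a sort, since both fail across infinitely many sorts. In compactness,
  definable sets are replaced by sets invariant under equality of types over a finite set, which
  amounts to the same inside a sort with finitely many such types.\<close>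

locale elementary_maps =
  fixes U :: "'a set" and pe :: "('a \<times> 'a) set \<Rightarrow> bool" and sm :: "'a set \<Rightarrow> bool"
    and srt :: "'a \<Rightarrow> 's" and h :: 's
  assumes pe_subset: "pe P \<Longrightarrow> P \<subseteq> U \<times> U"
    and pe_finite: "P \<subseteq> U \<times> U \<Longrightarrow> (\<And>Q. finite Q \<Longrightarrow> Q \<subseteq> P \<Longrightarrow> pe Q) \<Longrightarrow> pe P"
    and pe_mono: "pe P \<Longrightarrow> Q \<subseteq> P \<Longrightarrow> pe Q"
    and pe_Id_on: "A \<subseteq> U \<Longrightarrow> pe (Id_on A)"
    and pe_converse: "pe P \<Longrightarrow> pe (P\<inverse>)"
    and pe_relcomp: "pe P \<Longrightarrow> pe Q \<Longrightarrow> pe (P O Q)"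
    and pe_fun: "pe P \<Longrightarrow> (a, b) \<in> P \<Longrightarrow> (a, c) \<in> P \<Longrightarrow> b = c"
    and pe_sort: "pe P \<Longrightarrow> (a, b) \<in> P \<Longrightarrow> srt a = srt b"
    and forth: "pe P \<Longrightarrow> finite P \<Longrightarrow> d \<in> U \<Longrightarrow> \<exists>d'. pe (insert (d, d') P)"
    and types: "finite A \<Longrightarrow> A \<subseteq> U \<Longrightarrow> \<exists>R. finite R \<and> R \<subseteq> U \<and>
       (\<forall>x\<in>U. srt x = s \<longrightarrow> (\<exists>r\<in>R. pe (insert (x, r) (Id_on A))))"
    and compactness: "sm B \<Longrightarrow> a \<in> U \<Longrightarrow>
       (\<And>W. W \<in> \<W> \<Longrightarrow> W \<subseteq> U \<and> (\<exists>C. finite C \<and> C \<subseteq> B \<and>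
           (\<forall>x\<in>W. \<forall>y. pe (insert (x, y) (Id_on C)) \<longrightarrow> y \<in> W))) \<Longrightarrow>
       (\<And>\<W>'. finite \<W>' \<Longrightarrow> \<W>' \<subseteq> \<W> \<Longrightarrow> \<exists>x\<in>U. srt x = srt a \<and> x \<in> \<Inter>\<W>') \<Longrightarrow>
       \<exists>x\<in>U. srt x = srt a \<and> x \<in> \<Inter>\<W>"
    and sm_subset: "sm B \<Longrightarrow> B \<subseteq> U"
    and sm_finite: "finite B \<Longrightarrow> B \<subseteq> U \<Longrightarrow> sm B"
    and sm_Un: "sm A \<Longrightarrow> sm B \<Longrightarrow> sm (A \<union> B)"
    and sm_mono: "sm B \<Longrightarrow> A \<subseteq> B \<Longrightarrow> sm A"
begin

section \<open>The closure operator given by finite orbits\<close>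

abbreviation eqv :: "'a set \<Rightarrow> 'a \<Rightarrow> 'a \<Rightarrow> bool" where
  "eqv C a b \<equiv> pe (insert (a, b) (Id_on C))"

definition cl :: "'a set \<Rightarrow> 'a set" where
  "cl A = {a \<in> U. \<exists>C. finite C \<and> C \<subseteq> A \<and> finite {x. eqv C a x}}"

definition H :: "'a set" where
  "H = {a \<in> U. srt a = h}"

lemma pe_inj: "pe P \<Longrightarrow> (b, a) \<in> P \<Longrightarrow> (c, a) \<in> P \<Longrightarrow> b = c"
  using pe_fun[OF pe_converse] by fast

lemma eqv_refl: "a \<in> U \<Longrightarrow> C \<subseteq> U \<Longrightarrow> eqv C a a"
  by (rule pe_mono[OF pe_Id_on[of "insert a C"]]) auto

lemma eqv_sym: "eqv C a b \<Longrightarrow> eqv C b a"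
  by (drule pe_converse) (erule pe_mono, auto)

lemma eqv_trans: "eqv C a b \<Longrightarrow> eqv C b c \<Longrightarrow> eqv C a c"
  by (drule (1) pe_relcomp) (erule pe_mono, auto)

lemma eqv_mono: "eqv D a b \<Longrightarrow> C \<subseteq> D \<Longrightarrow> eqv C a b"
  by (erule pe_mono) auto

lemma sm_Un_finite: "sm A \<Longrightarrow> finite B \<Longrightarrow> B \<subseteq> U \<Longrightarrow> sm (A \<union> B)"
  by (rule sm_Un[OF _ sm_finite])

lemma eqvD: "eqv C a b \<Longrightarrow> a \<in> U" "eqv C a b \<Longrightarrow> b \<in> U" "eqv C a b \<Longrightarrow> C \<subseteq> U"
  by (auto dest!: pe_subset)

lemma cl_subset: "cl A \<subseteq> U"
  unfolding cl_def by blast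

lemma cl_mono: "A \<subseteq> B \<Longrightarrow> cl A \<subseteq> cl B"
  unfolding cl_def by blast

lemma cl_superset: "A \<subseteq> U \<Longrightarrow> A \<subseteq> cl A"
proof
  fix a assume a: "A \<subseteq> U" "a \<in> A"
  have "{x. eqv {a} a x} \<subseteq> {a}" using pe_fun by blast
  then have "finite {x. eqv {a} a x}" by (rule finite_subset) simp
  then show "a \<in> cl A" using a unfolding cl_def by (auto intro!: exI[of _ "{a}"])
qed

lemma forth_set:
  assumes "finite Z" "pe P" "finite P" "Z \<subseteq> U"
  shows "\<exists>P'. P \<subseteq> P' \<and> pe P' \<and> finite P' \<and> Z \<subseteq> Domain P'"
  using assms
proof (induction rule: finite_induct)
  case (insert z Z)
  then obtain P' where P': "P \<subseteq> P'" "pe P'" "finite P'" "Z \<subseteq> Domain P'" by auto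
  obtain z' where "pe (insert (z, z') P')" using forth[OF P'(2,3)] insert.prems by blast
  then show ?case using P' by (intro exI[of _ "insert (z, z') P'"]) auto
qed auto

text \<open>Orbit sizes are preserved by elementary maps: a finite set of conjugates on the range
  side is pulled back injectively by extending the converse of \<open>P\<close> to it.\<close>

lemma finite_orbit_pe:
  assumes P: "pe P" "finite P" and ab: "(a, b) \<in> P" and C: "C \<subseteq> Domain P"
    and fin: "finite {x. eqv C a x}"
  shows "finite {y. eqv (P `` C) b y}"
proof (rule ccontr)
  assume "infinite {y. eqv (P `` C) b y}"
  \<comment> \<open>One conjugate more than the orbit of \<open>a\<close> can accommodate.\<close>
  then obtain Z where Z: "Z \<subseteq> {y. eqv (P `` C) b y}" "finite Z" "card Z = Suc (card {x. eqv C a x})"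
    using infinite_arbitrarily_large by blast
  have ZU: "Z \<subseteq> U" using Z(1) eqvD(2) by blast
  obtain P' where P': "P\<inverse> \<subseteq> P'" "pe P'" "Z \<subseteq> Domain P'"
    using forth_set[OF Z(2) pe_converse[OF P(1)] _ ZU] P(2) by auto
  then have "\<forall>z\<in>Z. \<exists>x. (z, x) \<in> P'" by blast
  then obtain g where g: "\<And>z. z \<in> Z \<Longrightarrow> (z, g z) \<in> P'" by metis
  have "eqv C a (g z)" if z: "z \<in> Z" for z
  proof -
    have "eqv (P `` C) b z" using Z(1) z by blast
    then have "pe (P O insert (b, z) (Id_on (P `` C)) O P')" using P(1) P'(2) by (intro pe_relcomp)
    moreover have "(c, c) \<in> P O insert (b, z) (Id_on (P `` C)) O P'" if c: "c \<in> C" for c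
    proof -
      obtain c' where c': "(c, c') \<in> P" using C c by blast
      then have "(c', c') \<in> Id_on (P `` C)" "(c', c) \<in> P'" using P'(1) c by auto
      then show ?thesis using c' by blast
    qed
    moreover have "(a, g z) \<in> P O insert (b, z) (Id_on (P `` C)) O P'" using ab g[OF z] by blast
    ultimately show ?thesis by (elim pe_mono) auto
  qed
  then have "g ` Z \<subseteq> {x. eqv C a x}" by blast
  moreover have "inj_on g Z" using g pe_inj[OF P'(2)] by (metis inj_onI)
  ultimately have "card Z \<le> card {x. eqv C a x}" using fin by (metis card_image card_mono)
  then show False using Z(3) by simp
qed

lemma cl_pe:
  assumes P: "pe P" and ab: "(a, b) \<in> P" and A: "A \<subseteq> Domain P" and a: "a \<in> cl A"
  shows "b \<in> cl (P `` A)"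
proof -
  obtain C where C: "finite C" "C \<subseteq> A" "finite {x. eqv C a x}" using a unfolding cl_def by blast
  \<comment> \<open>\<open>P\<close> may be infinite while the back-and-forth needs a finite map;
    the restriction to \<open>a\<close> and \<open>C\<close> is finite because \<open>P\<close> is
    single-valued.\<close>
  define Q where "Q = {(x, y) \<in> P. x \<in> insert a C}"
  have Q: "pe Q" using P by (rule pe_mono) (auto simp: Q_def)
  have "inj_on fst Q" using pe_fun[OF P] by (auto simp: Q_def inj_on_def)
  moreover have "fst ` Q \<subseteq> insert a C" by (auto simp: Q_def)
  ultimately have "finite Q" using C(1) by (meson finite.insertI finite_imageD finite_subset)
  then have "finite {y. eqv (Q `` C) b y}"
    using C A ab by (intro finite_orbit_pe[OF Q _ _ _ C(3)]) (auto simp: Q_def)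
  moreover have "Q `` C \<subseteq> P `` A" using C(2) by (auto simp: Q_def)
  moreover have "finite (Q `` C)" using \<open>finite Q\<close> by (rule finite_Image)
  moreover have "b \<in> U" using pe_subset[OF P] ab by blast
  ultimately show ?thesis unfolding cl_def by blast
qed

lemma cl_pe_iff:
  assumes P: "pe P" and ab: "(a, b) \<in> P" and A: "A \<subseteq> Domain P"
  shows "b \<in> cl (P `` A) \<longleftrightarrow> a \<in> cl A"
proof
  assume b: "b \<in> cl (P `` A)"
  have "a \<in> cl (P\<inverse> `` (P `` A))"
    by (rule cl_pe[OF pe_converse[OF P] _ _ b]) (use ab in auto)
  moreover have "P\<inverse> `` (P `` A) \<subseteq> A" using pe_inj[OF P] by blast
  ultimately show "a \<in> cl A" using cl_mono by blast
qed (rule cl_pe[OF P ab A])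

text \<open>Over a finite set \<open>E\<close> the elements of \<open>C\<close> have finitely many
  conjugates. If \<open>a\<close> had infinitely many conjugates over \<open>E\<close>, then
  infinitely many of them would come with the same image of \<open>C\<close>, and these would be
  conjugate to each other over that image, whereas the orbit of \<open>a\<close> over
  \<open>C\<close> is finite.\<close>

lemma cl_trans:
  assumes B: "B \<subseteq> cl A" and A: "A \<subseteq> U" and a: "a \<in> cl B"
  shows "a \<in> cl A"
proof -
  obtain C where C: "finite C" "C \<subseteq> B" "finite {x. eqv C a x}" using a unfolding cl_def by blast
  have aU: "a \<in> U" and CU: "C \<subseteq> U" using a C(2) B cl_subset by blast+
  have "\<exists>D. \<forall>c\<in>C. finite (D c) \<and> D c \<subseteq> A \<and> finite {x. eqv (D c) c x}"
    using C(2) B unfolding cl_def by (intro bchoice) blast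
  then obtain D where D: "\<And>c. c \<in> C \<Longrightarrow> finite (D c) \<and> D c \<subseteq> A \<and> finite {x. eqv (D c) c x}"
    by blast
  define E where "E = \<Union>(D ` C)"
  have E: "finite E" "E \<subseteq> A" unfolding E_def using C(1) D by auto
  define Y where "Y = (\<Union>c\<in>C. {x. eqv E c x})"
  have "{x. eqv E c x} \<subseteq> {x. eqv (D c) c x}" if "c \<in> C" for c
    using eqv_mono[of c _ E "D c"] that unfolding E_def by blast
  then have Y: "finite Y" unfolding Y_def using C(1) D by (meson finite_UN finite_subset)
  have "finite {x. eqv E a x}"
  proof (rule ccontr)
    assume inf: "infinite {x. eqv E a x}"
    have "\<exists>P. pe P \<and> finite P \<and> insert (a, x) (Id_on E) \<subseteq> P \<and> C \<subseteq> Domain P"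
      if "eqv E a x" for x
      using forth_set[OF C(1) that _ CU] E(1) by (auto simp: Id_on_def)
    then obtain P where P: "\<And>x. eqv E a x \<Longrightarrow>
        pe (P x) \<and> finite (P x) \<and> insert (a, x) (Id_on E) \<subseteq> P x \<and> C \<subseteq> Domain (P x)" by metis
    \<comment> \<open>The image of \<open>C\<close> that accompanies the conjugate \<open>x\<close>
      of \<open>a\<close>; only finitely many such images exist.\<close>
    define g where "g x = P x \<inter> C \<times> UNIV" for x
    have "g ` {x. eqv E a x} \<subseteq> Pow (C \<times> Y)"
    proof clarsimp
      fix x c y assume x: "eqv E a x" and "(c, y) \<in> g x"
      then have cy: "(c, y) \<in> P x" "c \<in> C" by (auto simp: g_def)
      have "pe (P x)" "Id_on E \<subseteq> P x" using P[OF x] by auto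
      then have "eqv E c y" using cy(1) by (elim pe_mono) auto
      then show "c \<in> C \<and> y \<in> Y" using cy(2) by (auto simp: Y_def)
    qed
    then have "finite (g ` {x. eqv E a x})" using C(1) Y
      by (meson finite_Pow_iff finite_SigmaI finite_subset)
    then obtain x0 where x0: "eqv E a x0" "infinite {x. eqv E a x \<and> g x = g x0}"
      using pigeonhole_infinite[OF inf] by auto
    have gC: "g x `` C = P x `` C" for x by (auto simp: g_def)
    have "{x. eqv E a x \<and> g x = g x0} \<subseteq> {y. eqv (P x0 `` C) x0 y}"
    proof clarify
      fix x assume x: "eqv E a x" "g x = g x0"
      have "pe ((P x0)\<inverse> O P x)" using P x0(1) x(1) by (intro pe_relcomp pe_converse) auto
      moreover have "(y, y) \<in> (P x0)\<inverse> O P x" if y: "y \<in> P x0 `` C" for y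
      proof -
        obtain c where c: "c \<in> C" "(c, y) \<in> P x0" using y by blast
        then have "(c, y) \<in> g x" unfolding x(2) by (simp add: g_def)
        then show ?thesis using c(2) by (auto simp: g_def)
      qed
      moreover have "(x0, x) \<in> (P x0)\<inverse> O P x" using P[OF x0(1)] P[OF x(1)] by auto
      ultimately show "eqv (P x0 `` C) x0 x" by (elim pe_mono) auto
    qed
    moreover have "finite {y. eqv (P x0 `` C) x0 y}"
      using P[OF x0(1)] by (intro finite_orbit_pe[OF _ _ _ _ C(3)]) auto
    ultimately show False using x0(2) finite_subset by blast
  qed
  then show ?thesis using E aU unfolding cl_def by blast
qed

lemma cl_subset_cl: "B \<subseteq> cl A \<Longrightarrow> A \<subseteq> U \<Longrightarrow> cl B \<subseteq> cl A"
  using cl_trans by blast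

lemma cl_insert_absorb: "w \<in> cl (insert z C) \<Longrightarrow> insert z C \<subseteq> U \<Longrightarrow> cl (insert w C) \<subseteq> cl (insert z C)"
  by (rule cl_subset_cl) (use cl_superset[of "insert z C"] in auto)

text \<open>There are finitely many types over \<open>A\<close> in the sort, and each algebraic one
  has a finite orbit. The bound on closures, on which all descending arguments below rest, comes
  from here.\<close>

lemma finite_cl_sort:
  assumes "finite A" "A \<subseteq> U"
  shows "finite {x \<in> cl A. srt x = s}"
proof -
  obtain R where R: "finite R" "\<And>x. x \<in> U \<Longrightarrow> srt x = s \<Longrightarrow> \<exists>r\<in>R. eqv A x r"
    using types[OF assms, of s] by blast
  have "{x \<in> cl A. srt x = s} \<subseteq> \<Union>((\<lambda>r. {y. eqv A r y}) ` {r \<in> R. finite {y. eqv A r y}})"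
  proof
    fix x assume x: "x \<in> {x \<in> cl A. srt x = s}"
    then obtain r where r: "r \<in> R" "eqv A x r" using R(2) cl_subset by blast
    obtain C where C: "C \<subseteq> A" "finite {y. eqv C x y}" using x unfolding cl_def by blast
    have "{y. eqv A r y} \<subseteq> {y. eqv C x y}"
      using eqv_trans[OF r(2)] eqv_mono[OF _ C(1)] by blast
    then have "finite {y. eqv A r y}" using C(2) finite_subset by blast
    then show "x \<in> \<Union>((\<lambda>r. {y. eqv A r y}) ` {r \<in> R. finite {y. eqv A r y}})"
      using r eqv_sym by blast
  qed
  then show ?thesis by (rule finite_subset) (use R(1) in auto)
qed

text \<open>Compactness, with one invariant set of possible images for each finite part of
  \<open>P\<close>. The finite back-and-forth shows that finitely many of these sets meet in the
  right sort.\<close>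

lemma forth_small:
  assumes P: "pe P" and sm: "sm (Range P)" and d: "d \<in> U"
  shows "\<exists>d'. pe (insert (d, d') P)"
proof -
  define W where "W Q = {x. pe (insert (d, x) Q)}" for Q
  let ?\<W> = "W ` {Q. finite Q \<and> Q \<subseteq> P}"
  have "\<exists>x\<in>U. srt x = srt d \<and> x \<in> \<Inter>?\<W>"
  proof (rule compactness[OF sm d])
    fix V assume "V \<in> ?\<W>"
    then obtain Q where Q: "finite Q" "Q \<subseteq> P" "V = W Q" by blast
    have "V \<subseteq> U" unfolding Q(3) W_def using pe_subset by blast
    moreover have "y \<in> V" if "x \<in> V" "eqv (Range Q) x y" for x y
    proof -
      have "pe (insert (d, x) Q O insert (x, y) (Id_on (Range Q)))"
        using that unfolding Q(3) W_def by (intro pe_relcomp) auto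
      then show ?thesis unfolding Q(3) W_def mem_Collect_eq by (rule pe_mono) auto
    qed
    moreover have "finite (Range Q)" "Range Q \<subseteq> Range P" using Q(1,2) finite_Range by auto
    ultimately show "V \<subseteq> U \<and> (\<exists>C. finite C \<and> C \<subseteq> Range P \<and> (\<forall>x\<in>V. \<forall>y. eqv C x y \<longrightarrow> y \<in> V))"
      by blast
  next
    fix \<W>' assume "finite \<W>'" "\<W>' \<subseteq> ?\<W>"
    then obtain J where J: "J \<subseteq> {Q. finite Q \<and> Q \<subseteq> P}" "finite J" "\<W>' = W ` J"
      by (meson finite_subset_image)
    have "pe (\<Union>J)" "finite (\<Union>J)" using J(1,2) by (auto intro: pe_mono[OF P])
    then obtain d' where d': "pe (insert (d, d') (\<Union>J))" using forth d by blast
    have "d' \<in> W Q" if "Q \<in> J" for Q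
      unfolding W_def mem_Collect_eq using d' by (rule pe_mono) (use that in auto)
    then show "\<exists>x\<in>U. srt x = srt d \<and> x \<in> \<Inter>\<W>'"
      using pe_sort[OF d', of d d'] pe_subset[OF d'] J(3) by auto
  qed
  then obtain d' where d': "d' \<in> U" "\<And>Q. finite Q \<Longrightarrow> Q \<subseteq> P \<Longrightarrow> pe (insert (d, d') Q)"
    unfolding W_def by blast
  have "pe (insert (d, d') P)"
  proof (rule pe_finite)
    show "insert (d, d') P \<subseteq> U \<times> U" using d d' pe_subset[OF P] by blast
    fix Q assume "finite Q" "Q \<subseteq> insert (d, d') P"
    then show "pe Q" by (intro pe_mono[OF d'(2)[of "Q - {(d, d')}"]]) auto
  qed
  then show ?thesis by blast
qed

lemma forth_small_set:
  assumes "finite Z" "pe P" "sm (Range P)" "Z \<subseteq> U"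
  shows "\<exists>P'. P \<subseteq> P' \<and> pe P' \<and> sm (Range P') \<and> Z \<subseteq> Domain P'"
  using assms
proof (induction rule: finite_induct)
  case (insert z Z)
  then obtain P' where P': "P \<subseteq> P'" "pe P'" "sm (Range P')" "Z \<subseteq> Domain P'" by auto
  obtain z' where z': "pe (insert (z, z') P')" using forth_small[OF P'(2,3)] insert.prems by blast
  have "sm (Range P' \<union> {z'})" using P'(3) pe_subset[OF z'] by (intro sm_Un_finite) auto
  then show ?case using P' z' by (intro exI[of _ "insert (z, z') P'"]) auto
qed auto

lemma image_list:
  assumes "pe P" "set as \<subseteq> Domain P"
  obtains bs where "length bs = length as" "set (zip as bs) \<subseteq> P" "set bs = P `` set as"
proof -
  have "\<forall>a\<in>set as. \<exists>b. (a, b) \<in> P" using assms(2) by blast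
  then obtain f where f: "\<And>a. a \<in> set as \<Longrightarrow> (a, f a) \<in> P" by metis
  show ?thesis
  proof (rule that[of "map f as"])
    show "set (zip as (map f as)) \<subseteq> P" using f by (auto simp: zip_map2 set_zip)
    show "set (map f as) = P `` set as" using f pe_fun[OF assms(1)] by auto blast
  qed simp
qed

text \<open>A finite part of the type of \<open>a\<close> over \<open>D\<close> has infinitely many
  realisations, while each element algebraic over \<open>D \<union> F\<close> is excluded by
  removing a finite orbit. So compactness finds a realisation avoiding all these orbits.\<close>

lemma nonalgebraic_extension:
  assumes D: "sm D" and F: "sm F" and a: "a \<in> U" "a \<notin> cl D"
  shows "\<exists>x. eqv D a x \<and> x \<notin> cl (D \<union> F)"
proof -
  have DU: "D \<subseteq> U" "F \<subseteq> U" using D F sm_subset by auto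
  define W where "W C = {x. eqv C a x}" for C
  \<comment> \<open>\<open>\<A>\<close> expresses having the type of \<open>a\<close> over
    \<open>D\<close>, and \<open>\<B>\<close> expresses not being algebraic over
    \<open>D \<union> F\<close>.\<close>
  define \<A> where "\<A> = W ` {C. finite C \<and> C \<subseteq> D}"
  define \<B> where "\<B> = (\<lambda>(E, e). U - {y. eqv E e y}) `
     {(E, e). finite E \<and> E \<subseteq> D \<union> F \<and> e \<in> U \<and> finite {y. eqv E e y}}"
  have inf: "infinite (W C)" if "finite C" "C \<subseteq> D" for C
    using that a unfolding cl_def W_def by blast
  have "\<exists>x\<in>U. srt x = srt a \<and> x \<in> \<Inter>(\<A> \<union> \<B>)"
  proof (rule compactness[OF sm_Un[OF D F] a(1)])
    fix V assume "V \<in> \<A> \<union> \<B>"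
    then show "V \<subseteq> U \<and> (\<exists>C. finite C \<and> C \<subseteq> D \<union> F \<and> (\<forall>x\<in>V. \<forall>y. eqv C x y \<longrightarrow> y \<in> V))"
    proof
      assume "V \<in> \<A>"
      then obtain C where "finite C" "C \<subseteq> D" "V = {x. eqv C a x}" unfolding \<A>_def W_def by blast
      then show ?thesis using eqv_trans eqvD(2) by blast
    next
      assume "V \<in> \<B>"
      then obtain E e where E: "finite E" "E \<subseteq> D \<union> F" "V = U - {y. eqv E e y}"
        unfolding \<B>_def by auto
      have "y \<in> V" if "x \<in> V" "eqv E x y" for x y
        using that eqv_trans[OF _ eqv_sym[OF that(2)]] eqvD(2)[OF that(2)] unfolding E(3) by blast
      then show ?thesis using E by blast
    qed
  next
    fix \<W>' assume w: "finite \<W>'" "\<W>' \<subseteq> \<A> \<union> \<B>"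
    have "finite (\<W>' \<inter> \<A>)" "\<W>' \<inter> \<A> \<subseteq> W ` {C. finite C \<and> C \<subseteq> D}" using w by (auto simp: \<A>_def)
    then obtain J where J: "J \<subseteq> {C. finite C \<and> C \<subseteq> D}" "finite J" "\<W>' \<inter> \<A> = W ` J"
      by (meson finite_subset_image)
    define bad where "bad = (\<Union>V\<in>\<W>' \<inter> \<B>. U - V)"
    have "finite (U - V)" if "V \<in> \<B>" for V
    proof -
      have "\<exists>E e. finite {y. eqv E e y} \<and> V = U - {y. eqv E e y}"
        using that unfolding \<B>_def by auto
      then obtain E e where "finite {y. eqv E e y}" "V = U - {y. eqv E e y}" by metis
      then show ?thesis by (auto simp: double_diff intro: finite_subset[of "U - (U - {y. eqv E e y})"])
    qed
    then have "finite bad" unfolding bad_def using w(1) by (intro finite_UN_I) auto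
    moreover have "infinite (W (\<Union>J))" by (rule inf) (use J in auto)
    ultimately obtain x where x: "x \<in> W (\<Union>J)" "x \<notin> bad" by (meson finite_subset subsetI)
    then have e: "eqv (\<Union>J) a x" by (simp add: W_def)
    have "x \<in> V" if V: "V \<in> \<W>'" for V
    proof (cases "V \<in> \<A>")
      case True
      then obtain C where C: "C \<in> J" "V = W C" using J(3) V by blast
      then show ?thesis using eqv_mono[OF e, of C] unfolding W_def by blast
    next
      case False
      then have "V \<in> \<B>" using V w(2) by blast
      then show ?thesis using x(2) V eqvD(2)[OF e] unfolding bad_def by blast
    qed
    then show "\<exists>x\<in>U. srt x = srt a \<and> x \<in> \<Inter>\<W>'"
      using pe_sort[OF e, of a x] eqvD(2)[OF e] by auto
  qed
  then obtain x where x: "x \<in> U" "x \<in> \<Inter>\<A>" "x \<in> \<Inter>\<B>" by blast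
  have xC: "eqv C a x" if "finite C" "C \<subseteq> D" for C using x(2) that unfolding \<A>_def W_def by blast
  have "eqv D a x"
  proof (rule pe_finite)
    show "insert (a, x) (Id_on D) \<subseteq> U \<times> U" using a(1) x(1) DU by auto
    fix Q assume Q: "finite Q" "Q \<subseteq> insert (a, x) (Id_on D)"
    show "pe Q"
    proof (rule pe_mono[OF xC[of "Domain Q \<inter> D"]])
      show "finite (Domain Q \<inter> D)" using Q(1) finite_Domain by blast
      show "Q \<subseteq> insert (a, x) (Id_on (Domain Q \<inter> D))" using Q(2) by auto
    qed simp
  qed
  moreover have "x \<notin> cl (D \<union> F)"
  proof
    assume "x \<in> cl (D \<union> F)"
    then obtain E where E: "finite E" "E \<subseteq> D \<union> F" "finite {y. eqv E x y}" unfolding cl_def by blast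
    then have "U - {y. eqv E x y} \<in> \<B>" using x(1) unfolding \<B>_def by blast
    then have "x \<notin> {y. eqv E x y}" using x(3) by blast
    moreover have "eqv E x x" using x(1) E(2) DU by (intro eqv_refl) auto
    ultimately show False by blast
  qed
  ultimately show ?thesis by blast
qed

text \<open>If a tuple had finitely many conjugates, their entries would form a finite set
  \<open>F\<close>. A non-algebraic entry has a conjugate outside the closure of
  \<open>D \<union> F\<close>, and extending to the whole tuple gives a conjugate that was not
  listed.\<close>

lemma infinite_tuple_orbit:
  assumes D: "sm D" and as: "set as \<subseteq> U" "\<not> set as \<subseteq> cl D"
  shows "infinite {bs. length bs = length as \<and> pe (set (zip as bs) \<union> Id_on D)}" (is "infinite ?T")
proof
  assume fin: "finite ?T"
  define F where "F = \<Union>(set ` ?T)"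
  have "F \<subseteq> U"
  proof
    fix x assume "x \<in> F"
    then obtain bs where bs: "x \<in> set bs" "length bs = length as" "pe (set (zip as bs) \<union> Id_on D)"
      unfolding F_def by blast
    then obtain i where "i < length bs" "bs ! i = x" by (auto simp: in_set_conv_nth)
    then have "(as ! i, x) \<in> set (zip as bs)" using bs(2) by (auto simp: in_set_zip)
    then show "x \<in> U" using pe_subset[OF bs(3)] by blast
  qed
  moreover have "finite F" unfolding F_def using fin by auto
  ultimately have F: "sm F" "F \<subseteq> U" using sm_finite by auto
  obtain a where a: "a \<in> set as" "a \<notin> cl D" using as(2) by blast
  obtain x where x: "eqv D a x" "x \<notin> cl (D \<union> F)"
    using nonalgebraic_extension[OF D F(1), of a] a as(1) by blast
  have "sm (D \<union> {x})" using D eqvD(2)[OF x(1)] by (intro sm_Un_finite) auto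
  then have "sm (Range (insert (a, x) (Id_on D)))" by (rule sm_mono) auto
  then obtain P where P: "insert (a, x) (Id_on D) \<subseteq> P" "pe P" "set as \<subseteq> Domain P"
    using forth_small_set[OF _ x(1) _ as(1)] by auto
  obtain bs where bs: "length bs = length as" "set (zip as bs) \<subseteq> P" "set bs = P `` set as"
    using image_list[OF P(2,3)] by blast
  have "pe (set (zip as bs) \<union> Id_on D)" by (rule pe_mono[OF P(2)]) (use bs(2) P(1) in auto)
  then have "set bs \<subseteq> F" using bs(1) unfolding F_def by blast
  moreover have "x \<in> set bs" using bs(3) P(1) a(1) by blast
  ultimately have "x \<in> cl (D \<union> F)" using cl_superset[of "D \<union> F"] F(2) sm_subset[OF D] by blast
  then show False using x(2) by blast
qed

lemma finite_tuple_orbit: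
  assumes "set as \<subseteq> cl D"
  shows "finite {bs. length bs = length as \<and> pe (set (zip as bs) \<union> Id_on D)}" (is "finite ?T")
proof -
  define Y where "Y = (\<Union>a\<in>set as. {x. eqv D a x})"
  have "finite {x. eqv D a x}" if "a \<in> set as" for a
  proof -
    obtain C where "C \<subseteq> D" "finite {x. eqv C a x}" using assms \<open>a \<in> set as\<close> unfolding cl_def by blast
    then show ?thesis using eqv_mono by (metis (mono_tags, lifting) finite_subset mem_Collect_eq subsetI)
  qed
  then have "finite Y" unfolding Y_def by blast
  moreover have "set bs \<subseteq> Y" if l: "length bs = length as" and p: "pe (set (zip as bs) \<union> Id_on D)" for bs
  proof
    fix x assume "x \<in> set bs"
    then have "\<exists>i<length bs. bs ! i = x" by (simp add: in_set_conv_nth)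
    then obtain i where i: "i < length as" "bs ! i = x" using l by auto
    then have z: "(as ! i, x) \<in> set (zip as bs)" using l by (auto simp: in_set_zip)
    have "eqv D (as ! i) x" by (rule pe_mono[OF p]) (use z in auto)
    then show "x \<in> Y" using i(1) unfolding Y_def by auto
  qed
  ultimately have "?T \<subseteq> {bs. set bs \<subseteq> Y \<and> length bs = length as}" by blast
  then show ?thesis using finite_lists_length_eq[OF \<open>finite Y\<close>] finite_subset by blast
qed

section \<open>Elements of 0-rank 1 and chains of real elements\<close>

text \<open>\<open>r1 C x\<close> says that \<open>x\<close> has 0-rank 1 over \<open>C\<close>.\<close>
definition r1 :: "'a set \<Rightarrow> 'a \<Rightarrow> bool" where
  "r1 C x \<longleftrightarrow> x \<in> H \<and> x \<notin> cl C \<and> (\<forall>v\<in>cl {x} \<inter> H. v \<notin> cl C \<longrightarrow> x \<in> cl (insert v C))"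

lemma r1_mono: "r1 C z \<Longrightarrow> C \<subseteq> cl D \<Longrightarrow> D \<subseteq> U \<Longrightarrow> z \<notin> cl D \<Longrightarrow> r1 D z"
proof -
  assume a: "r1 C z" "C \<subseteq> cl D" "D \<subseteq> U" "z \<notin> cl D"
  have "z \<in> cl (insert v D)" if v: "v \<in> cl {z} \<inter> H" "v \<notin> cl D" for v
  proof -
    have "v \<notin> cl C" using v(2) cl_subset_cl[OF a(2,3)] by blast
    then have z: "z \<in> cl (insert v C)" using a(1) v(1) unfolding r1_def by blast
    have "insert v D \<subseteq> U" using v a(3) by (auto simp: H_def)
    moreover from this have "insert v C \<subseteq> cl (insert v D)"
      using a(2) cl_mono[of D "insert v D"] cl_superset[of "insert v D"] by blast
    ultimately show ?thesis using z cl_trans by blast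
  qed
  then show ?thesis using a unfolding r1_def by blast
qed

text \<open>A chain of real elements along which the closure of the base grows strictly. Such a
  chain need not be independent in the sense of a matroid, since a single entry may carry more than
  one dimension; its length only bounds the dimension from below.\<close>

primrec ind :: "'a set \<Rightarrow> 'a list \<Rightarrow> bool" where
  "ind C [] \<longleftrightarrow> True"
| "ind C (w # ws) \<longleftrightarrow> w \<in> H \<and> w \<notin> cl C \<and> ind (insert w C) ws"

text \<open>The entries add as little as possible at each step; these are the chains whose length
  will be the dimension.\<close>

primrec atomic :: "'a set \<Rightarrow> 'a list \<Rightarrow> bool" where
  "atomic C [] \<longleftrightarrow> True"
| "atomic C (z # zs) \<longleftrightarrow> r1 C z \<and> atomic (insert z C) zs"

lemma atomic_ind: "atomic C zs \<Longrightarrow> ind C zs"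
  by (induction zs arbitrary: C) (auto simp: r1_def)

lemma atomic_append: "atomic C (zs @ ys) \<longleftrightarrow> atomic C zs \<and> atomic (C \<union> set zs) ys"
  by (induction zs arbitrary: C) auto

lemma insert_subset_cl: "C \<subseteq> cl D \<Longrightarrow> insert w D \<subseteq> U \<Longrightarrow> insert w C \<subseteq> cl (insert w D)"
  using cl_mono[of D "insert w D"] cl_superset[of "insert w D"] by blast

lemma ind_mono: "ind D ws \<Longrightarrow> C \<subseteq> cl D \<Longrightarrow> D \<subseteq> U \<Longrightarrow> ind C ws"
proof (induction ws arbitrary: C D)
  case (Cons w ws)
  have w: "w \<in> H" "w \<notin> cl D" "ind (insert w D) ws" using Cons.prems by auto
  have U: "insert w D \<subseteq> U" using w Cons.prems(3) by (auto simp: H_def)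
  have "ind (insert w C) ws" by (rule Cons.IH[OF w(3) insert_subset_cl[OF Cons.prems(2) U] U])
  moreover have "w \<notin> cl C" using w(2) cl_subset_cl[OF Cons.prems(2,3)] by blast
  ultimately show ?case using w(1) by simp
qed simp

lemma atomic_cong: "atomic C zs \<Longrightarrow> C \<subseteq> cl D \<Longrightarrow> D \<subseteq> cl C \<Longrightarrow> C \<subseteq> U \<Longrightarrow> D \<subseteq> U \<Longrightarrow> atomic D zs"
proof (induction zs arbitrary: C D)
  case (Cons z zs)
  have z: "r1 C z" "atomic (insert z C) zs" using Cons.prems by auto
  have U: "insert z C \<subseteq> U" "insert z D \<subseteq> U" using z Cons.prems by (auto simp: H_def r1_def)
  have "z \<notin> cl D" using z(1) cl_subset_cl[OF Cons.prems(3,4)] by (auto simp: r1_def)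
  then have "r1 D z" using r1_mono[OF z(1) Cons.prems(2,5)] by blast
  moreover have "atomic (insert z D) zs"
    by (rule Cons.IH[OF z(2) _ _ U]) (use Cons.prems U insert_subset_cl in auto)
  ultimately show ?case by simp
qed simp

lemma ind_pe:
  assumes "pe P" "ind (Domain Q) ws" "Q \<subseteq> P" "list_all2 (\<lambda>x y. (x, y) \<in> P) ws ws'"
  shows "ind (Range Q) ws'"
  using assms(2-4)
proof (induction ws arbitrary: Q ws')
  case (Cons w ws)
  then obtain w' vs where w: "ws' = w' # vs" "(w, w') \<in> P" "list_all2 (\<lambda>x y. (x, y) \<in> P) ws vs"
    by (auto simp: list_all2_Cons1)
  have "P `` Domain Q = Range Q" using Cons.prems(2) pe_fun[OF assms(1)] by blast
  moreover have "Domain Q \<subseteq> Domain P" using Cons.prems(2) by blast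
  ultimately have "w' \<notin> cl (Range Q)" using cl_pe_iff[OF assms(1) w(2), of "Domain Q"] Cons.prems(1) by simp
  moreover have "w' \<in> H" using Cons.prems(1) pe_sort[OF assms(1) w(2)] pe_subset[OF assms(1)] w(2)
    by (auto simp: H_def)
  moreover have "ind (Range (insert (w, w') Q)) vs"
    by (rule Cons.IH[OF _ _ w(3)]) (use Cons.prems w in auto)
  ultimately show ?case using w(1) by simp
qed simp

text \<open>The entries are moved one after another, each to a conjugate that is non-algebraic also
  over \<open>F\<close>, so the moved chain remains strict over the larger base.\<close>

lemma ind_extension:
  assumes "ind (Domain P) ws" "pe P" "sm (Range P)" and F: "sm F"
  shows "\<exists>P' ws'. P \<subseteq> P' \<and> pe P' \<and> sm (Range P') \<and>
     list_all2 (\<lambda>x y. (x, y) \<in> P') ws ws' \<and> ind (Range P \<union> F) ws'"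
  using assms(1-3)
proof (induction ws arbitrary: P)
  case (Cons w ws)
  have w: "w \<in> U" "w \<in> H" "w \<notin> cl (Domain P)" using Cons.prems(1) by (auto simp: H_def)
  obtain w0 where w0: "pe (insert (w, w0) P)" using forth_small[OF Cons.prems(2,3) w(1)] by blast
  have "w \<notin> Domain P" using w(3) cl_superset[of "Domain P"] pe_subset[OF Cons.prems(2)] by blast
  then have "insert (w, w0) P `` Domain P = Range P" by blast
  then have "w0 \<notin> cl (Range P)" using cl_pe_iff[OF w0, of w w0 "Domain P"] w(3) by auto
  moreover have "w0 \<in> U" using pe_subset[OF w0] by blast
  ultimately obtain x where x: "eqv (Range P) w0 x" "x \<notin> cl (Range P \<union> F)"
    using nonalgebraic_extension[OF Cons.prems(3) F] by blast
  have px: "pe (insert (w, x) P)" by (rule pe_mono[OF pe_relcomp[OF w0 x(1)]]) auto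
  have "sm (Range P \<union> {x})" using Cons.prems(3) eqvD(2)[OF x(1)] by (intro sm_Un_finite) auto
  then have "sm (Range (insert (w, x) P))" by simp
  moreover have "ind (Domain (insert (w, x) P)) ws" using Cons.prems(1) by simp
  ultimately obtain P' ws' where P': "insert (w, x) P \<subseteq> P'" "pe P'" "sm (Range P')"
     "list_all2 (\<lambda>x y. (x, y) \<in> P') ws ws'" "ind (Range (insert (w, x) P) \<union> F) ws'"
    using Cons.IH px by blast
  have "x \<in> H" using w(2) pe_sort[OF px, of w x] eqvD(2)[OF x(1)] by (auto simp: H_def)
  then have "ind (Range P \<union> F) (x # ws')" using x(2) P'(5) by simp
  then show ?case using P' by (intro exI[of _ P'] exI[of _ "x # ws'"]) auto
qed auto

end

section \<open>Exchange, bases and dimension\<close>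

locale exchange_geometry = elementary_maps +
  assumes soft: "a \<in> U \<Longrightarrow> a \<in> cl (cl {a} \<inter> H)"
    and exch: "sm C \<Longrightarrow> r1 C x \<Longrightarrow> r1 C y \<Longrightarrow> y \<in> cl (insert x C) \<Longrightarrow> x \<in> cl (insert y C)"
begin

text \<open>An element with the fewest real elements in its algebraic closure has 0-rank 1.\<close>
lemma ex_r1:
  assumes w: "w \<in> H" "w \<notin> cl C"
  shows "\<exists>z. z \<in> cl {w} \<and> r1 C z"
proof -
  define n where "n x = card (cl {x} \<inter> H)" for x
  have wU: "{w} \<subseteq> U" using w by (auto simp: H_def)
  have "w \<in> cl {w}" using cl_superset[OF wU] by blast
  then obtain z where z: "z \<in> cl {w} \<inter> H - cl C"
    "\<And>v. v \<in> cl {w} \<inter> H - cl C \<Longrightarrow> n z \<le> n v"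
    using arg_min_nat_lemma[of "\<lambda>x. x \<in> cl {w} \<inter> H - cl C" w n] w by blast
  have zU: "{z} \<subseteq> U" using z(1) cl_subset by blast
  have fin: "finite (cl {z} \<inter> H)"
    using finite_cl_sort[of "{z}" h] zU cl_subset by (auto simp: H_def Int_def conj_ac elim!: rev_finite_subset)
  have "z \<in> cl (insert v C)" if v: "v \<in> cl {z} \<inter> H" "v \<notin> cl C" for v
  proof -
    have vU: "{v} \<subseteq> U" using v(1) cl_subset by blast
    have sub: "cl {v} \<subseteq> cl {z}" by (rule cl_subset_cl) (use v zU in auto)
    have "v \<in> cl {w}" using v(1) cl_trans[of "{z}" "{w}"] z(1) wU by blast
    then have "n z \<le> n v" using z(2) v by blast
    then have "cl {v} \<inter> H = cl {z} \<inter> H"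
      unfolding n_def using sub fin by (intro card_seteq) auto
    then have "z \<in> cl {v}" using z(1) cl_superset[OF zU] by blast
    then show ?thesis using cl_mono[of "{v}" "insert v C"] by blast
  qed
  then show ?thesis using z(1) unfolding r1_def by blast
qed

text \<open>Replace \<open>w\<close> by an atom \<open>y\<close> algebraic over it. Exchange between
  the atoms \<open>z\<close> and \<open>y\<close> puts \<open>z\<close> into the closure of
  \<open>insert y C\<close>, which lies in that of \<open>insert w C\<close>.\<close>

lemma exchange_r1:
  assumes C: "sm C" and z: "r1 C z" and w: "w \<in> H" "w \<in> cl (insert z C)" "w \<notin> cl C"
  shows "z \<in> cl (insert w C)"
proof -
  obtain y where y: "y \<in> cl {w}" "r1 C y" using ex_r1[OF w(1,3)] by blast
  have U: "insert z C \<subseteq> U" "insert w C \<subseteq> U" using sm_subset[OF C] z w(1) by (auto simp: r1_def H_def)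
  have "y \<in> cl (insert z C)" using cl_trans[of "{w}" "insert z C" y] w(2) y(1) U by blast
  then have "z \<in> cl (insert y C)" using exch[OF C z y(2)] by blast
  moreover have "y \<in> cl (insert w C)" using y(1) cl_mono[of "{w}" "insert w C"] by blast
  ultimately show ?thesis using cl_insert_absorb U(2) by blast
qed

text \<open>Adding an atom \<open>z\<close> to the base costs at most one entry of a chain. As long
  as \<open>z\<close> stays non-algebraic it stays an atom, and exchange keeps the current entry
  non-algebraic over \<open>z\<close>. At the first entry that makes \<open>z\<close> algebraic,
  this entry may be lost, and afterwards the two bases have the same closure.\<close>

lemma ind_drop:
  "sm C \<Longrightarrow> r1 C z \<Longrightarrow> ind C ws \<Longrightarrow>
    \<exists>vs. ind (insert z C) vs \<and> set vs \<subseteq> set ws \<and> length ws \<le> Suc (length vs)"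
proof (induction ws arbitrary: C)
  case (Cons w ws)
  have w: "w \<in> H" "w \<notin> cl C" "ind (insert w C) ws" using Cons.prems by auto
  have U: "insert z C \<subseteq> U" "insert w C \<subseteq> U"
    using sm_subset[OF Cons.prems(1)] Cons.prems(2) w(1) by (auto simp: r1_def H_def)
  show ?case
  proof (cases "z \<in> cl (insert w C)")
    case True
    have sub: "insert w C \<subseteq> cl (insert w C)" by (rule cl_superset[OF U(2)])
    show ?thesis
    proof (cases "w \<in> cl (insert z C)")
      case w': True
      have "ind (insert z C) ws" by (rule ind_mono[OF w(3) _ U(2)]) (use True sub in auto)
      then show ?thesis by (intro exI[of _ ws]) auto
    next
      case False
      have "ind (insert w (insert z C)) ws" by (rule ind_mono[OF w(3) _ U(2)]) (use True sub in auto)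
      then show ?thesis using False w(1) by (intro exI[of _ "w # ws"]) auto
    qed
  next
    case False
    then have w': "w \<notin> cl (insert z C)" using exchange_r1[OF Cons.prems(1,2) w(1) _ w(2)] by blast
    have "sm (insert w C)" using sm_Un[OF Cons.prems(1) sm_finite[of "{w}"]] U by simp
    moreover have "r1 (insert w C) z"
      by (rule r1_mono[OF Cons.prems(2) _ U(2) False]) (use cl_superset[OF U(2)] in blast)
    ultimately obtain vs where "ind (insert z (insert w C)) vs" "set vs \<subseteq> set ws"
      "length ws \<le> Suc (length vs)" using Cons.IH w(3) by blast
    then show ?thesis using w' w(1) by (intro exI[of _ "w # vs"]) (auto simp: insert_commute)
  qed
qed auto

text \<open>The Steinitz argument: absorb the atoms into the base one by one, losing at most one
  entry of \<open>ws\<close> each time; in the end no entry can be left.\<close>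

lemma ind_le_atomic:
  "sm C \<Longrightarrow> atomic C zs \<Longrightarrow> ind C ws \<Longrightarrow> set ws \<subseteq> cl (C \<union> set zs) \<Longrightarrow> length ws \<le> length zs"
proof (induction zs arbitrary: C ws)
  case Nil
  then show ?case by (cases ws) auto
next
  case (Cons z zs)
  then obtain vs where vs: "ind (insert z C) vs" "set vs \<subseteq> set ws" "length ws \<le> Suc (length vs)"
    using ind_drop[of C z ws] by auto
  have "sm (insert z C)"
    using sm_Un[OF Cons.prems(1) sm_finite[of "{z}"]] Cons.prems(2) by (auto simp: r1_def H_def)
  then have "length vs \<le> length zs"
    by (rule Cons.IH) (use Cons.prems vs in auto)
  then show ?case using vs(3) by simp
qed

lemma finite_cl_H: "finite A \<Longrightarrow> A \<subseteq> U \<Longrightarrow> finite (cl A \<inter> H)"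
  using finite_cl_sort[of A h] by (rule rev_finite_subset) (auto simp: H_def)

text \<open>Each new atom makes one more of the finitely many real elements of \<open>cl A\<close>
  algebraic. Once all of them are algebraic over the base, soft elimination of imaginaries makes
  \<open>A\<close> itself algebraic.\<close>

lemma ex_atomic:
  assumes A: "finite A" "A \<subseteq> U"
  shows "sm C \<Longrightarrow> \<exists>zs. atomic C zs \<and> set zs \<subseteq> cl A \<inter> H \<and> A \<subseteq> cl (C \<union> set zs)"
proof (induction "card (cl A \<inter> H - cl C)" arbitrary: C rule: less_induct)
  case less
  have CU: "C \<subseteq> U" using less.prems sm_subset by blast
  show ?case
  proof (cases "cl A \<inter> H \<subseteq> cl C")
    case True
    have "a \<in> cl C" if a: "a \<in> A" for a
    proof -
      have "cl {a} \<inter> H \<subseteq> cl C" using True cl_mono[of "{a}" A] a by blast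
      then show ?thesis using cl_trans[OF _ CU] soft[of a] a A(2) by blast
    qed
    then show ?thesis by (intro exI[of _ "[]"]) auto
  next
    case False
    then obtain w where w: "w \<in> cl A" "w \<in> H" "w \<notin> cl C" by blast
    obtain z where z: "z \<in> cl {w}" "r1 C z" using ex_r1[OF w(2,3)] by blast
    have zA: "z \<in> cl A \<inter> H" using cl_trans[of "{w}" A z] w(1) z A(2) by (auto simp: r1_def)
    have U: "insert z C \<subseteq> U" using zA CU cl_subset by auto
    have sm: "sm (insert z C)" using sm_Un[OF less.prems sm_finite[of "{z}"]] U by simp
    have "cl A \<inter> H - cl (insert z C) \<subset> cl A \<inter> H - cl C"
      using zA z(2) cl_mono[of C "insert z C"] cl_superset[OF U] by (auto simp: r1_def)
    then have "card (cl A \<inter> H - cl (insert z C)) < card (cl A \<inter> H - cl C)"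
      using finite_cl_H[OF A] by (intro psubset_card_mono) auto
    from less.hyps[OF this sm] obtain zs where "atomic (insert z C) zs" "set zs \<subseteq> cl A \<inter> H"
      "A \<subseteq> cl (insert z C \<union> set zs)" by blast
    then show ?thesis using z(2) zA by (intro exI[of _ "z # zs"]) auto
  qed
qed

definition basis :: "'a set \<Rightarrow> 'a set \<Rightarrow> 'a list \<Rightarrow> bool" where
  "basis C A zs \<longleftrightarrow> atomic C zs \<and> set zs \<subseteq> cl (C \<union> A) \<and> A \<subseteq> cl (C \<union> set zs)"

definition dim :: "'a set \<Rightarrow> 'a set \<Rightarrow> nat" where
  "dim C A = length (SOME zs. basis C A zs)"

lemma ind_H: "ind C ws \<Longrightarrow> set ws \<subseteq> H"
  by (induction ws arbitrary: C) auto

lemma ind_le_basis: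
  assumes C: "sm C" and b: "basis C A zs" and w: "ind C ws" "set ws \<subseteq> cl (C \<union> A)"
  shows "length ws \<le> length zs"
proof (rule ind_le_atomic[OF C _ w(1)])
  show "atomic C zs" using b by (simp add: basis_def)
  have "set zs \<subseteq> U" using ind_H[OF atomic_ind[OF \<open>atomic C zs\<close>]] by (auto simp: H_def)
  then have U: "C \<union> set zs \<subseteq> U" using sm_subset[OF C] by blast
  have "C \<union> A \<subseteq> cl (C \<union> set zs)" using b cl_superset[OF U] by (auto simp: basis_def)
  then show "set ws \<subseteq> cl (C \<union> set zs)" using cl_subset_cl[OF _ U] w(2) by blast
qed

lemma ex_basis: "sm C \<Longrightarrow> finite A \<Longrightarrow> A \<subseteq> U \<Longrightarrow> \<exists>zs. basis C A zs \<and> set zs \<subseteq> cl A"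
  using ex_atomic[of A C] cl_mono[of A "C \<union> A"] unfolding basis_def by blast

text \<open>Two bases bound each other in length, because an atomic chain is in particular a strict
  chain; so the choice in the definition of \<open>dim\<close> does not matter.\<close>

lemma dim_basis:
  assumes C: "sm C" and b: "basis C A zs"
  shows "dim C A = length zs"
proof -
  have s: "basis C A (SOME zs. basis C A zs)" using b by (rule someI)
  show ?thesis unfolding dim_def
    using ind_le_basis[OF C b atomic_ind] ind_le_basis[OF C s atomic_ind] b s
    unfolding basis_def by (meson le_antisym)
qed

lemma ind_le_dim:
  assumes "sm C" "finite A" "A \<subseteq> U" "ind C ws" "set ws \<subseteq> cl (C \<union> A)"
  shows "length ws \<le> dim C A"
proof -
  obtain zs where "basis C A zs" using ex_basis[OF assms(1-3)] by blast
  then show ?thesis using dim_basis[OF assms(1)] ind_le_basis[OF assms(1)] assms(4,5) by metis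
qed

text \<open>A basis of \<open>B\<close> over \<open>C\<close> followed by one of \<open>A\<close>
  over \<open>C \<union> B\<close> is a basis of the union, since replacing a base by one with the
  same closure keeps chains atomic.\<close>

lemma dim_Un:
  assumes C: "sm C" and A: "finite A" "A \<subseteq> U" and B: "finite B" "B \<subseteq> U"
  shows "dim C (A \<union> B) = dim C B + dim (C \<union> B) A"
proof -
  have CU: "C \<subseteq> U" using C sm_subset by blast
  have CB: "sm (C \<union> B)" using C B by (intro sm_Un_finite)
  obtain zs where zs: "basis C B zs" "set zs \<subseteq> cl B" using ex_basis[OF C B] by blast
  obtain ys where ys: "basis (C \<union> B) A ys" "set ys \<subseteq> cl A" using ex_basis[OF CB A] by blast
  have zU: "C \<union> set zs \<subseteq> U" and yU: "set ys \<subseteq> U" using CU zs(2) ys(2) cl_subset by blast+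
  have U: "C \<union> B \<subseteq> U" "C \<union> (A \<union> B) \<subseteq> U" "C \<union> set zs \<union> set ys \<subseteq> U"
    using CU A B zU yU by auto
  have e1: "C \<union> B \<subseteq> cl (C \<union> set zs)" using zs(1) cl_superset[OF zU] by (auto simp: basis_def)
  have e2: "C \<union> set zs \<subseteq> cl (C \<union> B)" using zs(1) cl_superset[OF U(1)] by (auto simp: basis_def)
  have "basis C (A \<union> B) (zs @ ys)"
    unfolding basis_def atomic_append
  proof (intro conjI)
    show "atomic C zs" using zs(1) by (simp add: basis_def)
    show "atomic (C \<union> set zs) ys"
      using atomic_cong[OF _ e1 e2 U(1) zU] ys(1) by (simp add: basis_def)
    have "cl A \<subseteq> cl (C \<union> (A \<union> B))" "cl B \<subseteq> cl (C \<union> (A \<union> B))" by (intro cl_mono; blast)+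
    then show "set (zs @ ys) \<subseteq> cl (C \<union> (A \<union> B))" using zs(2) ys(2) by auto
    have "cl (C \<union> set zs) \<subseteq> cl (C \<union> set (zs @ ys))" by (intro cl_mono) auto
    moreover have "C \<union> B \<union> set ys \<subseteq> cl (C \<union> set (zs @ ys))"
      using e1 calculation cl_superset[OF U(3)] by (auto simp: Un_assoc)
    then have "cl (C \<union> B \<union> set ys) \<subseteq> cl (C \<union> set (zs @ ys))"
      by (rule cl_subset_cl) (use U(3) in auto)
    ultimately show "A \<union> B \<subseteq> cl (C \<union> set (zs @ ys))" using zs(1) ys(1) unfolding basis_def by blast
  qed
  then show ?thesis using dim_basis[OF C] dim_basis[OF CB ys(1)] zs(1) by fastforce
qed

text \<open>A basis over the larger base is still a strict chain over the smaller one, and it can be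
  chosen inside \<open>cl A\<close>.\<close>

lemma dim_mono:
  assumes D: "sm D" "C \<subseteq> D" and A: "finite A" "A \<subseteq> U"
  shows "dim D A \<le> dim C A"
proof -
  have DU: "D \<subseteq> U" using D sm_subset by blast
  obtain zs where zs: "basis D A zs" "set zs \<subseteq> cl A" using ex_basis[OF D(1) A] by blast
  have "ind C zs"
    by (rule ind_mono[OF atomic_ind _ DU]) (use zs(1) D(2) cl_superset[OF DU] in \<open>auto simp: basis_def\<close>)
  moreover have "set zs \<subseteq> cl (C \<union> A)" using zs(2) cl_mono[of A "C \<union> A"] by blast
  ultimately have "length zs \<le> dim C A" using ind_le_dim[OF sm_mono[OF D] A] by blast
  then show ?thesis using dim_basis[OF D(1) zs(1)] by simp
qed

lemma dim_eq_0_iff: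
  assumes C: "sm C" and A: "finite A" "A \<subseteq> U"
  shows "dim C A = 0 \<longleftrightarrow> A \<subseteq> cl C"
proof
  assume "dim C A = 0"
  moreover obtain zs where zs: "basis C A zs" using ex_basis[OF C A] by blast
  ultimately have "zs = []" using dim_basis[OF C zs] by simp
  then show "A \<subseteq> cl C" using zs by (simp add: basis_def)
next
  assume "A \<subseteq> cl C"
  then have "basis C A []" by (simp add: basis_def)
  then show "dim C A = 0" using dim_basis[OF C] by fastforce
qed

text \<open>A basis of \<open>as\<close> is carried along an extension of the elementary map to a
  strict chain in the closure of \<open>C\<close> and \<open>bs\<close>.\<close>

lemma dim_pe_le:
  assumes C: "sm C" and p: "pe (set (zip as bs) \<union> Id_on C)" and l: "length as = length bs"
  shows "dim C (set as) \<le> dim C (set bs)"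
proof -
  let ?Q = "set (zip as bs) \<union> Id_on C"
  have DR: "Domain (set (zip as bs)) = set as" "Range (set (zip as bs)) = set bs"
    using l by (auto simp: Domain_fst Range_snd simp flip: set_map)
  have U: "set as \<subseteq> U" "set bs \<subseteq> U" using pe_subset[OF p] DR by blast+
  obtain zs where zs: "basis C (set as) zs" "set zs \<subseteq> cl (set as)"
    using ex_basis[OF C _ U(1)] by blast
  have "sm (C \<union> set bs)" using C U by (intro sm_Un_finite) auto
  moreover have "Range ?Q = C \<union> set bs" unfolding Range_Un_eq DR(2) by auto
  moreover have "set zs \<subseteq> U" using zs(2) cl_subset by blast
  ultimately obtain P where P: "?Q \<subseteq> P" "pe P" "set zs \<subseteq> Domain P"
    using forth_small_set[OF _ p] by (metis finite_set)
  obtain ws where ws: "length ws = length zs" "set (zip zs ws) \<subseteq> P" "set ws = P `` set zs"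
    using image_list[OF P(2,3)] by blast
  have all: "list_all2 (\<lambda>x y. (x, y) \<in> P) zs ws" using ws(1,2) by (auto simp: list_all2_iff)
  have "ind C ws"
    using ind_pe[OF P(2) _ _ all, of "Id_on C"] atomic_ind zs(1) P(1) by (auto simp: basis_def)
  moreover have "set ws \<subseteq> cl (C \<union> set bs)"
  proof
    fix w assume "w \<in> set ws"
    then obtain z where z: "z \<in> set zs" "(z, w) \<in> P" using ws(3) by blast
    have "set as \<subseteq> Domain P" using P(1) DR(1) by blast
    moreover have "P `` set as = set bs" using pe_fun[OF P(2)] P(1) DR by blast
    ultimately have "w \<in> cl (set bs)" using cl_pe[OF P(2) z(2), of "set as"] zs(2) z(1) by auto
    then show "w \<in> cl (C \<union> set bs)" using cl_mono[of "set bs" "C \<union> set bs"] by blast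
  qed
  ultimately have "length ws \<le> dim C (set bs)" using ind_le_dim[OF C _ U(2)] by blast
  then show ?thesis using dim_basis[OF C zs(1)] ws(1) by simp
qed

lemma dim_pe:
  assumes C: "sm C" and p: "pe (set (zip as bs) \<union> Id_on C)" and l: "length as = length bs"
  shows "dim C (set as) = dim C (set bs)"
proof (rule antisym)
  show "dim C (set as) \<le> dim C (set bs)" by (rule dim_pe_le[OF assms])
  have "set (zip bs as) \<union> Id_on C \<subseteq> (set (zip as bs) \<union> Id_on C)\<inverse>"
    using l by (auto simp: in_set_zip)
  then have "pe (set (zip bs as) \<union> Id_on C)" by (rule pe_mono[OF pe_converse[OF p]])
  then show "dim C (set bs) \<le> dim C (set as)" using dim_pe_le[OF C] l by simp
qed

text \<open>Existence of independent realisations: the type of \<open>bs\<close> over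
  \<open>D\<close> has a realisation that is independent of \<open>F\<close>. A basis is first moved
  to a chain that stays strict over \<open>F\<close>, and then \<open>bs\<close> is moved along with
  it.\<close>

lemma dim_extension:
  assumes D: "sm D" and F: "sm F" and bs: "set bs \<subseteq> U"
  shows "\<exists>cs. length cs = length bs \<and> pe (set (zip bs cs) \<union> Id_on D) \<and>
     dim (D \<union> F) (set cs) = dim D (set bs)"
proof -
  have DU: "D \<subseteq> U" using D sm_subset by blast
  obtain zs where zs: "basis D (set bs) zs" "set zs \<subseteq> cl (set bs)"
    using ex_basis[OF D _ bs] by blast
  have "ind (Domain (Id_on D)) zs" using atomic_ind zs(1) by (simp add: basis_def)
  moreover have "sm (Range (Id_on D))" using D by simp
  ultimately obtain P ws where P: "Id_on D \<subseteq> P" "pe P" "sm (Range P)"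
    "list_all2 (\<lambda>x y. (x, y) \<in> P) zs ws" "ind (D \<union> F) ws"
    using ind_extension[OF _ pe_Id_on[OF DU] _ F, of zs] by auto
  obtain P' where P': "P \<subseteq> P'" "pe P'" "set bs \<subseteq> Domain P'"
    using forth_small_set[OF _ P(2,3) bs] by auto
  obtain cs where cs: "length cs = length bs" "set (zip bs cs) \<subseteq> P'" "set cs = P' `` set bs"
    using image_list[OF P'(2,3)] by blast
  have p: "pe (set (zip bs cs) \<union> Id_on D)"
    by (rule pe_mono[OF P'(2)]) (use cs(2) P(1) P'(1) in auto)
  have cU: "set cs \<subseteq> U" using cs(3) pe_subset[OF P'(2)] by blast
  have DF: "sm (D \<union> F)" using D F by (rule sm_Un)
  have "set ws \<subseteq> cl (D \<union> F \<union> set cs)"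
  proof
    fix w assume "w \<in> set ws"
    then obtain i where i: "i < length ws" "ws ! i = w" by (auto simp: in_set_conv_nth)
    then have z: "(zs ! i, w) \<in> P'" "zs ! i \<in> set zs"
      using P(4) P'(1) by (auto simp: list_all2_conv_all_nth)
    have "w \<in> cl (set cs)" unfolding cs(3)
      by (rule cl_pe[OF P'(2) z(1) P'(3)]) (use z(2) zs(2) in blast)
    then show "w \<in> cl (D \<union> F \<union> set cs)" using cl_mono[of "set cs" "D \<union> F \<union> set cs"] by blast
  qed
  then have "length ws \<le> dim (D \<union> F) (set cs)" using ind_le_dim[OF DF _ cU P(5)] by simp
  moreover have "dim (D \<union> F) (set cs) \<le> dim D (set cs)" by (rule dim_mono[OF DF _ _ cU]) auto
  moreover have "dim D (set cs) = dim D (set bs)" using dim_pe[OF D p] cs(1) by simp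
  moreover have "dim D (set bs) = length ws"
    using dim_basis[OF D zs(1)] list_all2_lengthD[OF P(4)] by simp
  ultimately show ?thesis using cs(1) p by (intro exI[of _ cs]) simp
qed

text \<open>This is symmetry of independence, where \<open>B\<close> is independent from \<open>A\<close> over \<open>D\<close> if adding \<open>A\<close>
  to \<open>D\<close> does not lower the dimension of \<open>B\<close>.\<close>
lemma dim_drop:
  assumes D: "sm D" and A: "finite A" "A \<subseteq> U" and B: "finite B" "B \<subseteq> U"
    and alg: "A \<subseteq> cl (D \<union> B)" and le: "dim D B \<le> dim (D \<union> A) B"
  shows "A \<subseteq> cl D"
proof -
  have "sm (D \<union> B)" using D B by (intro sm_Un_finite)
  then have "dim (D \<union> B) A = 0" using dim_eq_0_iff[OF _ A] alg by blast
  then have "dim D (A \<union> B) = dim D B" using dim_Un[OF D A B] by simp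
  moreover have "dim D (B \<union> A) = dim D A + dim (D \<union> A) B" by (rule dim_Un[OF D B A])
  ultimately have "dim D A = 0" using le by (simp add: Un_commute)
  then show ?thesis using dim_eq_0_iff[OF D A] by blast
qed

end

section \<open>Types in the structure of imaginaries\<close>

lemma pe_holds:
  assumes "pe L S Q" "form L (length x) \<phi>" "length x = length y" "set (zip x y) \<subseteq> Q"
  shows "holds S \<phi> x \<longleftrightarrow> holds S \<phi> y"
  unfolding holds_def
proof (rule pe_sat[OF assms(1)])
  show "wf_fm L \<phi>" using assms(2) by (simp add: form_def)
  fix i assume "i \<in> fv \<phi>"
  then have "i < length x" using assms(2) by (auto simp: form_def)
  then show "(x ! i, y ! i) \<in> Q" using assms(3,4) by (auto simp: in_set_zip subset_iff)
qed

lemma infinite_Field: "Card_order \<kappa> \<Longrightarrow> natLeq <o \<kappa> \<Longrightarrow> infinite (Field \<kappa>)"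
  using finite_ordLess_infinite[of \<kappa> natLeq] natLeq_Well_order Field_natLeq
    not_ordLess_ordLeq ordLess_imp_ordLeq card_order_on_well_order_on infinite_UNIV_nat
  by metis

lemma small_Un:
  "Card_order \<kappa> \<Longrightarrow> natLeq <o \<kappa> \<Longrightarrow> small \<kappa> S A \<Longrightarrow> small \<kappa> S B \<Longrightarrow> small \<kappa> S (A \<union> B)"
  unfolding small_def using card_of_Un_ordLess_infinite_Field[OF infinite_Field] by blast

lemma small_mono: "small \<kappa> S B \<Longrightarrow> A \<subseteq> B \<Longrightarrow> small \<kappa> S A"
  unfolding small_def using card_of_mono1 ordLeq_ordLess_trans by blast

lemma small_UN:
  assumes \<kappa>: "Card_order \<kappa>" "natLeq <o \<kappa>" and B: "small \<kappa> S B"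
    and f: "\<And>b. b \<in> B \<Longrightarrow> finite (f b) \<and> f b \<subseteq> univ S'"
  shows "small \<kappa> S' (\<Union>(f ` B))"
proof (cases "finite B")
  case True
  then show ?thesis using f by (intro small_finite[OF \<kappa>(2)]) auto
next
  case False
  have "|\<Union>(f ` B)| \<le>o |B|"
  proof (rule card_of_UNION_ordLeq_infinite[OF False])
    show "\<forall>b\<in>B. |f b| \<le>o |B|"
    proof
      fix b assume "b \<in> B"
      then have "|f b| <o |B|"
        using f False by (intro finite_ordLess_infinite card_of_Well_order) (simp_all add: Field_card_of)
      then show "|f b| \<le>o |B|" by (rule ordLess_imp_ordLeq)
    qed
  qed (simp add: card_of_Well_order ordLeq_reflexive)
  then show ?thesis using B f unfolding small_def by (auto intro: ordLeq_ordLess_trans)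
qed

lemma same_type_append:
  assumes "same_type L S {} (x @ c) r" "same_type L S {} (y @ c) r" "length x = length y"
    and "set x \<subseteq> univ S" "set y \<subseteq> univ S" "set c \<subseteq> univ S"
  shows "pe L S (set (zip x y) \<union> Id_on (set c))"
proof -
  have "same_type L S {} (x @ c) (y @ c)" using assms(1-3) by (auto simp: same_type_empty)
  then have "pe L S (set (zip (x @ c) (y @ c)) \<union> Id_on {})"
    using assms by (subst (asm) pe_same_type) auto
  then show ?thesis
    by (rule pe_mono) (use assms(3) in \<open>auto simp: zip_same_conv_map\<close>)
qed

section \<open>Real tuples: finitely many types, back and forth, compactness\<close>

locale omega_cat_model =
  fixes L :: "('f, 'r) lang" and M :: "('f, 'r, 'a) struct" and \<kappa> :: "'k rel"
  assumes struct: "is_struct L M" and card: "Card_order \<kappa>" and unc: "natLeq <o \<kappa>"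
    and sat: "saturated \<kappa> L M"
    and types: "\<exists>R. finite R \<and> R \<subseteq> tuples M n \<and> (\<forall>x\<in>tuples M n. \<exists>r\<in>R. same_type L M {} x r)"
begin

lemma univ_ne: "univ M \<noteq> {}"
  using struct by (simp add: is_struct_def)

text \<open>With \<open>c\<close> enumerating \<open>A\<close>, the type of \<open>x\<close> over
  \<open>A\<close> is determined by the type of \<open>x @ c\<close> over the empty set;
  \<open>f\<close> picks one tuple for each of the latter types that occurs.\<close>

lemma types_over:
  assumes A: "finite A" "A \<subseteq> univ M"
  shows "\<exists>R. finite R \<and> R \<subseteq> tuples M n \<and>
     (\<forall>x\<in>tuples M n. \<exists>r\<in>R. pe L M (set (zip x r) \<union> Id_on A))"
proof -
  obtain c where c: "set c = A" using finite_list[OF A(1)] by blast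
  obtain R' where R': "finite R'" "\<forall>x\<in>tuples M (n + length c). \<exists>r\<in>R'. same_type L M {} x r"
    using types by blast
  define f where "f r = (SOME x. x \<in> tuples M n \<and> same_type L M {} (x @ c) r)" for r
  have f: "f r \<in> tuples M n" "same_type L M {} (f r @ c) r"
    if "x \<in> tuples M n" "same_type L M {} (x @ c) r" for x r
    unfolding f_def using someI[of "\<lambda>x. x \<in> tuples M n \<and> same_type L M {} (x @ c) r"] that by blast+
  have "\<exists>r\<in>f ` R' \<inter> tuples M n. pe L M (set (zip x r) \<union> Id_on A)" if x: "x \<in> tuples M n" for x
  proof -
    have "x @ c \<in> tuples M (n + length c)" using x c A(2) by (auto simp: tuples_def)
    then obtain r where r: "r \<in> R'" "same_type L M {} (x @ c) r" using R'(2) by blast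
    have "pe L M (set (zip x (f r)) \<union> Id_on (set c))"
      using f[OF x r(2)] r(2) x A(2) c by (intro same_type_append[of L M x c r]) (auto simp: tuples_def)
    then show ?thesis using r(1) f(1)[OF x r(2)] c by blast
  qed
  then show ?thesis using R'(1) by (intro exI[of _ "f ` R' \<inter> tuples M n"]) auto
qed

lemma types_over1:
  assumes "finite A" "A \<subseteq> univ M"
  shows "\<exists>R. finite R \<and> R \<subseteq> univ M \<and> (\<forall>x\<in>univ M. \<exists>r\<in>R. pe L M (insert (x, r) (Id_on A)))"
proof -
  obtain R where R: "finite R" "R \<subseteq> tuples M 1"
     "\<forall>x\<in>tuples M 1. \<exists>r\<in>R. pe L M (set (zip x r) \<union> Id_on A)" using types_over[OF assms, of 1] by metis
  have hd: "r = [hd r]" if "r \<in> R" for r using R(2) that by (cases r) (auto simp: tuples_def)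
  have "\<exists>r\<in>hd ` R. pe L M (insert (x, r) (Id_on A))" if "x \<in> univ M" for x
  proof -
    have "[x] \<in> tuples M 1" using that by (simp add: tuples_def)
    then obtain r where r: "r \<in> R" "pe L M (set (zip [x] r) \<union> Id_on A)" using R(3) by blast
    have "set (zip [x] r) = {(x, hd r)}" by (subst hd[OF r(1)]) simp
    then show ?thesis using r by auto
  qed
  moreover have "hd r \<in> univ M" if "r \<in> R" for r
    using R(2) that hd[OF that] by (cases r) (auto simp: tuples_def)
  then have "hd ` R \<subseteq> univ M" by blast
  ultimately show ?thesis using R(1) by (intro exI[of _ "hd ` R"]) auto
qed

lemma orbit_pdef_M:
  assumes "a \<in> univ M" "finite C" "C \<subseteq> univ M"
  shows "pdef L M C {x. pe L M (insert (a, x) (Id_on C))}"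
  using types_over1[OF assms(2,3)] orbit_pdef[OF assms(1) pdef_univ assms(3)] by blast

lemma forth_M:
  assumes "pe L M P" "finite P" "d \<in> univ M"
  shows "\<exists>d'. pe L M (insert (d, d') P)"
proof (rule pe_forth[OF assms])
  have "Domain P \<subseteq> univ M" using pe_subset[OF assms(1)] by blast
  then show "pdef L M (Domain P) {x. pe L M (insert (d, x) (Id_on (Domain P)))}"
    using assms by (intro orbit_pdef_M finite_Domain)
qed

lemma forth_tuple:
  assumes "pe L M P" "finite P" "set x \<subseteq> univ M"
  shows "\<exists>y. length y = length x \<and> pe L M (set (zip x y) \<union> P)"
  using assms
proof (induction x arbitrary: P)
  case (Cons a x)
  obtain b where b: "pe L M (insert (a, b) P)" using forth_M[OF Cons.prems(1,2)] Cons.prems(3) by auto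
  obtain y where "length y = length x" "pe L M (set (zip x y) \<union> insert (a, b) P)"
    using Cons.IH[OF b] Cons.prems by auto
  then show ?case by (intro exI[of _ "b # y"]) simp
qed auto

text \<open>With finitely many types over \<open>C\<close>, an invariant set is a finite union of
  orbits, each of which is definable.\<close>

lemma invariant_pdef:
  assumes C: "finite C" "C \<subseteq> univ M" and W: "W \<subseteq> univ M"
    and inv: "\<And>x y. x \<in> W \<Longrightarrow> pe L M (insert (x, y) (Id_on C)) \<Longrightarrow> y \<in> W"
  shows "pdef L M C W"
proof -
  obtain R where R: "finite R" "\<And>x. x \<in> univ M \<Longrightarrow> \<exists>r\<in>R. pe L M (insert (x, r) (Id_on C))"
    using types_over1[OF C] by blast
  have "pdef L M C (\<Union>r\<in>R \<inter> W. {x. pe L M (insert (r, x) (Id_on C))})"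
    using R(1) C W by (intro pdef_UN orbit_pdef_M) auto
  moreover have "(\<Union>r\<in>R \<inter> W. {x. pe L M (insert (r, x) (Id_on C))}) = W"
  proof (intro set_eqI iffI)
    fix x assume x: "x \<in> W"
    then obtain r where r: "r \<in> R" "pe L M (insert (x, r) (Id_on C))" using R(2) W by blast
    have "pe L M (insert (r, x) (Id_on C))" by (rule pe_mono[OF pe_converse[OF r(2)]]) auto
    then show "x \<in> (\<Union>r\<in>R \<inter> W. {x. pe L M (insert (r, x) (Id_on C))})"
      using r inv[OF x r(2)] by blast
  qed (use inv in blast)
  ultimately show ?thesis by simp
qed

definition inv_over :: "nat \<Rightarrow> 'a set \<Rightarrow> 'a list set \<Rightarrow> bool" where
  "inv_over n C W \<longleftrightarrow> W \<subseteq> tuples M n \<and> (\<forall>x\<in>W. \<forall>y. length y = length x \<and>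
     pe L M (set (zip x y) \<union> Id_on C) \<longrightarrow> y \<in> W)"

lemma inv_over_tuples: "C \<subseteq> univ M \<Longrightarrow> inv_over n C (tuples M n)"
proof -
  have "y \<in> tuples M n" if "x \<in> tuples M n" "length y = length x"
      "pe L M (set (zip x y) \<union> Id_on C)" for x y
  proof -
    have "Range (set (zip x y)) = set y" using that(2) by (simp add: Range_snd flip: set_map)
    then have "set y \<subseteq> univ M" using pe_subset[OF that(3)] by blast
    then show ?thesis using that(1,2) by (simp add: tuples_def)
  qed
  then show ?thesis by (auto simp: inv_over_def)
qed

lemma inv_over_mono: "inv_over n C W \<Longrightarrow> C \<subseteq> D \<Longrightarrow> inv_over n D W"
proof -
  assume a: "inv_over n C W" "C \<subseteq> D"
  have "pe L M (set (zip x y) \<union> Id_on C)" if "pe L M (set (zip x y) \<union> Id_on D)" for x y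
    using that by (rule pe_mono) (use a(2) in auto)
  then show ?thesis using a(1) unfolding inv_over_def by blast
qed

text \<open>Saturation concerns single elements, so a tuple is found coordinate by coordinate: first
  an \<open>a\<close> that can begin a solution of every finite subfamily, then the rest over the
  parameters with \<open>a\<close> added.\<close>

lemma tuple_compactness:
  assumes "small \<kappa> M B"
    and "\<And>W. W \<in> \<W> \<Longrightarrow> \<exists>C. finite C \<and> C \<subseteq> B \<and> inv_over n C W"
    and "\<And>\<W>'. finite \<W>' \<Longrightarrow> \<W>' \<subseteq> \<W> \<Longrightarrow> \<exists>x\<in>tuples M n. x \<in> \<Inter>\<W>'"
  shows "\<exists>x\<in>tuples M n. x \<in> \<Inter>\<W>"
  using assms
proof (induction n arbitrary: B \<W>)
  case 0
  have t0: "tuples M 0 = {[]}" by (auto simp: tuples_def)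
  have "[] \<in> W" if "W \<in> \<W>" for W using 0(3)[of "{W}"] that t0 by auto
  then show ?case using t0 by blast
next
  case (Suc n)
  have B: "B \<subseteq> univ M" using Suc.prems(1) by (simp add: small_def)
  define pr where "pr W = {a. \<exists>xs. a # xs \<in> W}" for W :: "'a list set"
  \<comment> \<open>Projection does not commute with intersection, so the projections are taken of
    all finite intersections.\<close>
  define \<C> where "\<C> = (\<lambda>\<W>'. tuples M (Suc n) \<inter> \<Inter>\<W>') ` {\<W>'. finite \<W>' \<and> \<W>' \<subseteq> \<W>}"
  have inv: "\<exists>C. finite C \<and> C \<subseteq> B \<and> inv_over (Suc n) C W" if W: "W \<in> \<C>" for W
  proof -
    obtain \<W>' where w: "finite \<W>'" "\<W>' \<subseteq> \<W>" "W = tuples M (Suc n) \<inter> \<Inter>\<W>'"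
      using W unfolding \<C>_def by blast
    have "\<exists>C. \<forall>V\<in>\<W>'. finite (C V) \<and> C V \<subseteq> B \<and> inv_over (Suc n) (C V) V"
      using Suc.prems(2) w(2) by (intro bchoice) blast
    then obtain C where C: "\<And>V. V \<in> \<W>' \<Longrightarrow> finite (C V) \<and> C V \<subseteq> B \<and> inv_over (Suc n) (C V) V"
      by blast
    let ?C = "\<Union>(C ` \<W>')"
    have "inv_over (Suc n) ?C V" if "V \<in> \<W>'" for V
      using inv_over_mono[of "Suc n" "C V" V ?C] C[OF that] that by blast
    moreover have "inv_over (Suc n) ?C (tuples M (Suc n))" using C B by (intro inv_over_tuples) blast
    ultimately have "inv_over (Suc n) ?C W" unfolding w(3) inv_over_def by blast
    moreover have "finite ?C" "?C \<subseteq> B" using C w(1) by auto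
    ultimately show ?thesis by blast
  qed
  have "univ M \<inter> \<Inter>(pr ` \<C>) \<noteq> {}"
  proof (rule saturated_pdef[OF sat Suc.prems(1)])
    fix V assume "V \<in> pr ` \<C>"
    then obtain W where W: "W \<in> \<C>" "V = pr W" by blast
    obtain C where C: "finite C" "C \<subseteq> B" "inv_over (Suc n) C W" using inv[OF W(1)] by blast
    have Wt: "W \<subseteq> tuples M (Suc n)" using C(3) by (simp add: inv_over_def)
    have CU: "C \<subseteq> univ M" using C(2) B by blast
    have "pdef L M C V"
    proof (rule invariant_pdef[OF C(1) CU])
      show "V \<subseteq> univ M" using Wt unfolding W(2) pr_def tuples_def by fastforce
      fix x y assume x: "x \<in> V" and p: "pe L M (insert (x, y) (Id_on C))"
      obtain xs where xs: "x # xs \<in> W" using x unfolding W(2) pr_def by blast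
      then have "set xs \<subseteq> univ M" using subsetD[OF Wt xs] by (auto simp: tuples_def)
      moreover have "finite (insert (x, y) (Id_on C))" using C(1) by (simp add: Id_on_def)
      ultimately obtain ys where ys: "length ys = length xs"
        "pe L M (set (zip xs ys) \<union> insert (x, y) (Id_on C))" using forth_tuple[OF p] by blast
      then have "y # ys \<in> W" using C(3) xs unfolding inv_over_def by auto
      then show "y \<in> V" unfolding W(2) pr_def by blast
    qed
    then show "pdef L M B V" using C(2) by (rule pdef_mono)
  next
    fix \<V>' assume v: "finite \<V>'" "\<V>' \<subseteq> pr ` \<C>"
    obtain J where J: "J \<subseteq> \<C>" "finite J" "\<V>' = pr ` J"
      using finite_subset_image[OF v] by metis
    obtain K where K: "K \<subseteq> {\<W>'. finite \<W>' \<and> \<W>' \<subseteq> \<W>}" "finite K"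
      "J = (\<lambda>\<W>'. tuples M (Suc n) \<inter> \<Inter>\<W>') ` K"
      using finite_subset_image[OF J(2) J(1)[unfolded \<C>_def]] by metis
    have "finite (\<Union>K)" "\<Union>K \<subseteq> \<W>" using K(1,2) by auto
    then obtain x where x: "x \<in> tuples M (Suc n)" "x \<in> \<Inter>(\<Union>K)" using Suc.prems(3) by meson
    then obtain a xs where "x = a # xs" by (cases x) (auto simp: tuples_def)
    then have "a \<in> univ M \<inter> \<Inter>\<V>'" using x unfolding J(3) K(3) pr_def by (auto simp: tuples_def)
    then show "univ M \<inter> \<Inter>\<V>' \<noteq> {}" by blast
  qed
  then obtain a where a: "a \<in> univ M" "\<And>W. W \<in> \<C> \<Longrightarrow> a \<in> pr W" by blast
  define tl where "tl W = {xs. a # xs \<in> W}" for W :: "'a list set"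
  have "\<exists>x\<in>tuples M n. x \<in> \<Inter>(tl ` \<W>)"
  proof (rule Suc.IH[of "B \<union> {a}"])
    show "small \<kappa> M (B \<union> {a})"
      using a by (intro small_Un card unc Suc.prems(1) small_finite) auto
    fix V assume "V \<in> tl ` \<W>"
    then obtain W where W: "W \<in> \<W>" "V = tl W" by blast
    obtain C where C: "finite C" "C \<subseteq> B" "inv_over (Suc n) C W" using Suc.prems(2)[OF W(1)] by blast
    have "inv_over n (insert a C) V"
      unfolding inv_over_def
    proof (intro conjI ballI allI impI)
      have "W \<subseteq> tuples M (Suc n)" using C(3) by (simp add: inv_over_def)
      then show "V \<subseteq> tuples M n" unfolding W(2) tl_def tuples_def by fastforce
      fix xs ys assume xs: "xs \<in> V"
        and ys: "length ys = length xs \<and> pe L M (set (zip xs ys) \<union> Id_on (insert a C))"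
      have "pe L M (set (zip (a # xs) (a # ys)) \<union> Id_on C)"
        by (rule pe_mono[of L M "set (zip xs ys) \<union> Id_on (insert a C)"]) (use ys in auto)
      then show "ys \<in> V" using C(3) xs ys unfolding W(2) tl_def inv_over_def
        by (metis length_Cons mem_Collect_eq)
    qed
    then show "\<exists>C. finite C \<and> C \<subseteq> B \<union> {a} \<and> inv_over n C V"
      using C(1,2) by (intro exI[of _ "insert a C"]) auto
  next
    fix \<V>' assume v: "finite \<V>'" "\<V>' \<subseteq> tl ` \<W>"
    obtain J where J: "J \<subseteq> \<W>" "finite J" "\<V>' = tl ` J"
      using finite_subset_image[OF v] by metis
    have "tuples M (Suc n) \<inter> \<Inter>J \<in> \<C>" using J unfolding \<C>_def by blast
    then obtain xs where "a # xs \<in> tuples M (Suc n) \<inter> \<Inter>J" using a(2) unfolding pr_def by blast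
    then show "\<exists>x\<in>tuples M n. x \<in> \<Inter>\<V>'"
      unfolding J(3) tl_def by (intro bexI[of _ xs]) (auto simp: tuples_def)
  qed
  then obtain xs where xs: "xs \<in> tuples M n" "\<And>W. W \<in> \<W> \<Longrightarrow> a # xs \<in> W" unfolding tl_def by blast
  have "a # xs \<in> tuples M (Suc n)" using xs(1) a(1) by (auto simp: tuples_def)
  then show ?case using xs(2) by blast
qed

section \<open>Sorts and representatives of imaginaries\<close>

abbreviation Leq where "Leq \<equiv> eq_lang L M"
abbreviation Meq where "Meq \<equiv> eq_struct L M"
abbreviation U where "U \<equiv> univ Meq"

definition h where "h = Id_on (tuples M 1)"

lemma def_equiv_ne: "def_equiv L M n E \<Longrightarrow> \<exists>x. x \<in> tuples M n \<and> (x, x) \<in> E"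
proof -
  assume d: "def_equiv L M n E"
  obtain a where "a \<in> univ M" using univ_ne by blast
  then have "replicate n a \<in> tuples M n" by (auto simp: tuples_def)
  then show ?thesis using d by (auto simp: def_equiv_def equiv_def refl_on_def)
qed

lemma def_equiv_sub: "def_equiv L M n E \<Longrightarrow> E \<subseteq> tuples M n \<times> tuples M n"
  unfolding def_equiv_def by auto

lemma def_equiv_unique: "def_equiv L M n E \<Longrightarrow> def_equiv L M m E \<Longrightarrow> n = m"
  using def_equiv_ne[of n E] def_equiv_sub[of n E] def_equiv_sub[of m E]
  by (fastforce simp: tuples_def)

lemma U_iff: "e \<in> U \<longleftrightarrow> (\<exists>n. def_equiv L M n (fst e) \<and> snd e \<in> tuples M n // fst e)"
  by (cases e) (auto simp: eq_struct_def)

lemma rep_ex: "e \<in> U \<Longrightarrow> \<exists>x. x \<in> snd e"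
  unfolding U_iff def_equiv_def using in_quotient_imp_non_empty by blast

lemma rep_tuple:
  assumes "e \<in> U" "x \<in> snd e" "def_equiv L M n (fst e)"
  shows "x \<in> tuples M n" "e = (fst e, fst e `` {x})"
proof -
  obtain m where m: "def_equiv L M m (fst e)" "snd e \<in> tuples M m // fst e"
    using assms(1) unfolding U_iff by blast
  have n: "m = n" using def_equiv_unique m(1) assms(3) by blast
  have eq: "equiv (tuples M n) (fst e)" using assms(3) by (simp add: def_equiv_def)
  show "x \<in> tuples M n" using m(2) assms(2) n eq in_quotient_imp_subset by blast
  have "snd e = fst e `` {x}"
  proof -
    obtain y where y: "snd e = fst e `` {y}" using m(2) by (rule quotientE)
    then have "(y, x) \<in> fst e" using assms(2) by simp
    then show ?thesis using y equiv_class_eq[OF eq] by simp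
  qed
  then show "e = (fst e, fst e `` {x})" by (metis prod.collapse)
qed

lemma U_I: "def_equiv L M n E \<Longrightarrow> x \<in> tuples M n \<Longrightarrow> (E, E `` {x}) \<in> U"
  unfolding U_iff by (auto intro: quotientI)

lemma rep_self: "def_equiv L M n E \<Longrightarrow> x \<in> tuples M n \<Longrightarrow> x \<in> E `` {x}"
  unfolding def_equiv_def by (elim conjE) (rule equiv_class_self)

lemma U_arity: "e \<in> U \<Longrightarrow> \<exists>n. def_equiv L M n (fst e)"
  unfolding U_iff by blast

lemma eq_iff_rep:
  assumes "a \<in> U" "c \<in> U" "fst a = fst c" "x \<in> snd a" "y \<in> snd c"
  shows "a = c \<longleftrightarrow> (x, y) \<in> fst a"
proof -
  obtain n where n: "def_equiv L M n (fst a)" using U_arity assms(1) by blast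
  have eq: "equiv (tuples M n) (fst a)" using n by (simp add: def_equiv_def)
  have x: "x \<in> tuples M n" "a = (fst a, fst a `` {x})" using rep_tuple[OF assms(1,4) n] by auto
  have y: "y \<in> tuples M n" "c = (fst a, fst a `` {y})" using rep_tuple[OF assms(2,5)] n assms(3) by auto
  have "snd a = fst a `` {x}" "snd c = fst a `` {y}"
    using arg_cong[OF x(2), of snd] arg_cong[OF y(2), of snd] by simp_all
  then have "a = c \<longleftrightarrow> fst a `` {x} = fst a `` {y}" using assms(3) by (simp add: prod_eq_iff)
  then show ?thesis using eq_equiv_class_iff[OF eq x(1) y(1)] by simp
qed

lemma equiv_pe:
  assumes Q: "pe L M Q" and E: "def_equiv L M n E"
    and x: "x \<in> tuples M n" "x' \<in> tuples M n" "set (zip x y) \<subseteq> Q" "set (zip x' y') \<subseteq> Q"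
    and y: "y \<in> tuples M n" "y' \<in> tuples M n"
  shows "(x, x') \<in> E \<longleftrightarrow> (y, y') \<in> E"
proof -
  obtain \<phi> where \<phi>: "form L (n + n) \<phi>"
    "E = {(as, bs). as \<in> tuples M n \<and> bs \<in> tuples M n \<and> holds M \<phi> (as @ bs)}"
    using E unfolding def_equiv_def by blast
  have "holds M \<phi> (x @ x') \<longleftrightarrow> holds M \<phi> (y @ y')"
    by (rule pe_holds[OF Q]) (use \<phi>(1) x y in \<open>auto simp: tuples_def\<close>)
  then show ?thesis using \<phi>(2) x y by auto
qed

lemma def_equiv_h: "def_equiv L M 1 h"
proof -
  have "form L (1 + 1) (Eq (Var 0) (Var 1))" by (auto simp: form_def)
  moreover have "h = {(as, bs). as \<in> tuples M 1 \<and> bs \<in> tuples M 1 \<and> holds M (Eq (Var 0) (Var 1)) (as @ bs)}"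
    by (auto simp: h_def tuples_def holds_def length_Suc_conv)
  moreover have "equiv (tuples M 1) h"
    by (auto simp: h_def intro!: equivI refl_onI symI transI)
  ultimately show ?thesis unfolding def_equiv_def by blast
qed

lemma def_equiv_trivial: "0 < n \<Longrightarrow> def_equiv L M n (tuples M n \<times> tuples M n)"
  unfolding def_equiv_def
  by (auto simp: form_def holds_def intro!: equivI refl_onI symI transI exI[of _ "Eq (Var 0) (Var 0)"])

text \<open>The trivial equivalence relations on \<open>n\<close>-tuples give one sort for each
  positive \<open>n\<close>, so infinitely many sorts remain outside any finite set. This supplies
  the interchangeable elements used below.\<close>

lemma infinite_fresh:
  assumes "finite \<E>"
  shows "infinite {u \<in> U. fst u \<notin> \<E>}"
proof
  assume fin: "finite {u \<in> U. fst u \<notin> \<E>}"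
  define f where "f n = (tuples M (Suc n) \<times> tuples M (Suc n))" for n
  have "inj f"
  proof (rule injI)
    fix m n assume "f m = f n"
    then show "m = n" using def_equiv_unique def_equiv_trivial[of "Suc m"] def_equiv_trivial[of "Suc n"]
      by (metis Suc_inject f_def zero_less_Suc)
  qed
  then have "infinite (range f)" by (rule range_inj_infinite)
  moreover have "range f \<subseteq> \<E> \<union> fst ` {u \<in> U. fst u \<notin> \<E>}"
  proof
    fix E assume "E \<in> range f"
    then obtain n where n: "def_equiv L M (Suc n) E" using def_equiv_trivial f_def by auto
    then obtain x where "x \<in> tuples M (Suc n)" using def_equiv_ne by blast
    then have "(E, E `` {x}) \<in> U" using U_I n by blast
    then show "E \<in> \<E> \<union> fst ` {u \<in> U. fst u \<notin> \<E>}" by force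
  qed
  ultimately show False using assms fin finite_subset by blast
qed

lemma real_elem_iff: "e \<in> U \<and> fst e = h \<longleftrightarrow> (\<exists>a\<in>univ M. e = real_elem M a)"
proof
  assume e: "e \<in> U \<and> fst e = h"
  then obtain x where x: "x \<in> snd e" using rep_ex by blast
  have t: "x \<in> tuples M 1" "e = (fst e, fst e `` {x})" using rep_tuple[of e x 1] e x def_equiv_h by auto
  then obtain a where a: "x = [a]" "a \<in> univ M" by (auto simp: tuples_def length_Suc_conv)
  have "h `` {x} = {[a]}" using t(1) a(1) by (auto simp: h_def)
  then show "\<exists>a\<in>univ M. e = real_elem M a" using t(2) e a(2) by (auto simp: real_elem_def h_def)
next
  assume "\<exists>a\<in>univ M. e = real_elem M a"
  then obtain a where a: "a \<in> univ M" "e = real_elem M a" by blast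
  then have "[a] \<in> tuples M 1" by (simp add: tuples_def)
  moreover from this have "e = (h, h `` {[a]})" using a by (auto simp: real_elem_def h_def)
  ultimately show "e \<in> U \<and> fst e = h" using U_I[OF def_equiv_h] by auto
qed

lemma home_eq: "home M = {e \<in> U. fst e = h}"
proof (rule set_eqI)
  fix e show "e \<in> home M \<longleftrightarrow> e \<in> {e \<in> U. fst e = h}"
    unfolding mem_Collect_eq real_elem_iff by (simp add: home_def image_iff)
qed

lemma real_elem_rep: "x \<in> snd (real_elem M a) \<longleftrightarrow> x = [a]"
  by (simp add: real_elem_def)

section \<open>Back and forth between finite sets of imaginaries\<close>

definition reps_in :: "('a list \<times> 'a list) set set \<Rightarrow> ('a imag \<times> 'a imag) set \<Rightarrow> ('a \<times> 'a) set \<Rightarrow> bool" where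
  "reps_in \<E> P Q \<longleftrightarrow> (\<forall>a b. (a, b) \<in> P \<and> fst a \<in> \<E> \<longrightarrow> (\<exists>x\<in>snd a. \<exists>y\<in>snd b. set (zip x y) \<subseteq> Q))"

lemma reps_inD:
  "reps_in \<E> P Q \<Longrightarrow> (a, b) \<in> P \<Longrightarrow> fst a \<in> \<E> \<Longrightarrow> \<exists>x\<in>snd a. \<exists>y\<in>snd b. set (zip x y) \<subseteq> Q"
  unfolding reps_in_def by (elim allE impE) (rule conjI)

text \<open>Back and forth: imaginaries of sorts outside the finite set \<open>\<E>\<close> are only required to
  be distinct, since a formula mentioning no sort outside \<open>\<E>\<close> cannot tell them apart.\<close>
definition bf :: "('a list \<times> 'a list) set set \<Rightarrow> ('a imag \<times> 'a imag) set \<Rightarrow> bool" where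
  "bf \<E> P \<longleftrightarrow> P \<subseteq> U \<times> U \<and> (\<forall>a b c d. (a, b) \<in> P \<and> (c, d) \<in> P \<longrightarrow> (a = c \<longleftrightarrow> b = d)) \<and>
     (\<forall>a b. (a, b) \<in> P \<and> (fst a \<in> \<E> \<or> fst b \<in> \<E>) \<longrightarrow> fst a = fst b) \<and>
     (\<exists>Q. finite Q \<and> pe L M Q \<and> reps_in \<E> P Q)"

lemma bfI:
  assumes "P \<subseteq> U \<times> U" "\<And>a b c d. (a, b) \<in> P \<Longrightarrow> (c, d) \<in> P \<Longrightarrow> a = c \<longleftrightarrow> b = d"
    and "\<And>a b. (a, b) \<in> P \<Longrightarrow> fst a \<in> \<E> \<or> fst b \<in> \<E> \<Longrightarrow> fst a = fst b"
    and "finite Q" "pe L M Q"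
    and "\<And>a b. (a, b) \<in> P \<Longrightarrow> fst a \<in> \<E> \<Longrightarrow> \<exists>x\<in>snd a. \<exists>y\<in>snd b. set (zip x y) \<subseteq> Q"
  shows "bf \<E> P"
proof -
  have "reps_in \<E> P Q" unfolding reps_in_def using assms(6) by simp
  moreover have "\<forall>a b c d. (a, b) \<in> P \<and> (c, d) \<in> P \<longrightarrow> (a = c \<longleftrightarrow> b = d)"
    by (intro allI impI, elim conjE) (rule assms(2))
  moreover have "\<forall>a b. (a, b) \<in> P \<and> (fst a \<in> \<E> \<or> fst b \<in> \<E>) \<longrightarrow> fst a = fst b"
    by (intro allI impI, elim conjE) (rule assms(3))
  ultimately show ?thesis unfolding bf_def using assms(1,4,5) by (intro conjI exI[of _ Q])
qed

lemma bf_subset: "bf \<E> P \<Longrightarrow> P \<subseteq> U \<times> U"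
  unfolding bf_def by (rule conjunct1)

lemma bf_inj:
  assumes "bf \<E> P" "(a, b) \<in> P" "(c, d) \<in> P"
  shows "a = c \<longleftrightarrow> b = d"
proof -
  have "\<forall>a b c d. (a, b) \<in> P \<and> (c, d) \<in> P \<longrightarrow> (a = c \<longleftrightarrow> b = d)"
    using assms(1) unfolding bf_def by (elim conjE)
  from this[rule_format, OF conjI[OF assms(2,3)]] show ?thesis .
qed

lemma bf_sort: "bf \<E> P \<Longrightarrow> (a, b) \<in> P \<Longrightarrow> fst a \<in> \<E> \<or> fst b \<in> \<E> \<Longrightarrow> fst a = fst b"
  unfolding bf_def by meson

lemma bf_rep: "bf \<E> P \<Longrightarrow> \<exists>Q. finite Q \<and> pe L M Q \<and> reps_in \<E> P Q"
  unfolding bf_def by (elim conjE)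

lemma zip_converse: "set (zip x y) \<subseteq> Q \<Longrightarrow> set (zip y x) \<subseteq> Q\<inverse>"
  by (auto simp: set_zip)

lemma bf_converse:
  assumes "bf \<E> P"
  shows "bf \<E> (P\<inverse>)"
proof -
  obtain Q where Q: "finite Q" "pe L M Q" "reps_in \<E> P Q" using bf_rep[OF assms] by blast
  show ?thesis
  proof (rule bfI)
    show "P\<inverse> \<subseteq> U \<times> U" using bf_subset[OF assms] by blast
    show "finite (Q\<inverse>)" using Q(1) by simp
    show "pe L M (Q\<inverse>)" by (rule pe_converse[OF Q(2)])
    show "a = c \<longleftrightarrow> b = d" if "(a, b) \<in> P\<inverse>" "(c, d) \<in> P\<inverse>" for a b c d
      using bf_inj[OF assms, of b a d c] that by simp
    show "fst a = fst b" if "(a, b) \<in> P\<inverse>" "fst a \<in> \<E> \<or> fst b \<in> \<E>" for a b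
      using bf_sort[OF assms, of b a] that by auto
    fix b a assume ab: "(b, a) \<in> P\<inverse>" "fst b \<in> \<E>"
    then have "fst a \<in> \<E>" using bf_sort[OF assms, of a b] by simp
    then obtain x y where xy: "x \<in> snd a" "y \<in> snd b" "set (zip x y) \<subseteq> Q" using reps_inD[OF Q(3), of a b] ab by auto
    then have "set (zip y x) \<subseteq> Q\<inverse>" by (intro zip_converse)
    then show "\<exists>x\<in>snd b. \<exists>y\<in>snd a. set (zip x y) \<subseteq> Q\<inverse>" using xy by blast
  qed
qed

lemma bf_forth:
  assumes bf: "bf \<E> P" and fin: "finite \<E>" "finite P" and a: "a \<in> U"
  shows "\<exists>b. bf \<E> (insert (a, b) P)"
proof (cases "a \<in> Domain P")
  case True
  then obtain b where "(a, b) \<in> P" by blast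
  then have "insert (a, b) P = P" by blast
  then show ?thesis using bf by metis
next
  case False
  obtain Q where Q: "finite Q" "pe L M Q" "reps_in \<E> P Q" using bf_rep[OF bf] by blast
  note P = bf_subset[OF bf] and inj = bf_inj[OF bf] and s = bf_sort[OF bf]
  have fin_ext: "bf \<E> (insert (a, b) P)"
    if b: "b \<in> U" "b \<notin> Range P" "fst a \<in> \<E> \<or> fst b \<in> \<E> \<Longrightarrow> fst a = fst b"
      and Q': "finite Q'" "pe L M Q'" "Q \<subseteq> Q'"
        "fst a \<in> \<E> \<Longrightarrow> \<exists>x\<in>snd a. \<exists>y\<in>snd b. set (zip x y) \<subseteq> Q'" for b Q'
  proof (rule bfI[OF _ _ _ Q'(1,2)])
    show "insert (a, b) P \<subseteq> U \<times> U" using a b(1) P by blast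
    show "a' = c \<longleftrightarrow> b' = d" if ab: "(a', b') \<in> insert (a, b) P" "(c, d) \<in> insert (a, b) P" for a' b' c d
    proof -
      have "(a', b') = (a, b) \<or> (a', b') \<in> P" "(c, d) = (a, b) \<or> (c, d) \<in> P" using ab by auto
      then show ?thesis
        using inj[of a' b' c d] DomainI[of a' b' P] DomainI[of c d P] RangeI[of a' b' P]
          RangeI[of c d P] False b(2) by auto
    qed
    show "fst a' = fst b'" if "(a', b') \<in> insert (a, b) P" "fst a' \<in> \<E> \<or> fst b' \<in> \<E>" for a' b'
      using s[of a' b'] b(3) that by auto
    fix a' b' assume p: "(a', b') \<in> insert (a, b) P" and e: "fst a' \<in> \<E>"
    show "\<exists>x\<in>snd a'. \<exists>y\<in>snd b'. set (zip x y) \<subseteq> Q'"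
    proof (cases "(a', b') \<in> P")
      case True
      then show ?thesis using reps_inD[OF Q(3) True e] Q'(3) by (meson subset_trans)
    next
      case False
      then show ?thesis using p e Q'(4) by simp
    qed
  qed
  show ?thesis
  proof (cases "fst a \<in> \<E>")
    case True
    obtain n where n: "def_equiv L M n (fst a)" using U_arity a by blast
    obtain x where x: "x \<in> snd a" using rep_ex a by blast
    have xt: "x \<in> tuples M n" using rep_tuple(1)[OF a x n] .
    then obtain y where y: "length y = length x" "pe L M (set (zip x y) \<union> Q)"
      using forth_tuple[OF Q(2,1)] by (auto simp: tuples_def)
    have "Range (set (zip x y)) = set y" using y(1) by (simp add: Range_snd flip: set_map)
    then have "set y \<subseteq> univ M" using pe_subset[OF y(2)] by blast
    then have yt: "y \<in> tuples M n" using xt y(1) by (simp add: tuples_def)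
    define b where "b = (fst a, fst a `` {y})"
    have bU: "b \<in> U" using U_I[OF n yt] by (simp add: b_def)
    have yb: "y \<in> snd b" using rep_self[OF n yt] by (simp add: b_def)
    \<comment> \<open>\<open>Q\<close> preserves and reflects equivalence of representatives, so a
      clash on the range side would already be one on the domain side.\<close>
    have "b \<notin> Range P"
    proof
      assume "b \<in> Range P"
      then obtain c where c: "(c, b) \<in> P" by blast
      have fb: "fst b = fst a" by (simp add: b_def)
      then have fc: "fst c = fst a" using s[OF c] True by simp
      then obtain x' y' where x': "x' \<in> snd c" "y' \<in> snd b" "set (zip x' y') \<subseteq> Q"
        using reps_inD[OF Q(3) c] True by auto
      have cU: "c \<in> U" using P c by blast
      have t: "x' \<in> tuples M n" "y' \<in> tuples M n"
        using rep_tuple(1)[OF cU x'(1)] rep_tuple(1)[OF bU x'(2)] n fc fb by auto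
      have "(x, x') \<in> fst a \<longleftrightarrow> (y, y') \<in> fst a"
        by (rule equiv_pe[OF y(2) n xt t(1) _ _ yt t(2)]) (use x'(3) in auto)
      moreover have "(y, y') \<in> fst a" using eq_iff_rep[OF bU bU refl yb x'(2)] fb by simp
      ultimately have "a = c" using eq_iff_rep[OF a cU fc[symmetric] x x'(1)] by simp
      then show False using False c by blast
    qed
    then have "bf \<E> (insert (a, b) P)"
      by (rule fin_ext[OF bU _ _ _ y(2)]) (use Q(1) x yb in \<open>auto simp: b_def\<close>)
    then show ?thesis by blast
  next
    case aE: False
    have "finite (Range P)" using fin(2) by (rule finite_Range)
    then obtain b where b: "b \<in> U" "fst b \<notin> \<E>" "b \<notin> Range P"
      using infinite_fresh[OF fin(1)] by (metis (mono_tags, lifting) finite_subset mem_Collect_eq subsetI)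
    have "bf \<E> (insert (a, b) P)" by (rule fin_ext[OF b(1,3) _ Q(1,2)]) (use aE b(2) in auto)
    then show ?thesis by blast
  qed
qed

lemma bf_real:
  assumes bf: "bf \<E> P" and h: "h \<in> \<E>" and Q: "pe L M Q" "reps_in \<E> P Q"
    and a: "(real_elem M a, e) \<in> P" "a \<in> univ M"
  shows "\<exists>b\<in>univ M. e = real_elem M b \<and> (a, b) \<in> Q"
proof -
  have "fst (real_elem M a) = h" by (simp add: real_elem_def h_def)
  then have "fst e = h" using bf_sort[OF bf a(1)] h by simp
  moreover have "e \<in> U" using bf_subset[OF bf] a(1) by blast
  ultimately obtain b where b: "b \<in> univ M" "e = real_elem M b" using real_elem_iff by blast
  obtain x y where "x \<in> snd (real_elem M a)" "y \<in> snd e" "set (zip x y) \<subseteq> Q"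
    using reps_inD[OF Q(2) a(1)] h \<open>fst (real_elem M a) = h\<close> by auto
  then have "(a, b) \<in> Q" unfolding b(2) real_elem_rep by simp
  then show ?thesis using b by blast
qed

lemma bf_real_list:
  assumes bf: "bf \<E> P" and h: "h \<in> \<E>" and Q: "pe L M Q" "reps_in \<E> P Q"
    and as: "set as \<subseteq> univ M" "set (zip (map (real_elem M) as) es) \<subseteq> P" "length es = length as"
  shows "\<exists>bs. es = map (real_elem M) bs \<and> set bs \<subseteq> univ M \<and> length bs = length as \<and> set (zip as bs) \<subseteq> Q"
  using as
proof (induction as arbitrary: es)
  case (Cons a as)
  then obtain e es' where es: "es = e # es'" by (cases es) auto
  obtain b where b: "b \<in> univ M" "e = real_elem M b" "(a, b) \<in> Q"
    using bf_real[OF bf h Q, of a e] Cons.prems es by auto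
  obtain bs where "es' = map (real_elem M) bs" "set bs \<subseteq> univ M" "length bs = length as"
    "set (zip as bs) \<subseteq> Q" using Cons.IH[of es'] Cons.prems es by auto
  then show ?case using b es by (intro exI[of _ "b # bs"]) auto
qed auto

text \<open>The sorts to which the symbol is sensitive. The sort \<open>h\<close> is always among
  them, so that real arguments are moved by \<open>Q\<close> itself.\<close>

fun needed :: "('f, 'r, 'a) eqsym \<Rightarrow> ('a list \<times> 'a list) set set" where
  "needed (Sort E) = {E, h}"
| "needed (Proj E) = {E, h}"
| "needed _ = {h}"

lemma bf_rel:
  assumes bf: "bf \<E> P" and s: "s \<in> rels Leq" "needed s \<subseteq> \<E>"
    and es: "length es = rarity Leq s" "length es' = length es" "set (zip es es') \<subseteq> P"
    and r: "relI Meq s es"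
  shows "relI Meq s es'"
proof -
  obtain Q where Q: "pe L M Q" "reps_in \<E> P Q" using bf_rep[OF bf] by blast
  have h: "h \<in> \<E>" using s(2) by (cases s) auto
  have sf: "fst a = fst b" if "(a, b) \<in> P" "fst a \<in> \<E>" for a b
    using bf_sort[OF bf] that by blast
  note PU = bf_subset[OF bf]
  show ?thesis
  proof (cases s)
    case (Base R)
    then obtain as where as: "as \<in> tuples M (rarity L R)" "es = map (real_elem M) as" "relI M R as"
      using r by (auto simp: eq_struct_def)
    obtain bs where bs: "es' = map (real_elem M) bs" "set bs \<subseteq> univ M" "length bs = length as"
      "set (zip as bs) \<subseteq> Q"
      using bf_real_list[OF bf h Q, of as es'] as es by (auto simp: tuples_def)
    let ?\<phi> = "Rel R (map Var [0..<length as])"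
    have R: "R \<in> rels L" using s(1) Base by (auto simp: eq_lang_def)
    have ev: "map (eval_tm M ((!) xs)) (map Var [0..<length xs]) = xs" for xs
      by (rule nth_equalityI) auto
    have "holds M ?\<phi> as \<longleftrightarrow> holds M ?\<phi> bs"
      by (rule pe_holds[OF Q(1)]) (use as(1) bs R in \<open>auto simp: form_def tuples_def\<close>)
    then have "relI M R as \<longleftrightarrow> relI M R bs"
      using ev[of as] ev[of bs] bs(3) by (simp add: holds_def del: map_map)
    then show ?thesis using as bs Base by (auto simp: eq_struct_def tuples_def)
  next
    case (Graph f)
    then obtain as where as: "as \<in> tuples M (farity L f)"
      "es = map (real_elem M) (as @ [funI M f as])" using r by (auto simp: eq_struct_def)
    have f: "f \<in> funs L" using s(1) Graph by (auto simp: eq_lang_def)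
    have fU: "funI M f as \<in> univ M" using struct as(1) f by (auto simp: is_struct_def tuples_def)
    obtain cs where cs: "es' = map (real_elem M) cs" "set cs \<subseteq> univ M"
      "length cs = Suc (length as)" "set (zip (as @ [funI M f as]) cs) \<subseteq> Q"
      using bf_real_list[OF bf h Q, of "as @ [funI M f as]" es'] as es fU by (auto simp: tuples_def)
    then obtain bs c where bc: "cs = bs @ [c]" by (cases cs rule: rev_cases) auto
    let ?\<phi> = "Eq (App f (map Var [0..<length as])) (Var (length as))"
    have ev: "map (eval_tm M ((!) (xs @ [x]))) (map Var [0..<length xs]) = xs" for xs x
      by (rule nth_equalityI) (auto simp: nth_append)
    have "holds M ?\<phi> (as @ [funI M f as]) \<longleftrightarrow> holds M ?\<phi> (bs @ [c])"
      by (rule pe_holds[OF Q(1)]) (use as(1) cs bc f in \<open>auto simp: form_def tuples_def\<close>)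
    moreover have bl: "length bs = length as" using cs(3) bc by simp
    moreover from bl have "(bs @ [c]) ! length as = c" by (metis nth_append_length)
    ultimately have "funI M f bs = c"
      using ev[of as "funI M f as"] ev[of bs c] by (simp add: holds_def del: map_map)
    then show ?thesis using as cs bc Graph by (auto simp: eq_struct_def tuples_def)
  next
    case (Sort E)
    then obtain X where X: "es = [(E, X)]" using r by (auto simp: eq_struct_def)
    then obtain e where e: "es' = [e]" using es(2) by (auto simp: length_Suc_conv)
    have "fst e = E" using sf[of "(E, X)" e] es(3) X e s(2) Sort by auto
    then show ?thesis using e Sort by (cases e) (auto simp: eq_struct_def)
  next
    case (Proj E)
    then obtain n as where as: "as \<in> tuples M n" "def_equiv L M n E"
      "es = map (real_elem M) as @ [(E, E `` {as})]" using r by (auto simp: eq_struct_def)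
    obtain es1 e where e: "es' = es1 @ [e]" using es(2) as(3) by (cases es' rule: rev_cases) auto
    have l1: "length es1 = length as" using e es(2) as(3) by simp
    have z: "set (zip (map (real_elem M) as) es1) \<subseteq> P" "((E, E `` {as}), e) \<in> P"
      using es(3) as(3) e l1 by auto
    obtain bs where bs: "es1 = map (real_elem M) bs" "set bs \<subseteq> univ M" "length bs = length as"
      "set (zip as bs) \<subseteq> Q"
      using bf_real_list[OF bf h Q _ z(1) l1] as(1) by (auto simp: tuples_def)
    have EE: "E \<in> \<E>" using s(2) Proj by simp
    have fe: "fst e = E" using sf[OF z(2)] EE by simp
    obtain x y where xy: "x \<in> E `` {as}" "y \<in> snd e" "set (zip x y) \<subseteq> Q"
      using reps_inD[OF Q(2) z(2)] EE by auto
    have U: "(E, E `` {as}) \<in> U" "e \<in> U" using z(2) PU by auto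
    have bt: "bs \<in> tuples M n" using as(1) bs by (simp add: tuples_def)
    have x: "x \<in> tuples M n" using rep_tuple(1)[OF U(1), of x n] xy(1) as(2) by simp
    have y: "y \<in> tuples M n" "e = (E, E `` {y})" using rep_tuple[OF U(2) xy(2)] as(2) fe by auto
    have "(bs, y) \<in> E" using equiv_pe[OF Q(1) as(2,1) x bs(4) xy(3) bt y(1)] xy(1) by blast
    then have "E `` {bs} = E `` {y}" using as(2) equiv_class_eq unfolding def_equiv_def by metis
    then have "e = (E, E `` {bs})" using y(2) by simp
    then show ?thesis using e bs(1) bt as(2) Proj by (auto simp: eq_struct_def)
  qed
qed

text \<open>The finite set of sorts depends on the formula alone. A quantifier is handled by
  extending the map by one pair; the reverse implications follow by passing to the converse
  map.\<close>

lemma bf_sat: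
  assumes "wf_fm Leq \<phi>"
  shows "\<exists>\<E>0. finite \<E>0 \<and> (\<forall>\<E> P v w. finite \<E> \<and> \<E>0 \<subseteq> \<E> \<and> finite P \<and> bf \<E> P \<and>
     (\<forall>i\<in>fv \<phi>. (v i, w i) \<in> P) \<longrightarrow> (sat Meq v \<phi> \<longleftrightarrow> sat Meq w \<phi>))"
  using assms
proof (induction \<phi>)
  have tm: "\<exists>i. t = Var i" if "wf_tm Leq t" for t
    using that by (cases t) (auto simp: eq_lang_def)
  {
    case (Eq s t)
    then obtain i j where ij: "s = Var i" "t = Var j" using tm by auto metis
    have "sat Meq v (Eq s t) \<longleftrightarrow> sat Meq w (Eq s t)"
      if "bf \<E> P" "\<forall>i\<in>fv (Eq s t). (v i, w i) \<in> P" for \<E> P v w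
      using bf_inj[OF that(1), of "v i" "w i" "v j" "w j"] that(2) ij by simp
    then show ?case by (intro exI[of _ "{}"]) blast
  next
    case (Rel s ts)
    have imp: "sat Meq w (Rel s ts)"
      if h: "needed s \<subseteq> \<E>" "bf \<E> P" "\<forall>i\<in>fv (Rel s ts). (v i, w i) \<in> P"
      and sv: "sat Meq v (Rel s ts)" for \<E> P v w
    proof -
      have "(eval_tm Meq v t, eval_tm Meq w t) \<in> P" if t: "t \<in> set ts" for t
      proof -
        obtain i where "t = Var i" using tm Rel t by auto
        then show ?thesis using h(3) t by auto
      qed
      then have "set (zip (map (eval_tm Meq v) ts) (map (eval_tm Meq w) ts)) \<subseteq> P"
        by (auto simp: set_zip)
      then show ?thesis
        using bf_rel[OF h(2) _ h(1), of "map (eval_tm Meq v) ts" "map (eval_tm Meq w) ts"] Rel sv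
        by auto
    qed
    have "finite (needed s)" by (cases s) auto
    moreover have "sat Meq v (Rel s ts) \<longleftrightarrow> sat Meq w (Rel s ts)"
      if "needed s \<subseteq> \<E>" "bf \<E> P" "\<forall>i\<in>fv (Rel s ts). (v i, w i) \<in> P" for \<E> P v w
      using imp[OF that] imp[OF that(1) bf_converse[OF that(2)], of w v] that(3) by blast
    ultimately show ?case by (intro exI[of _ "needed s"]) blast
  next
    case (Neg \<phi>)
    then show ?case by simp
  next
    case (Conj \<phi> \<psi>)
    then obtain \<E>1 \<E>2 where e: "finite \<E>1" "\<And>\<E> P v w. finite \<E> \<and> \<E>1 \<subseteq> \<E> \<and> finite P \<and> bf \<E> P \<and>
     (\<forall>i\<in>fv \<phi>. (v i, w i) \<in> P) \<Longrightarrow> (sat Meq v \<phi> \<longleftrightarrow> sat Meq w \<phi>)" "finite \<E>2"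
     "\<And>\<E> P v w. finite \<E> \<and> \<E>2 \<subseteq> \<E> \<and> finite P \<and> bf \<E> P \<and>
     (\<forall>i\<in>fv \<psi>. (v i, w i) \<in> P) \<Longrightarrow> (sat Meq v \<psi> \<longleftrightarrow> sat Meq w \<psi>)"
      by auto
    show ?case
    proof (intro exI[of _ "\<E>1 \<union> \<E>2"] conjI allI impI)
      show "finite (\<E>1 \<union> \<E>2)" using e by simp
      fix \<E> P v w assume "finite \<E> \<and> \<E>1 \<union> \<E>2 \<subseteq> \<E> \<and> finite P \<and> bf \<E> P \<and>
        (\<forall>i\<in>fv (Conj \<phi> \<psi>). (v i, w i) \<in> P)"
      then show "sat Meq v (Conj \<phi> \<psi>) \<longleftrightarrow> sat Meq w (Conj \<phi> \<psi>)"
        using e(2)[of \<E> P v w] e(4)[of \<E> P v w] by auto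
    qed
  next
    case (Exists i \<phi>)
    then obtain \<E>0 where e: "finite \<E>0" "\<And>\<E> P v w. finite \<E> \<Longrightarrow> \<E>0 \<subseteq> \<E> \<Longrightarrow> finite P \<Longrightarrow> bf \<E> P \<Longrightarrow>
     (\<forall>i\<in>fv \<phi>. (v i, w i) \<in> P) \<Longrightarrow> (sat Meq v \<phi> \<longleftrightarrow> sat Meq w \<phi>)"
      by auto
    have imp: "sat Meq w (Exists i \<phi>)"
      if h: "finite \<E>" "\<E>0 \<subseteq> \<E>" "finite P" "bf \<E> P" "\<forall>j\<in>fv (Exists i \<phi>). (v j, w j) \<in> P"
      and sv: "sat Meq v (Exists i \<phi>)" for \<E> P v w
    proof -
      obtain a where a: "a \<in> U" "sat Meq (v(i := a)) \<phi>" using sv by auto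
      obtain b where b: "bf \<E> (insert (a, b) P)" using bf_forth[OF h(4,1,3) a(1)] by blast
      have "\<forall>j\<in>fv \<phi>. ((v(i := a)) j, (w(i := b)) j) \<in> insert (a, b) P" using h(5) by auto
      then have "sat Meq (w(i := b)) \<phi>"
        using e(2)[OF h(1,2) _ b, of "v(i := a)" "w(i := b)"] h(3) a(2) by simp
      moreover have "b \<in> U" using bf_subset[OF b] by blast
      ultimately show ?thesis by auto
    qed
    show ?case
    proof (intro exI[of _ \<E>0] conjI allI impI e(1))
      fix \<E> P v w assume "finite \<E> \<and> \<E>0 \<subseteq> \<E> \<and> finite P \<and> bf \<E> P \<and>
        (\<forall>j\<in>fv (Exists i \<phi>). (v j, w j) \<in> P)"
      then have h: "finite \<E>" "\<E>0 \<subseteq> \<E>" "finite P" "bf \<E> P" "\<forall>j\<in>fv (Exists i \<phi>). (v j, w j) \<in> P"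
        by auto
      have "\<forall>j\<in>fv (Exists i \<phi>). (w j, v j) \<in> P\<inverse>" using h(5) by blast
      then show "sat Meq v (Exists i \<phi>) \<longleftrightarrow> sat Meq w (Exists i \<phi>)"
        using imp[OF h] imp[OF h(1,2) _ bf_converse[OF h(4)]] h(3) by blast
    qed
  }
qed

text \<open>A map that respects sorts and moves representatives by an elementary map of real
  elements satisfies the back-and-forth conditions for every \<open>\<E>\<close>, so its finite
  parts preserve all formulas.\<close>

lemma lift_pe:
  assumes Q: "pe L M Q" and P: "P \<subseteq> U \<times> U"
    and rep: "\<And>a b. (a, b) \<in> P \<Longrightarrow> fst a = fst b \<and> (\<exists>x\<in>snd a. \<exists>y\<in>snd b. set (zip x y) \<subseteq> Q)"
  shows "pe Leq Meq P"
proof (rule pe_finite[OF P])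
  fix P0 assume P0: "finite P0" "P0 \<subseteq> P"
  obtain X Y where XY: "\<And>p. p \<in> P0 \<Longrightarrow> X p \<in> snd (fst p) \<and> Y p \<in> snd (snd p) \<and> set (zip (X p) (Y p)) \<subseteq> Q"
  proof -
    have "\<forall>p\<in>P0. \<exists>z. fst z \<in> snd (fst p) \<and> snd z \<in> snd (snd p) \<and> set (zip (fst z) (snd z)) \<subseteq> Q"
      using rep P0(2) by fastforce
    then obtain z where "\<And>p. p \<in> P0 \<Longrightarrow> fst (z p) \<in> snd (fst p) \<and> snd (z p) \<in> snd (snd p) \<and>
      set (zip (fst (z p)) (snd (z p))) \<subseteq> Q" by metis
    then show ?thesis using that[of "fst \<circ> z" "snd \<circ> z"] by simp
  qed
  define Q0 where "Q0 = (\<Union>p\<in>P0. set (zip (X p) (Y p)))"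
  have Q0: "finite Q0" "Q0 \<subseteq> Q"
    unfolding Q0_def by (use P0(1) in simp) (use XY in \<open>intro UN_least, simp\<close>)
  have bf: "bf \<E> P0" for \<E>
  proof (rule bfI[OF _ _ _ Q0(1) pe_mono[OF Q Q0(2)]])
    show "P0 \<subseteq> U \<times> U" using P0(2) P by blast
    show "a = c \<longleftrightarrow> b = d" if p: "(a, b) \<in> P0" "(c, d) \<in> P0" for a b c d
    proof -
      have U: "a \<in> U" "b \<in> U" "c \<in> U" "d \<in> U" using p P0(2) P by auto
      have f: "fst a = fst b" "fst c = fst d" using rep[of a b] rep[of c d] p P0(2) by auto
      show ?thesis
      proof (cases "fst a = fst c")
        case True
        obtain n where n: "def_equiv L M n (fst a)" using U_arity[OF U(1)] by blast
        let ?x = "X (a, b)" and ?y = "Y (a, b)" and ?x' = "X (c, d)" and ?y' = "Y (c, d)"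
        have r: "?x \<in> snd a" "?y \<in> snd b" "?x' \<in> snd c" "?y' \<in> snd d"
          "set (zip ?x ?y) \<subseteq> Q" "set (zip ?x' ?y') \<subseteq> Q" using XY[OF p(1)] XY[OF p(2)] by auto
        have t: "?x \<in> tuples M n" "?y \<in> tuples M n" "?x' \<in> tuples M n" "?y' \<in> tuples M n"
          using rep_tuple(1)[OF U(1) r(1)] rep_tuple(1)[OF U(2) r(2)] rep_tuple(1)[OF U(3) r(3)]
            rep_tuple(1)[OF U(4) r(4)] n f True by auto
        have "a = c \<longleftrightarrow> (?x, ?x') \<in> fst a" by (rule eq_iff_rep[OF U(1,3) True r(1,3)])
        also have "\<dots> \<longleftrightarrow> (?y, ?y') \<in> fst b"
          using equiv_pe[OF Q n t(1,3) r(5,6) t(2,4)] f by simp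
        also have "\<dots> \<longleftrightarrow> b = d" by (rule eq_iff_rep[OF U(2,4) _ r(2,4), symmetric]) (use f True in simp)
        finally show ?thesis .
      qed (use f in auto)
    qed
    show "fst a = fst b" if "(a, b) \<in> P0" for a b using rep[of a b] that P0(2) by blast
    show "\<exists>x\<in>snd a. \<exists>y\<in>snd b. set (zip x y) \<subseteq> Q0" if p: "(a, b) \<in> P0" for a b
      using XY[OF p] p unfolding Q0_def by (intro bexI[of _ "X (a, b)"] bexI[of _ "Y (a, b)"]) auto
  qed
  show "pe Leq Meq P0"
    unfolding pe_def
  proof (intro conjI allI impI)
    show "P0 \<subseteq> U \<times> U" using P0(2) P by blast
    fix \<phi> v w assume h: "wf_fm Leq \<phi> \<and> (\<forall>i\<in>fv \<phi>. (v i, w i) \<in> P0)"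
    then show "sat Meq v \<phi> \<longleftrightarrow> sat Meq w \<phi>" using bf_sat[of \<phi>] bf P0(1) by blast
  qed
qed

end

section \<open>Types and compactness, one sort at a time\<close>

context omega_cat_model
begin

definition rep :: "'a imag \<Rightarrow> 'a list" where
  "rep e = (SOME x. x \<in> snd e)"

lemma rep_in: "e \<in> U \<Longrightarrow> rep e \<in> snd e"
  unfolding rep_def using rep_ex by (rule someI_ex)

lemma rep_univ: "e \<in> U \<Longrightarrow> set (rep e) \<subseteq> univ M"
  using U_arity[of e] rep_tuple(1)[OF _ rep_in, of e] by (auto simp: tuples_def)

definition reps :: "'a imag set \<Rightarrow> 'a set" where
  "reps C = (\<Union>e\<in>C. set (rep e))"

lemma reps_univ: "C \<subseteq> U \<Longrightarrow> reps C \<subseteq> univ M"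
  unfolding reps_def using rep_univ by blast

lemma pe_reps: "C \<subseteq> U \<Longrightarrow> pe L M (Id_on (reps C))"
  by (rule pe_Id_on[OF reps_univ])

text \<open>Equality of types of classes over \<open>C\<close> follows from equality of types of
  their representatives over chosen representatives of \<open>C\<close>. Through this, questions
  about imaginaries are reduced to real tuples.\<close>

lemma lift_over:
  assumes C: "C \<subseteq> U" and E: "def_equiv L M n E" and x: "x \<in> tuples M n" and y: "y \<in> tuples M n"
    and p: "pe L M (set (zip x y) \<union> Id_on (reps C))"
  shows "pe Leq Meq (insert ((E, E `` {x}), (E, E `` {y})) (Id_on C))"
proof (rule lift_pe[OF p])
  show "insert ((E, E `` {x}), (E, E `` {y})) (Id_on C) \<subseteq> U \<times> U"
    using C U_I[OF E x] U_I[OF E y] by auto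
  fix a b assume "(a, b) \<in> insert ((E, E `` {x}), (E, E `` {y})) (Id_on C)"
  then consider "a = (E, E `` {x})" "b = (E, E `` {y})" | "a \<in> C" "b = a"
    by (auto simp: Id_on_iff)
  then show "fst a = fst b \<and> (\<exists>x'\<in>snd a. \<exists>y'\<in>snd b. set (zip x' y') \<subseteq> set (zip x y) \<union> Id_on (reps C))"
  proof cases
    case 1
    then show ?thesis using rep_self[OF E x] rep_self[OF E y]
      by (intro conjI bexI[of _ x] bexI[of _ y]) auto
  next
    case 2
    then have "rep a \<in> snd a" using C rep_in by blast
    moreover have "set (zip (rep a) (rep a)) \<subseteq> Id_on (reps C)"
      using 2(1) by (auto simp: zip_same_conv_map reps_def)
    ultimately show ?thesis using 2 by (intro conjI bexI[of _ "rep a"]) auto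
  qed
qed

lemma sort_pdef:
  assumes "def_equiv L M n E"
  shows "pdef Leq Meq C {x \<in> U. fst x = E}"
proof -
  have "fdef Leq Meq (insert 0 {}) {v. sat Meq v (Rel (Sort E) [Var 0])}"
    using assms by (intro fdefI) (auto simp: eq_lang_def)
  from pdefI[OF this, of undefined C]
  have "pdef Leq Meq C {x \<in> U. \<exists>X. x = (E, X)}" by (simp add: eq_struct_def)
  moreover have "{x \<in> U. \<exists>X. x = (E, X)} = {x \<in> U. fst x = E}" by force
  ultimately show ?thesis by simp
qed

lemma pe_eq_sort:
  assumes P: "pe Leq Meq P" and ab: "(a, b) \<in> P"
  shows "fst a = fst b"
proof -
  have aU: "a \<in> U" using pe_subset[OF P] ab by blast
  obtain n where "def_equiv L M n (fst a)" using U_arity[OF aU] by blast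
  from sort_pdef[OF this, of "{}"] have d: "pdef Leq Meq {} {x \<in> U. fst x = fst a}" .
  have "pe Leq Meq (insert (a, b) (Id_on {}))" using P by (rule pe_mono) (use ab in simp)
  from pdef_invariant[OF d _ this] show ?thesis using aU by simp
qed

lemma types_eq:
  assumes A: "finite A" "A \<subseteq> U"
  shows "\<exists>R. finite R \<and> R \<subseteq> U \<and>
    (\<forall>x\<in>U. fst x = s \<longrightarrow> (\<exists>r\<in>R. pe Leq Meq (insert (x, r) (Id_on A))))"
proof (cases "\<exists>n. def_equiv L M n s")
  case False
  then have "\<forall>x\<in>U. fst x \<noteq> s" using U_arity by blast
  then show ?thesis by blast
next
  case True
  then obtain n where n: "def_equiv L M n s" by blast
  have "finite (reps A)" using A(1) by (simp add: reps_def)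
  then obtain R where R: "finite R" "R \<subseteq> tuples M n"
    "\<And>x. x \<in> tuples M n \<Longrightarrow> \<exists>r\<in>R. pe L M (set (zip x r) \<union> Id_on (reps A))"
    using types_over[OF _ reps_univ[OF A(2)], of n] by metis
  show ?thesis
  proof (intro exI[of _ "(\<lambda>r. (s, s `` {r})) ` R"] conjI ballI impI)
    show "finite ((\<lambda>r. (s, s `` {r})) ` R)" using R(1) by simp
    show "(\<lambda>r. (s, s `` {r})) ` R \<subseteq> U" using U_I[OF n] R(2) by blast
    fix x assume x: "x \<in> U" "fst x = s"
    have xt: "rep x \<in> tuples M n" "x = (s, s `` {rep x})"
      using rep_tuple[OF x(1) rep_in[OF x(1)], of n] n x(2) by auto
    obtain r where r: "r \<in> R" "pe L M (set (zip (rep x) r) \<union> Id_on (reps A))" using R(3)[OF xt(1)] by blast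
    have "pe Leq Meq (insert (x, (s, s `` {r})) (Id_on A))"
      using lift_over[OF A(2) n xt(1) _ r(2)] R(2) r(1) xt(2) by auto
    then show "\<exists>r\<in>(\<lambda>r. (s, s `` {r})) ` R. pe Leq Meq (insert (x, r) (Id_on A))" using r(1) by blast
  qed
qed

lemma orbit_pdef_eq:
  assumes "a \<in> U" "finite C" "C \<subseteq> U"
  shows "pdef Leq Meq C {x. pe Leq Meq (insert (a, x) (Id_on C))}"
proof -
  obtain n where n: "def_equiv L M n (fst a)" using U_arity assms(1) by blast
  obtain R where R: "finite R" "R \<subseteq> U"
    "\<forall>x\<in>U. fst x = fst a \<longrightarrow> (\<exists>r\<in>R. pe Leq Meq (insert (x, r) (Id_on C)))"
    using types_eq[OF assms(2,3), of "fst a"] by metis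
  show ?thesis
    by (rule orbit_pdef[OF _ sort_pdef[OF n] assms(3) R(1,2)]) (use assms(1) R(3) in auto)
qed

lemma forth_eq:
  assumes "pe Leq Meq P" "finite P" "d \<in> U"
  shows "\<exists>d'. pe Leq Meq (insert (d, d') P)"
proof (rule pe_forth[OF assms])
  have "Domain P \<subseteq> U" using pe_subset[OF assms(1)] by blast
  then show "pdef Leq Meq (Domain P) {x. pe Leq Meq (insert (d, x) (Id_on (Domain P)))}"
    using assms by (intro orbit_pdef_eq finite_Domain)
qed

text \<open>The sets are pulled back along the map from tuples to classes in the sort of
  \<open>a\<close>. Their preimages are invariant over finitely many representatives of parameters,
  so compactness for real tuples applies.\<close>

lemma compactness_eq:
  assumes B: "small \<kappa> Meq B" and a: "a \<in> U"
    and W: "\<And>W. W \<in> \<W> \<Longrightarrow> W \<subseteq> U \<and> (\<exists>C. finite C \<and> C \<subseteq> B \<and>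
      (\<forall>x\<in>W. \<forall>y. pe Leq Meq (insert (x, y) (Id_on C)) \<longrightarrow> y \<in> W))"
    and fip: "\<And>\<W>'. finite \<W>' \<Longrightarrow> \<W>' \<subseteq> \<W> \<Longrightarrow> \<exists>x\<in>U. fst x = fst a \<and> x \<in> \<Inter>\<W>'"
  shows "\<exists>x\<in>U. fst x = fst a \<and> x \<in> \<Inter>\<W>"
proof -
  obtain n where n: "def_equiv L M n (fst a)" using U_arity a by blast
  let ?E = "fst a"
  have BU: "B \<subseteq> U" using B by (simp add: small_def)
  define tr where "tr W = {x \<in> tuples M n. (?E, ?E `` {x}) \<in> W}" for W :: "'a imag set"
  have "small \<kappa> M (reps B)"
    unfolding reps_def by (rule small_UN[OF card unc B]) (use rep_univ BU in auto)
  then have "\<exists>x\<in>tuples M n. x \<in> \<Inter>(tr ` \<W>)"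
  proof (rule tuple_compactness)
    fix V assume "V \<in> tr ` \<W>"
    then obtain X where X: "X \<in> \<W>" "V = tr X" by blast
    obtain C where C: "finite C" "C \<subseteq> B"
      "\<And>x y. x \<in> X \<Longrightarrow> pe Leq Meq (insert (x, y) (Id_on C)) \<Longrightarrow> y \<in> X" using W[OF X(1)] by blast
    have CU: "C \<subseteq> U" using C(2) BU by blast
    have "inv_over n (reps C) V"
      unfolding inv_over_def
    proof (intro conjI ballI allI impI)
      show "V \<subseteq> tuples M n" unfolding X(2) tr_def by blast
      fix x y assume x: "x \<in> V" and y: "length y = length x \<and> pe L M (set (zip x y) \<union> Id_on (reps C))"
      have xt: "x \<in> tuples M n" "(?E, ?E `` {x}) \<in> X" using x unfolding X(2) tr_def by auto
      have yt: "y \<in> tuples M n"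
        using inv_over_tuples[OF reps_univ[OF CU], of n] xt(1) y unfolding inv_over_def by blast
      have "pe Leq Meq (insert ((?E, ?E `` {x}), (?E, ?E `` {y})) (Id_on C))"
        using lift_over[OF CU n xt(1) yt] y by blast
      then have "(?E, ?E `` {y}) \<in> X" by (rule C(3)[OF xt(2)])
      then show "y \<in> V" using yt unfolding X(2) tr_def by blast
    qed
    moreover have "finite (reps C)" using C(1) by (simp add: reps_def)
    moreover have "reps C \<subseteq> reps B" using C(2) unfolding reps_def by blast
    ultimately show "\<exists>C. finite C \<and> C \<subseteq> reps B \<and> inv_over n C V" by blast
  next
    fix \<V>' assume v: "finite \<V>'" "\<V>' \<subseteq> tr ` \<W>"
    obtain J where J: "J \<subseteq> \<W>" "finite J" "\<V>' = tr ` J"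
      using finite_subset_image[OF v] by metis
    obtain x where x: "x \<in> U" "fst x = ?E" "x \<in> \<Inter>J" using fip[OF J(2,1)] by blast
    have "rep x \<in> tuples M n" "x = (?E, ?E `` {rep x})"
      using rep_tuple[OF x(1) rep_in[OF x(1)], of n] n x(2) by auto
    then show "\<exists>x\<in>tuples M n. x \<in> \<Inter>\<V>'"
      using x(3) unfolding J(3) tr_def by (intro bexI[of _ "rep x"]) auto
  qed
  then obtain x where x: "x \<in> tuples M n" "\<And>W. W \<in> \<W> \<Longrightarrow> (?E, ?E `` {x}) \<in> W" unfolding tr_def by blast
  then show ?thesis using U_I[OF n x(1)] by (intro bexI[of _ "(?E, ?E `` {x})"]) auto
qed

end

sublocale omega_cat_model \<subseteq> elementary_maps U "pe Leq Meq" "small \<kappa> Meq" fst h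
proof
  show "\<exists>x\<in>U. fst x = fst a \<and> x \<in> \<Inter>\<W>"
    if "small \<kappa> Meq B" "a \<in> U"
      "\<And>W. W \<in> \<W> \<Longrightarrow> W \<subseteq> U \<and> (\<exists>C. finite C \<and> C \<subseteq> B \<and>
        (\<forall>x\<in>W. \<forall>y. pe Leq Meq (insert (x, y) (Id_on C)) \<longrightarrow> y \<in> W))"
      "\<And>\<W>'. finite \<W>' \<Longrightarrow> \<W>' \<subseteq> \<W> \<Longrightarrow> \<exists>x\<in>U. fst x = fst a \<and> x \<in> \<Inter>\<W>'" for B a \<W>
    using that by (rule compactness_eq)
  show "small \<kappa> Meq (A \<union> B)" if "small \<kappa> Meq A" "small \<kappa> Meq B" for A B
    by (rule small_Un[OF card unc that])
  show "\<exists>R. finite R \<and> R \<subseteq> U \<and>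
    (\<forall>x\<in>U. fst x = s \<longrightarrow> (\<exists>r\<in>R. pe Leq Meq (insert (x, r) (Id_on A))))"
    if "finite A" "A \<subseteq> U" for A s using that by (rule types_eq)
  show "B \<subseteq> U" if "small \<kappa> Meq B" for B using that by (simp add: small_def)
qed (fact pe_subset pe_finite pe_mono pe_Id_on pe_converse pe_relcomp pe_fun pe_eq_sort forth_eq
    small_finite[OF unc] small_mono)+

section \<open>Algebraic closure, and elements of unmentioned sorts\<close>

context omega_cat_model
begin

lemma H_home: "H = home M"
  unfolding H_def home_eq ..

text \<open>A finite definable set contains the orbit of each member over its finitely many
  parameters. Conversely, an orbit over a finite set is definable because its type is
  isolated.\<close>

lemma acl_cl:
  assumes C: "C \<subseteq> U"
  shows "acl_eq L M C = cl C"
proof (intro set_eqI iffI)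
  fix a assume "a \<in> acl_eq L M C"
  then obtain W where W: "pdef Leq Meq C W" "finite W" "a \<in> W"
    unfolding acl_eq_def acl_pdef by blast
  obtain \<phi> cs where p: "set cs \<subseteq> C" "form Leq (Suc (length cs)) \<phi>"
     "W = {x \<in> U. holds Meq \<phi> (x # cs)}" using W(1) unfolding pdef_def by blast
  have W': "pdef Leq Meq (set cs) W" unfolding pdef_def using p by blast
  have "{x. eqv (set cs) a x} \<subseteq> W" using pdef_invariant[OF W' W(3)] by blast
  then have "finite {x. eqv (set cs) a x}" using W(2) finite_subset by blast
  moreover have "a \<in> U" using pdef_subset[OF W'] W(3) by blast
  ultimately show "a \<in> cl C" using p(1) unfolding cl_def by blast
next
  fix a assume "a \<in> cl C"
  then obtain D where D: "a \<in> U" "finite D" "D \<subseteq> C" "finite {x. eqv D a x}" unfolding cl_def by blast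
  have "pdef Leq Meq C {x. eqv D a x}"
    using D C by (intro pdef_mono[OF orbit_pdef_eq D(3)]) auto
  moreover have "eqv D a a" using D C by (intro eqv_refl) auto
  ultimately show "a \<in> acl_eq L M C" unfolding acl_eq_def acl_pdef using D(4) by blast
qed

text \<open>A formula does not notice when an element of an unmentioned sort is replaced by another
  such element. Requiring that \<open>u'\<close> not occur in \<open>e\<close> keeps the replacement
  injective.\<close>

lemma swap:
  assumes \<phi>: "form Leq n \<phi>"
  shows "\<exists>\<E>. finite \<E> \<and> (\<forall>e\<in>tuples Meq n. \<forall>u\<in>U. \<forall>u'\<in>U. fst u \<notin> \<E> \<and> fst u' \<notin> \<E> \<and> u' \<notin> set e \<longrightarrow>
     (holds Meq \<phi> e \<longleftrightarrow> holds Meq \<phi> (map (\<lambda>x. if x = u then u' else x) e)))"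
proof -
  have "wf_fm Leq \<phi>" using \<phi> by (simp add: form_def)
  then obtain \<E> where E: "finite \<E>" "\<And>P v w. finite P \<Longrightarrow> bf \<E> P \<Longrightarrow>
     (\<forall>i\<in>fv \<phi>. (v i, w i) \<in> P) \<Longrightarrow> (sat Meq v \<phi> \<longleftrightarrow> sat Meq w \<phi>)"
    using bf_sat by (metis order_refl)
  have "holds Meq \<phi> e \<longleftrightarrow> holds Meq \<phi> (map (\<lambda>x. if x = u then u' else x) e)"
    if e: "e \<in> tuples Meq n" and u: "u' \<in> U" "fst u \<notin> \<E>" "fst u' \<notin> \<E>" "u' \<notin> set e" for e u u'
  proof -
    let ?f = "\<lambda>x. if x = u then u' else x"
    define P where "P = (\<lambda>x. (x, ?f x)) ` set e"
    have eU: "set e \<subseteq> U" "length e = n" using e by (auto simp: tuples_def)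
    have P: "a \<in> set e \<and> b = ?f a" if "(a, b) \<in> P" for a b using that unfolding P_def by blast
    have "bf \<E> P"
    proof (rule bfI)
      show "P \<subseteq> U \<times> U" unfolding P_def using eU(1) u(1) by auto
      show "a = c \<longleftrightarrow> b = d" if "(a, b) \<in> P" "(c, d) \<in> P" for a b c d
        using P[OF that(1)] P[OF that(2)] u(4) by metis
      show "fst a = fst b" if "(a, b) \<in> P" "fst a \<in> \<E> \<or> fst b \<in> \<E>" for a b
        using P[OF that(1)] that(2) u(2,3) by metis
      show "finite (Id_on (reps (set e)))" by (simp add: reps_def Id_on_def)
      show "pe L M (Id_on (reps (set e)))" by (rule pe_reps[OF eU(1)])
      fix a b assume ab: "(a, b) \<in> P" "fst a \<in> \<E>"
      have a: "a \<in> set e" "b = a" using P[OF ab(1)] ab(2) u(2) by metis+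
      then have "rep a \<in> snd a" using eU(1) rep_in by blast
      moreover have "set (zip (rep a) (rep a)) \<subseteq> Id_on (reps (set e))"
        using a(1) by (auto simp: zip_same_conv_map reps_def)
      ultimately show "\<exists>x\<in>snd a. \<exists>y\<in>snd b. set (zip x y) \<subseteq> Id_on (reps (set e))"
        unfolding a(2) by blast
    qed
    moreover have "\<forall>i\<in>fv \<phi>. (e ! i, map ?f e ! i) \<in> P"
    proof
      fix i assume "i \<in> fv \<phi>"
      then have "i < length e" using \<phi> eU(2) by (auto simp: form_def)
      then show "(e ! i, map ?f e ! i) \<in> P" unfolding P_def by simp
    qed
    moreover have "finite P" by (simp add: P_def)
    ultimately show ?thesis unfolding holds_def by (intro E(2)) auto
  qed
  then show ?thesis using E(1) by blast
qed

end

section \<open>The geometry of real elements\<close>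

locale soft_exchange_model = omega_cat_model L M \<kappa>
  for L :: "('f, 'r) lang" and M :: "('f, 'r, 'a) struct" and \<kappa> :: "'k rel" +
  assumes soft_elim: "soft_elim_imag L M" and exchange: "exchange0 \<kappa> L M"

sublocale soft_exchange_model \<subseteq> exchange_geometry U "pe Leq Meq" "small \<kappa> Meq" fst h
proof
  fix a assume a: "a \<in> U"
  obtain bs where bs: "set bs \<subseteq> home M" "acl_eq L M {a} = acl_eq L M (set bs)"
    using soft_elim a unfolding soft_elim_imag_def by blast
  have bU: "set bs \<subseteq> U" using bs(1) unfolding home_eq by blast
  have aU: "{a} \<subseteq> U" using a by blast
  have e: "cl {a} = cl (set bs)" using bs(2) acl_cl[OF bU] acl_cl[OF aU] by simp
  have "set bs \<subseteq> cl {a} \<inter> H" using cl_superset[OF bU] bs(1) e H_home by blast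
  then have "cl {a} \<subseteq> cl (cl {a} \<inter> H)" unfolding e by (rule cl_mono)
  then show "a \<in> cl (cl {a} \<inter> H)" using cl_superset[OF aU] by blast
next
  fix C x y assume C: "small \<kappa> Meq C" and x: "r1 C x" and y: "r1 C y" and yx: "y \<in> cl (insert x C)"
  have CU: "C \<subseteq> U" using C by (simp add: small_def)
  \<comment> \<open>A rank of at least 2 would give a real \<open>v\<close> in
    \<open>cl {z}\<close>, non-algebraic over \<open>C\<close>, and a further element of
    \<open>cl {z}\<close> outside the closure of \<open>insert v C\<close>. But for an atom
    \<open>z\<close> that closure contains \<open>z\<close>, and so all of
    \<open>cl {z}\<close>.\<close>
  have rk: "rk0_eq L M 1 {z} C" if z: "r1 C z" for z
  proof -
    have zU: "{z} \<subseteq> U" using z by (auto simp: r1_def H_def)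
    have a0: "acl0 L M {z} = cl {z} \<inter> H" unfolding acl0_def H_home acl_cl[OF zU] ..
    have ac: "acl0 L M D = cl D \<inter> H" if "D \<subseteq> U" for D unfolding acl0_def H_home acl_cl[OF that] ..
    have step: "rk0_step L M ({z}, D) q \<longleftrightarrow> (\<exists>v. v \<in> cl {z} \<inter> H - cl D \<and> q = ({z}, insert v D))"
      if "D \<subseteq> U" for D q
      unfolding rk0_step_def using ac[OF that] a0 by auto
    have "z \<in> cl {z} \<inter> H - cl C" using z cl_superset[OF zU] by (auto simp: r1_def)
    then have "rk0_step L M ({z}, C) ({z}, insert z C)" using step[OF CU] by blast
    then have "rk0_ge L M natLeq (Suc 0) {z} C"
      unfolding rk0_ge_def rank_ge_natLeq_Suc
      by (intro exI[of _ "({z}, insert z C)"] conjI rank_ge_natLeq_0)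
    moreover have "\<not> rk0_ge L M natLeq (Suc (Suc 0)) {z} C"
    proof
      assume "rk0_ge L M natLeq (Suc (Suc 0)) {z} C"
      then obtain q where q: "rk0_step L M ({z}, C) q" "rank_ge natLeq (rk0_step L M) (Suc 0) q"
        unfolding rk0_ge_def rank_ge_natLeq_Suc[of _ "Suc 0"] by blast
      then obtain v where v: "v \<in> cl {z} \<inter> H" "v \<notin> cl C" "q = ({z}, insert v C)"
        using step[OF CU] by blast
      have vC: "insert v C \<subseteq> U" using v(1) CU cl_subset by blast
      obtain q' where "rk0_step L M ({z}, insert v C) q'"
        using q(2) unfolding v(3) rank_ge_natLeq_Suc by blast
      then obtain w where w: "w \<in> cl {z}" "w \<notin> cl (insert v C)" using step[OF vC] by blast
      have "z \<in> cl (insert v C)" using z v by (simp add: r1_def)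
      then have "cl {z} \<subseteq> cl (insert v C)" using vC by (intro cl_subset_cl) auto
      then show False using w by blast
    qed
    ultimately show ?thesis by (simp add: rk0_eq_def)
  qed
  \<comment> \<open>Only the case of two elements of the exchange property is needed here; the
    middle segment of the sequence is then empty.\<close>
  define a where "a i = (if i = 1 then x else y)" for i :: nat
  have im: "a ` {1..2 - 1} = {x}" "a ` {2..2 - 1} = {}" "a ` {2..2} = {y}" by (auto simp: a_def)
  have "\<forall>i\<in>{1..2}. a i \<in> home M \<and> rk0_eq L M 1 {a i} C"
    using rk[OF x] rk[OF y] x y by (auto simp: a_def r1_def H_home)
  moreover have xU: "{x} \<union> C \<subseteq> U" "{y} \<union> C \<subseteq> U" using x y CU by (auto simp: r1_def H_def)
  have "a 2 \<in> acl_eq L M (a ` {1..2 - 1} \<union> C) - acl_eq L M (a ` {2..2 - 1} \<union> C)"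
    unfolding im using acl_cl[OF xU(1)] acl_cl[OF CU] yx y by (simp add: a_def r1_def)
  ultimately have "a 1 \<in> acl_eq L M (a ` {2..2} \<union> C)"
    using exchange[unfolded exchange0_def, rule_format, of C 2 a] C by blast
  then show "x \<in> cl (insert y C)" unfolding im using acl_cl[OF xU(2)] by (simp add: a_def)
qed

section \<open>Thorn-forking and the dimension\<close>

text \<open>An infinite set of instances with a common solution would contain \<open>k\<close> of
  them.\<close>

lemma k_inconsistent_finite:
  assumes "k_inconsistent S n \<delta> k B" "b \<in> tuples S n" "T \<subseteq> B" "\<And>a. a \<in> T \<Longrightarrow> holds S \<delta> (b @ a)"
  shows "finite T"
proof (rule ccontr)
  assume "infinite T"
  then obtain T' where T': "T' \<subseteq> T" "finite T'" "card T' = k" using infinite_arbitrarily_large by blast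
  then have "T' \<subseteq> B \<and> finite T' \<and> card T' = k" using assms(3) by auto
  then have "\<not> (\<exists>xs\<in>tuples S n. \<forall>a\<in>T'. holds S \<delta> (xs @ a))"
    using assms(1) unfolding k_inconsistent_def by simp
  then show False using assms(2,4) T'(1) by blast
qed

section \<open>Thorn-forking lowers the dimension\<close>

context soft_exchange_model
begin

lemma zip_append_Id:
  assumes "set ds \<subseteq> B" "length bs = length cs"
  shows "set (zip (bs @ ds) (cs @ ds)) \<subseteq> set (zip bs cs) \<union> Id_on B"
  using assms by (auto simp: zip_same_conv_map)

lemma range_tuple:
  assumes "pe Leq Meq P" "set (zip as bs) \<subseteq> P" "length bs = length as"
  shows "set bs \<subseteq> U"
proof -
  have "set bs = Range (set (zip as bs))" using assms(3) by (simp add: Range_snd flip: set_map)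
  then show ?thesis using assms(2) pe_subset[OF assms(1)] by blast
qed

text \<open>If the dimension did not drop, a sufficiently independent realisation \<open>gs\<close>
  of one of the dividing formulas would not lose dimension when \<open>a\<close> is added to the
  base \<open>E\<close>. By inconsistency \<open>a\<close> is algebraic over \<open>E\<close> and
  \<open>gs\<close>, so symmetry makes \<open>a\<close> algebraic over \<open>E\<close> alone. But
  strong dividing requires infinitely many conjugates of \<open>a\<close> over
  \<open>E\<close>.\<close>

lemma thorn_forks_dim:
  assumes A: "small \<kappa> Meq A" and B: "small \<kappa> Meq B" "A \<subseteq> B" and bs: "set bs \<subseteq> U"
    and fork: "type_thorn_forks Leq Meq bs B A"
  shows "dim B (set bs) < dim A (set bs)"
proof (rule ccontr)
  assume "\<not> ?thesis"
  then have le: "dim A (set bs) \<le> dim B (set bs)" by simp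
  let ?n = "length bs"
  have BU: "B \<subseteq> U" using B(1) sm_subset by blast
  have AU: "A \<subseteq> U" using B(2) BU by blast
  obtain \<chi> ds where \<chi>: "set ds \<subseteq> B" "form Leq (?n + length ds) \<chi>" "holds Meq \<chi> (bs @ ds)"
    "thorn_forks Leq Meq ?n \<chi> ds A" using fork unfolding type_thorn_forks_def by blast
  obtain \<D> where D': "finite \<D> \<and> (\<forall>(\<delta>, a)\<in>\<D>. set a \<subseteq> U \<and> form Leq (?n + length a) \<delta> \<and>
      thorn_divides Leq Meq ?n \<delta> a A) \<and> sol Meq ?n \<chi> ds \<subseteq> (\<Union>(\<delta>, a)\<in>\<D>. sol Meq ?n \<delta> a)"
    using \<chi>(4) unfolding thorn_forks_def by (rule exE)
  note D = conjunct1[OF D'] conjunct1[OF conjunct2[OF D']] conjunct2[OF conjunct2[OF D']]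
  define F where "F = (\<Union>p\<in>\<D>. set (snd p))"
  have "set (snd p) \<subseteq> U" if "p \<in> \<D>" for p
    using bspec[OF D(2) that] by (simp add: case_prod_unfold)
  then have F: "finite F" "F \<subseteq> U" unfolding F_def using D(1) by blast+
  \<comment> \<open>\<open>cs\<close> has the type of \<open>bs\<close> over \<open>B\<close> and is
    independent over \<open>B\<close> from all parameters of the formulas covering
    \<open>\<chi>\<close>. Whichever of these formulas it satisfies, its parameters are
    covered.\<close>
  obtain cs where cs: "length cs = ?n" "pe Leq Meq (set (zip bs cs) \<union> Id_on B)"
    "dim (B \<union> F) (set cs) = dim B (set bs)"
    using dim_extension[OF B(1) sm_finite[OF F] bs] by blast
  have csU: "set cs \<subseteq> U" by (rule range_tuple[OF cs(2) _ cs(1)]) simp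
  have "holds Meq \<chi> (bs @ ds) \<longleftrightarrow> holds Meq \<chi> (cs @ ds)"
    by (rule pe_holds[OF cs(2)]) (use \<chi>(2) cs(1) zip_append_Id[OF \<chi>(1), of bs cs] in auto)
  then have "cs \<in> sol Meq ?n \<chi> ds" using \<chi>(3) cs(1) csU by (simp add: sol_def tuples_def)
  then obtain \<delta> a where \<delta>: "(\<delta>, a) \<in> \<D>" "cs \<in> sol Meq ?n \<delta> a" using D(3) by blast
  have a: "set a \<subseteq> U" "form Leq (?n + length a) \<delta>" "thorn_divides Leq Meq ?n \<delta> a A"
    using bspec[OF D(2) \<delta>(1)] by auto
  have aF: "set a \<subseteq> F" using \<delta>(1) unfolding F_def by force
  obtain es where es: "set es \<subseteq> U" "strongly_divides Leq Meq ?n \<delta> a (A \<union> set es)"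
    using a(3) unfolding thorn_divides_def by blast
  define E where "E = A \<union> set es"
  define R where "R = {a' \<in> tuples Meq (length a). same_type Leq Meq E a a'}"
  obtain k where R: "infinite R" "k_inconsistent Meq ?n \<delta> k R"
    using es(2) unfolding strongly_divides_def R_def E_def Let_def by blast
  have EU: "E \<subseteq> U" using AU es(1) by (simp add: E_def)
  have E: "small \<kappa> Meq E" unfolding E_def by (rule sm_Un_finite[OF A _ es(1)]) simp
  have Aa: "small \<kappa> Meq (A \<union> set a)" by (rule sm_Un_finite[OF A _ a(1)]) simp
  \<comment> \<open>A second independent realisation: over \<open>A\<close> and \<open>a\<close> the
    tuple \<open>cs\<close> is moved away from the parameters \<open>es\<close> over which
    \<open>\<delta>\<close> divides strongly. Since \<open>a\<close> stays fixed,
    \<open>\<delta>\<close> remains true.\<close>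
  obtain gs where gs: "length gs = length cs" "pe Leq Meq (set (zip cs gs) \<union> Id_on (A \<union> set a))"
    "dim (A \<union> set a \<union> set es) (set gs) = dim (A \<union> set a) (set cs)"
    using dim_extension[OF Aa sm_finite[OF _ es(1)] csU] by auto
  have gsU: "set gs \<subseteq> U" by (rule range_tuple[OF gs(2) _ gs(1)]) simp
  then have gst: "gs \<in> tuples Meq ?n" using gs(1) cs(1) by (simp add: tuples_def)
  have "holds Meq \<delta> (cs @ a) \<longleftrightarrow> holds Meq \<delta> (gs @ a)"
    by (rule pe_holds[OF gs(2)]) (use a(2) cs(1) gs(1) zip_append_Id[of a "A \<union> set a" cs gs] in auto)
  then have \<delta>gs: "holds Meq \<delta> (gs @ a)" using \<delta>(2) by (simp add: sol_def)
  have "set a \<subseteq> cl E"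
  proof (rule dim_drop[OF E _ a(1) _ gsU])
    have "dim E (set gs) \<le> dim A (set gs)"
      by (rule dim_mono[OF E _ _ gsU]) (auto simp: E_def)
    also have "\<dots> = dim A (set cs)"
      by (rule dim_pe[OF A pe_mono[OF gs(2)], symmetric]) (use gs(1) in auto)
    also have "\<dots> = dim A (set bs)"
      by (rule dim_pe[OF A pe_mono[OF cs(2)], symmetric]) (use cs(1) B(2) in auto)
    \<comment> \<open>Here the assumption enters that the dimension of \<open>bs\<close> does not
      drop from \<open>A\<close> to \<open>B\<close>.\<close>
    also have "\<dots> \<le> dim (B \<union> F) (set cs)" using le cs(3) by simp
    also have "\<dots> \<le> dim (A \<union> set a) (set cs)"
      by (rule dim_mono[OF sm_Un_finite[OF B(1) F] _ _ csU]) (use B(2) aF in auto)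
    also have "\<dots> = dim (E \<union> set a) (set gs)" using gs(3) by (simp add: E_def Un_ac)
    finally show "dim E (set gs) \<le> dim (E \<union> set a) (set gs)" .
    show "set a \<subseteq> cl (E \<union> set gs)"
    proof (rule ccontr)
      assume nalg: "\<not> ?thesis"
      let ?T = "{a'. length a' = length a \<and> pe Leq Meq (set (zip a a') \<union> Id_on (E \<union> set gs))}"
      have "infinite ?T"
        by (rule infinite_tuple_orbit[OF sm_Un_finite[OF E _ gsU] a(1) nalg]) simp
      moreover have "finite ?T"
      proof (rule k_inconsistent_finite[OF R(2) gst])
        show "?T \<subseteq> R"
        proof clarify
          fix a' assume l: "length a' = length a"
            and p: "pe Leq Meq (set (zip a a') \<union> Id_on (E \<union> set gs))"
          have U: "set a' \<subseteq> U" by (rule range_tuple[OF p _ l]) simp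
          have "pe Leq Meq (set (zip a a') \<union> Id_on E)" by (rule pe_mono[OF p]) auto
          then have "same_type Leq Meq E a a'" using pe_same_type[OF a(1) U EU] l by simp
          then show "a' \<in> R" using U l by (simp add: R_def tuples_def)
        qed
        fix a' assume "a' \<in> ?T"
        then have l: "length a' = length a"
          and p: "pe Leq Meq (set (zip a a') \<union> Id_on (E \<union> set gs))" by auto
        have "holds Meq \<delta> (gs @ a) \<longleftrightarrow> holds Meq \<delta> (gs @ a')"
          by (rule pe_holds[OF p]) (use a(2) gs(1) cs(1) l in \<open>auto simp: zip_same_conv_map\<close>)
        then show "holds Meq \<delta> (gs @ a')" using \<delta>gs by simp
      qed
      ultimately show False by blast
    qed
  qed auto
  then have "finite {a'. length a' = length a \<and> pe Leq Meq (set (zip a a') \<union> Id_on E)}"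
    by (rule finite_tuple_orbit)
  moreover have "R \<subseteq> {a'. length a' = length a \<and> pe Leq Meq (set (zip a a') \<union> Id_on E)}"
    unfolding R_def tuples_def using pe_same_type[OF a(1) _ EU] by auto
  ultimately show False using R(1) finite_subset by blast
qed

text \<open>\<open>G\<close> stands for the finite stages of the rank in any well-order; it is used
  for the natural numbers and for their copy in another type.\<close>

lemma thorn_rank_le_dim:
  assumes step: "\<And>m x. G (Suc m) x \<Longrightarrow> \<exists>y. thorn_ext \<kappa> Leq Meq x y \<and> G m y"
  shows "G m (as, A) \<Longrightarrow> set as \<subseteq> U \<Longrightarrow> small \<kappa> Meq A \<Longrightarrow> m \<le> dim A (set as)"
proof (induction m arbitrary: as A)
  case (Suc m)
  obtain bs B where b: "A \<subseteq> B" "small \<kappa> Meq B" "bs \<in> tuples Meq (length as)"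
    "same_type Leq Meq A as bs" "type_thorn_forks Leq Meq bs B A" "G m (bs, B)"
    using step[OF Suc.prems(1)] unfolding thorn_ext_def by blast
  have bU: "set bs \<subseteq> U" and l: "length as = length bs" using b(3) by (auto simp: tuples_def)
  have AU: "A \<subseteq> U" using Suc.prems(3) sm_subset by blast
  have "pe Leq Meq (set (zip as bs) \<union> Id_on A)"
    using b(4) pe_same_type[OF Suc.prems(2) bU AU l] by simp
  then have "dim A (set as) = dim A (set bs)" using dim_pe[OF Suc.prems(3)] l by blast
  moreover have "dim B (set bs) < dim A (set bs)"
    by (rule thorn_forks_dim[OF Suc.prems(3) b(2,1) bU b(5)])
  moreover have "m \<le> dim B (set bs)" by (rule Suc.IH[OF b(6) bU b(2)])
  ultimately show ?case by simp
qed simp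

lemma U_thorn_le_dim:
  "U_thorn_ge \<kappa> Leq Meq natLeq m as A \<Longrightarrow> set as \<subseteq> U \<Longrightarrow> small \<kappa> Meq A \<Longrightarrow> m \<le> dim A (set as)"
  unfolding U_thorn_ge_def
  by (rule thorn_rank_le_dim[of "rank_ge natLeq (thorn_ext \<kappa> Leq Meq)"])
    (simp_all add: rank_ge_natLeq_Suc)

text \<open>The dimension depends only on the type, and a sort has finitely many types over the
  empty set.\<close>

lemma dim_sort_bounded: "\<exists>N. \<forall>x\<in>U. fst x = s \<longrightarrow> dim {} {x} \<le> N"
proof -
  have sm0: "small \<kappa> Meq {}" by (rule sm_finite) auto
  obtain R where R: "finite R" "\<And>x. x \<in> U \<Longrightarrow> fst x = s \<Longrightarrow> \<exists>r\<in>R. pe Leq Meq (insert (x, r) (Id_on {}))"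
    using types_eq[of "{}" s] by auto
  have "dim {} {x} \<le> Max (insert 0 ((\<lambda>r. dim {} {r}) ` R))" if x: "x \<in> U" "fst x = s" for x
  proof -
    obtain r where r: "r \<in> R" "pe Leq Meq (insert (x, r) (Id_on {}))" using R(2)[OF x] by blast
    then have "dim {} (set [x]) = dim {} (set [r])" by (intro dim_pe[OF sm0]) auto
    then show ?thesis using r(1) R(1) by (auto intro: Max_ge)
  qed
  then show ?thesis by blast
qed

lemma dim_sorts_bounded: "\<exists>N. \<forall>bs. set bs \<subseteq> U \<and> map fst bs = ss \<longrightarrow> dim {} (set bs) \<le> N"
proof (induction ss)
  case Nil
  then show ?case by auto
next
  case (Cons s ss)
  obtain N where N: "\<And>bs. set bs \<subseteq> U \<Longrightarrow> map fst bs = ss \<Longrightarrow> dim {} (set bs) \<le> N"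
    using Cons by blast
  obtain K where K: "\<And>x. x \<in> U \<Longrightarrow> fst x = s \<Longrightarrow> dim {} {x} \<le> K"
    using dim_sort_bounded[of s] by blast
  have sm0: "small \<kappa> Meq {}" by (rule sm_finite) auto
  have "dim {} (set bs) \<le> N + K" if bs: "set bs \<subseteq> U" "map fst bs = s # ss" for bs
  proof -
    obtain x xs where x: "bs = x # xs" "fst x = s" "map fst xs = ss" using bs(2) by auto
    have "dim {} ({x} \<union> set xs) = dim {} (set xs) + dim ({} \<union> set xs) {x}"
      by (rule dim_Un[OF sm0]) (use bs(1) x(1) in auto)
    moreover have "dim (set xs) {x} \<le> dim {} {x}"
      by (rule dim_mono) (use bs(1) x(1) in \<open>auto intro: sm_finite\<close>)
    ultimately show ?thesis using N[of xs] K[of x] bs(1) x by simp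
  qed
  then show ?case by (intro exI[of _ "N + K"]) simp
qed

text \<open>A copy of the natural numbers inside the type of pairs is needed because
  \<open>superrosy_in\<close> asks for a well-order on that type.\<close>

lemma well_order_nat:
  fixes f :: "nat \<Rightarrow> 'o"
  assumes "inj f"
  shows "Well_order (dir_image natLeq f)" "f n \<in> Field (dir_image natLeq f)"
    and "rank_ge (dir_image natLeq f) step (f (Suc m)) x \<Longrightarrow>
      \<exists>y. step x y \<and> rank_ge (dir_image natLeq f) step (f m) y"
proof -
  let ?r = "dir_image natLeq f"
  show W: "Well_order ?r"
    using natLeq_Well_order assms by (intro Well_order_dir_image) (auto intro: inj_on_subset)
  show "f n \<in> Field ?r" by (simp add: dir_image_Field Field_natLeq)
  have r: "(x, y) \<in> ?r \<longleftrightarrow> (\<exists>i j. x = f i \<and> y = f j \<and> i \<le> j)" for x y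
    unfolding dir_image_def natLeq_def by auto
  have "succ_in ?r (f m) (f (Suc m))"
    unfolding succ_in_def using assms by (auto simp: r inj_eq)
  moreover assume "rank_ge ?r step (f (Suc m)) x"
  ultimately show "\<exists>y. step x y \<and> rank_ge ?r step (f m) y"
    by (subst (asm) rank_ge_unfold[OF W]) blast
qed

section \<open>Rosiness\<close>

lemma sort_tuple_formula:
  assumes "set as \<subseteq> U"
  shows "\<exists>\<theta>. form Leq (length as) \<theta> \<and>
    (\<forall>bs\<in>tuples Meq (length as). holds Meq \<theta> bs \<longleftrightarrow> map fst bs = map fst as)"
proof -
  let ?n = "length as"
  let ?V = "\<Inter>((\<lambda>i. {v. sat Meq v (Rel (Sort (fst (as ! i))) [Var i])}) ` {..<?n})"
  have Une: "U \<noteq> {}" using infinite_fresh[of "{}"] by auto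
  have "fdef Leq Meq {..<?n} ?V"
  proof (rule fdef_INT[OF Une])
    fix W assume "W \<in> (\<lambda>i. {v. sat Meq v (Rel (Sort (fst (as ! i))) [Var i])}) ` {..<?n}"
    then obtain i where i: "i < ?n" "W = {v. sat Meq v (Rel (Sort (fst (as ! i))) [Var i])}" by blast
    have "as ! i \<in> U" using assms i(1) nth_mem by blast
    then have "\<exists>n. def_equiv L M n (fst (as ! i))" by (rule U_arity)
    then show "fdef Leq Meq {..<?n} W"
      unfolding i(2) using i(1) by (intro fdefI) (auto simp: eq_lang_def)
  qed simp
  then obtain \<theta> where \<theta>: "wf_fm Leq \<theta>" "fv \<theta> \<subseteq> {..<?n}" "?V = {v. sat Meq v \<theta>}"
    unfolding fdef_def by metis
  have s: "sat Meq v (Rel (Sort E) [Var i]) \<longleftrightarrow> fst (v i) = E" for v E i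
    by (cases "v i") (auto simp: eq_struct_def)
  have "holds Meq \<theta> bs \<longleftrightarrow> map fst bs = map fst as" if b: "bs \<in> tuples Meq ?n" for bs
  proof -
    have "holds Meq \<theta> bs \<longleftrightarrow> (!) bs \<in> ?V" unfolding holds_def \<theta>(3) by simp
    also have "\<dots> \<longleftrightarrow> (\<forall>i<?n. fst (bs ! i) = fst (as ! i))" using s by auto
    also have "\<dots> \<longleftrightarrow> map fst bs = map fst as"
      using b by (auto simp: list_eq_iff_nth_eq tuples_def)
    finally show ?thesis .
  qed
  then show ?thesis using \<theta>(1,2) unfolding form_def by blast
qed

text \<open>A parameter of a sort that is mentioned neither by the formulas nor by the other arguments
  could be replaced by infinitely many others, contradicting inconsistency.\<close>
lemma local_thorn_sorts:
  assumes \<delta>: "form Leq (n + m) \<delta>" and \<pi>: "form Leq (m + l) \<pi>"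
  shows "\<exists>\<E>. finite \<E> \<and> (\<forall>k c a b. c \<in> tuples Meq l \<and> a \<in> sol Meq m \<pi> c \<and> b \<in> sol Meq n \<delta> a \<and>
     k_inconsistent Meq n \<delta> k (sol Meq m \<pi> c) \<longrightarrow> fst ` set a \<subseteq> \<E> \<union> fst ` set b \<union> fst ` set c)"
proof -
  let ?sw = "\<lambda>u u' x. if x = u then u' else x"
  obtain \<E>1 where E1: "finite \<E>1" "\<And>e u u'. e \<in> tuples Meq (n + m) \<Longrightarrow> u \<in> U \<Longrightarrow> u' \<in> U \<Longrightarrow>
     fst u \<notin> \<E>1 \<Longrightarrow> fst u' \<notin> \<E>1 \<Longrightarrow> u' \<notin> set e \<Longrightarrow> holds Meq \<delta> e \<longleftrightarrow> holds Meq \<delta> (map (?sw u u') e)"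
    using swap[OF \<delta>] by auto
  obtain \<E>2 where E2: "finite \<E>2" "\<And>e u u'. e \<in> tuples Meq (m + l) \<Longrightarrow> u \<in> U \<Longrightarrow> u' \<in> U \<Longrightarrow>
     fst u \<notin> \<E>2 \<Longrightarrow> fst u' \<notin> \<E>2 \<Longrightarrow> u' \<notin> set e \<Longrightarrow> holds Meq \<pi> e \<longleftrightarrow> holds Meq \<pi> (map (?sw u u') e)"
    using swap[OF \<pi>] by auto
  have "fst u \<in> \<E>1 \<union> \<E>2 \<union> fst ` set b \<union> fst ` set c"
    if c: "c \<in> tuples Meq l" and a: "a \<in> sol Meq m \<pi> c" and b: "b \<in> sol Meq n \<delta> a"
      and inc: "k_inconsistent Meq n \<delta> k (sol Meq m \<pi> c)" and u: "u \<in> set a" for k c a b u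
  proof (rule ccontr)
    assume "\<not> ?thesis"
    then have nu: "fst u \<notin> \<E>1" "fst u \<notin> \<E>2" "u \<notin> set b" "u \<notin> set c" by auto
    have t: "a \<in> tuples Meq m" "b \<in> tuples Meq n" using a b by (auto simp: sol_def)
    then have uU: "u \<in> U" using u by (auto simp: tuples_def)
    let ?N = "set a \<union> set b \<union> set c"
    define V where "V = {u' \<in> U. fst u' \<notin> \<E>1 \<union> \<E>2} - ?N"
    \<comment> \<open>Each element of \<open>V\<close> may take the place of \<open>u\<close>, which
      yields infinitely many instances of \<open>\<delta>\<close> that are all satisfied by the same
      \<open>b\<close>.\<close>
    have "infinite V" unfolding V_def
      by (rule Diff_infinite_finite[OF _ infinite_fresh]) (use E1(1) E2(1) in auto)
    moreover have "inj_on (\<lambda>u'. map (?sw u u') a) V"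
    proof (rule inj_onI)
      fix x y assume x: "x \<in> V" and "map (?sw u x) a = map (?sw u y) a"
      then have "\<forall>z\<in>set a. ?sw u x z = ?sw u y z" by (simp only: map_eq_conv)
      from bspec[OF this u] show "x = y" by simp
    qed
    ultimately have "infinite ((\<lambda>u'. map (?sw u u') a) ` V)" using finite_imageD by blast
    moreover have "finite ((\<lambda>u'. map (?sw u u') a) ` V)"
    proof (rule k_inconsistent_finite[OF inc t(2)])
      have *: "map (?sw u u') a \<in> sol Meq m \<pi> c \<and> holds Meq \<delta> (b @ map (?sw u u') a)"
        if u': "u' \<in> V" for u'
      proof -
        have v: "u' \<in> U" "fst u' \<notin> \<E>1" "fst u' \<notin> \<E>2" "u' \<notin> ?N" using u' by (auto simp: V_def)
        have id: "map (?sw u u') b = b" "map (?sw u u') c = c" using nu(3,4) by (auto intro!: map_idI)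
        have "holds Meq \<delta> (b @ a) \<longleftrightarrow> holds Meq \<delta> (map (?sw u u') (b @ a))"
          by (rule E1(2)[OF _ uU v(1) nu(1) v(2)]) (use t v(4) in \<open>auto simp: tuples_def\<close>)
        moreover have "holds Meq \<pi> (a @ c) \<longleftrightarrow> holds Meq \<pi> (map (?sw u u') (a @ c))"
          by (rule E2(2)[OF _ uU v(1) nu(2) v(3)]) (use t c v(4) in \<open>auto simp: tuples_def\<close>)
        moreover have "map (?sw u u') a \<in> tuples Meq m" using t(1) v(1) by (auto simp: tuples_def)
        ultimately show ?thesis using a b unfolding sol_def map_append id by simp
      qed
      show "(\<lambda>u'. map (?sw u u') a) ` V \<subseteq> sol Meq m \<pi> c" using * by blast
      show "holds Meq \<delta> (b @ a')" if "a' \<in> (\<lambda>u'. map (?sw u u') a) ` V" for a' using * that by blast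
    qed
    ultimately show False by blast
  qed
  then show ?thesis using E1(1) E2(1) by (intro exI[of _ "\<E>1 \<union> \<E>2"]) blast
qed

text \<open>Each level of the local rank gains one dimension. Among infinitely many parameters
  \<open>a\<close>, one is not algebraic over \<open>D\<close>; the solution \<open>b\<close> found
  one level lower over \<open>D\<close> and \<open>a\<close> makes \<open>a\<close> algebraic by
  inconsistency, so by symmetry its dimension over \<open>D\<close> is strictly larger. The base
  \<open>e\<close> is arbitrary so that \<open>a\<close> can be absorbed into it.\<close>

lemma local_thorn_dim:
  assumes \<Delta>: "\<forall>\<delta>\<in>\<Delta>. form Leq (n + m) \<delta>" and \<Pi>: "\<forall>\<pi>\<in>\<Pi>. form Leq (m + l) \<pi>"
  shows "local_thorn_ge Meq n m l \<Delta> \<Pi> k \<alpha> X \<Longrightarrow>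
    X \<subseteq> {b \<in> tuples Meq n. map fst b = ss} \<Longrightarrow> finite e \<Longrightarrow> e \<subseteq> U \<Longrightarrow> \<exists>b\<in>X. \<alpha> \<le> dim e (set b)"
proof (induction \<alpha> arbitrary: X e)
  case 0
  then show ?case by auto
next
  case (Suc \<alpha>)
  obtain \<delta> \<pi> c where d: "\<delta> \<in> \<Delta>" "\<pi> \<in> \<Pi>" "c \<in> tuples Meq l"
    "infinite {a \<in> sol Meq m \<pi> c. local_thorn_ge Meq n m l \<Delta> \<Pi> k \<alpha> (X \<inter> sol Meq n \<delta> a)}"
    "k_inconsistent Meq n \<delta> k (sol Meq m \<pi> c)" using Suc.prems(1) by auto
  define I where "I = {a \<in> sol Meq m \<pi> c. local_thorn_ge Meq n m l \<Delta> \<Pi> k \<alpha> (X \<inter> sol Meq n \<delta> a)}"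
  have f: "form Leq (n + m) \<delta>" "form Leq (m + l) \<pi>" using d \<Delta> \<Pi> by auto
  obtain \<E>0 where E0': "finite \<E>0 \<and> (\<forall>k c a b. c \<in> tuples Meq l \<and> a \<in> sol Meq m \<pi> c \<and>
     b \<in> sol Meq n \<delta> a \<and> k_inconsistent Meq n \<delta> k (sol Meq m \<pi> c) \<longrightarrow>
     fst ` set a \<subseteq> \<E>0 \<union> fst ` set b \<union> fst ` set c)"
    using local_thorn_sorts[OF f] by (rule exE)
  have E0: "finite \<E>0" "\<And>a b. a \<in> sol Meq m \<pi> c \<Longrightarrow> b \<in> sol Meq n \<delta> a \<Longrightarrow>
     fst ` set a \<subseteq> \<E>0 \<union> fst ` set b \<union> fst ` set c"
    using conjunct1[OF E0'] conjunct2[OF E0', rule_format, OF conjI[OF d(3) conjI[OF _ conjI[OF _ d(5)]]]]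
    by simp_all
  \<comment> \<open>This set bounds the sorts of all relevant parameters uniformly, since all
    elements of \<open>X\<close> have the same list of sorts \<open>ss\<close>.\<close>
  define \<E> where "\<E> = \<E>0 \<union> set ss \<union> fst ` set c"
  have E: "finite \<E>" using E0(1) by (simp add: \<E>_def)
  have cU: "set c \<subseteq> U" using d(3) by (auto simp: tuples_def)
  define D where "D = e \<union> set c"
  have D: "finite D" "D \<subseteq> U" using Suc.prems(3,4) cU by (auto simp: D_def)
  have smD: "small \<kappa> Meq D" by (rule sm_finite[OF D])
  have IH: "\<exists>b\<in>X \<inter> sol Meq n \<delta> a. \<alpha> \<le> dim e' (set b)"
    if "a \<in> I" "finite e'" "e' \<subseteq> U" for a e'
    by (rule Suc.IH) (use that Suc.prems(2) in \<open>auto simp: I_def\<close>)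
  \<comment> \<open>Parameters algebraic over \<open>D\<close> with sorts in \<open>\<E>\<close> are
    tuples from this finite set, so the infinite set \<open>I\<close> contains a tuple
    outside.\<close>
  define Y where "Y = (\<Union>s\<in>\<E>. {x \<in> cl D. fst x = s})"
  have "finite Y" unfolding Y_def using E finite_cl_sort[OF D] by blast
  then have finY: "finite {a. set a \<subseteq> Y \<and> length a = m}" by (rule finite_lists_length_eq)
  have "\<not> I \<subseteq> {a. set a \<subseteq> Y \<and> length a = m}" using d(4) finY finite_subset unfolding I_def by blast
  then obtain a where a: "a \<in> I" "\<not> (set a \<subseteq> Y \<and> length a = m)" by blast
  have at: "set a \<subseteq> U" "length a = m" "a \<in> sol Meq m \<pi> c" using a(1) by (auto simp: I_def sol_def tuples_def)
  obtain b where b: "b \<in> X" "b \<in> sol Meq n \<delta> a" "\<alpha> \<le> dim (D \<union> set a) (set b)"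
    using IH[OF a(1), of "D \<union> set a"] D at(1) by auto
  have bt: "b \<in> tuples Meq n" "map fst b = ss" using b(1) Suc.prems(2) by auto
  have bU: "set b \<subseteq> U" using bt(1) by (simp add: tuples_def)
  have "fst ` set b = set ss" using bt(2) by (metis set_map)
  then have "fst ` set a \<subseteq> \<E>" using E0(2)[OF at(3) b(2)] by (simp add: \<E>_def)
  then have nalg: "\<not> set a \<subseteq> cl D" using a(2) at(2) unfolding Y_def by auto
  have alg: "set a \<subseteq> cl (D \<union> set b)"
  proof (rule ccontr)
    assume na: "\<not> ?thesis"
    let ?T = "{a'. length a' = length a \<and> pe Leq Meq (set (zip a a') \<union> Id_on (D \<union> set b))}"
    have "infinite ?T"
      by (rule infinite_tuple_orbit[OF sm_Un_finite[OF smD _ bU] at(1) na]) simp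
    moreover have "finite ?T"
    proof (rule k_inconsistent_finite[OF d(5) bt(1)])
      have *: "a' \<in> sol Meq m \<pi> c \<and> holds Meq \<delta> (b @ a')" if "a' \<in> ?T" for a'
      proof -
        have l: "length a' = length a"
          and p: "pe Leq Meq (set (zip a a') \<union> Id_on (D \<union> set b))" using that by auto
        have "set a' \<subseteq> U" by (rule range_tuple[OF p _ l]) simp
        then have a't: "a' \<in> tuples Meq m" using l at(2) by (simp add: tuples_def)
        have "holds Meq \<delta> (b @ a) \<longleftrightarrow> holds Meq \<delta> (b @ a')"
          by (rule pe_holds[OF p])
            (use f(1) bt(1) at(2) l in \<open>auto simp: zip_same_conv_map tuples_def\<close>)
        moreover have "holds Meq \<pi> (a @ c) \<longleftrightarrow> holds Meq \<pi> (a' @ c)"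
          by (rule pe_holds[OF p])
            (use f(2) d(3) at(2) l zip_append_Id[of c "D \<union> set b" a a'] in \<open>auto simp: tuples_def D_def\<close>)
        ultimately show ?thesis using a't at(3) b(2) by (simp add: sol_def)
      qed
      then show "?T \<subseteq> sol Meq m \<pi> c" by blast
      show "holds Meq \<delta> (b @ a')" if "a' \<in> ?T" for a' using * that by blast
    qed
    ultimately show False by blast
  qed
  have "\<not> dim D (set b) \<le> dim (D \<union> set a) (set b)"
    using dim_drop[OF smD _ at(1) _ bU alg] nalg by auto
  moreover have "dim D (set b) \<le> dim e (set b)"
    by (rule dim_mono[OF smD _ _ bU]) (auto simp: D_def)
  ultimately have "Suc \<alpha> \<le> dim e (set b)" using b(3) by simp
  then show ?case using b(1) by blast
qed

text \<open>The formula \<open>\<theta>\<close> fixing the sorts of the tuple already has bounded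
  local rank, because the dimension is bounded on tuples with these sorts.\<close>

lemma rosy_eq: "rosy \<kappa> Leq Meq"
  unfolding rosy_def
proof (intro allI impI, elim conjE)
  fix as A m l \<Delta> \<Pi> k
  assume as: "set as \<subseteq> U" and \<Delta>: "\<forall>\<delta>\<in>\<Delta>. form Leq (length as + m) \<delta>"
    and \<Pi>: "\<forall>\<pi>\<in>\<Pi>. form Leq (m + l) \<pi>"
  obtain \<theta> where \<theta>: "form Leq (length as) \<theta>"
    "\<And>bs. bs \<in> tuples Meq (length as) \<Longrightarrow> holds Meq \<theta> bs \<longleftrightarrow> map fst bs = map fst as"
    using sort_tuple_formula[OF as] by blast
  obtain N where N: "\<And>bs. set bs \<subseteq> U \<Longrightarrow> map fst bs = map fst as \<Longrightarrow> dim {} (set bs) \<le> N"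
    using dim_sorts_bounded[of "map fst as"] by blast
  have sub: "sol Meq (length as) \<theta> [] \<subseteq> {b \<in> tuples Meq (length as). map fst b = map fst as}"
    using \<theta>(2) by (auto simp: sol_def)
  have "\<not> local_thorn_ge Meq (length as) m l \<Delta> \<Pi> k (Suc N) (sol Meq (length as) \<theta> [])"
  proof
    assume "local_thorn_ge Meq (length as) m l \<Delta> \<Pi> k (Suc N) (sol Meq (length as) \<theta> [])"
    then obtain b where b: "b \<in> sol Meq (length as) \<theta> []" "Suc N \<le> dim {} (set b)"
      using local_thorn_dim[OF \<Delta> \<Pi> _ sub, of k "Suc N" "{}"] by blast
    then have "set b \<subseteq> U" "map fst b = map fst as" using sub by (auto simp: tuples_def)
    then show False using N[of b] b(2) by simp
  qed
  moreover have "holds Meq \<theta> as" using \<theta>(2) as by (simp add: tuples_def)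
  ultimately show "\<exists>\<theta> ds N. set ds \<subseteq> A \<and> form Leq (length as + length ds) \<theta> \<and> holds Meq \<theta> (as @ ds) \<and>
      \<not> local_thorn_ge Meq (length as) m l \<Delta> \<Pi> k N (sol Meq (length as) \<theta> ds)"
    using \<theta>(1) by (intro exI[of _ \<theta>] exI[of _ "[]"] exI[of _ "Suc N"]) simp
qed

section \<open>Superrosiness and finite rank\<close>

lemma superrosy_eq: "superrosy \<kappa> L M"
  unfolding superrosy_def superrosy_in_def
proof (intro conjI allI impI rosy_eq)
  fix as A assume h: "set as \<subseteq> U \<and> small \<kappa> Meq A"
  \<comment> \<open>Lists of different lengths give an injection of the natural numbers into the
    type of pairs.\<close>
  define f :: "nat \<Rightarrow> 'a imag list \<times> 'a imag set" where "f n = (replicate n undefined, {})" for n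
  have inj: "inj f" unfolding f_def by (rule injI) (drule arg_cong[where f = "\<lambda>p. length (fst p)"], simp)
  let ?r = "dir_image natLeq f"
  let ?n = "Suc (dim A (set as))"
  have "\<not> U_thorn_ge \<kappa> Leq Meq ?r (f ?n) as A"
  proof
    let ?G = "\<lambda>m. rank_ge ?r (thorn_ext \<kappa> Leq Meq) (f m)"
    assume u: "U_thorn_ge \<kappa> Leq Meq ?r (f ?n) as A"
    have st: "\<exists>y. thorn_ext \<kappa> Leq Meq x y \<and> ?G m y" if "?G (Suc m) x" for m x
      using that by (rule well_order_nat(3)[OF inj])
    have "?n \<le> dim A (set as)"
      by (rule thorn_rank_le_dim[of ?G, OF st u[unfolded U_thorn_ge_def]]) (use h in auto)
    then show False by simp
  qed
  then show "\<exists>(r :: ('a imag list \<times> 'a imag set) rel) \<alpha>. Well_order r \<and> \<alpha> \<in> Field r \<and>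
      \<not> U_thorn_ge \<kappa> Leq Meq r \<alpha> as A"
    using well_order_nat(1,2)[OF inj] by blast
qed

lemma finite_U_thorn_eq: "finite_U_thorn \<kappa> L M"
  unfolding finite_U_thorn_def
proof (intro conjI allI impI)
  fix as A assume h: "set as \<subseteq> U \<and> small \<kappa> Meq A"
  have "\<not> U_thorn_ge \<kappa> Leq Meq natLeq (Suc (dim A (set as))) as A"
    using U_thorn_le_dim[of "Suc (dim A (set as))" as A] h by (meson not_less_eq_eq order_refl)
  then show "\<exists>n. \<not> U_thorn_ge \<kappa> Leq Meq natLeq n as A" by blast
next
  \<comment> \<open>The bound has to be uniform in \<open>A\<close>, so it is taken over the empty
    base, where the dimension is largest.\<close>
  obtain N where N: "\<And>x. x \<in> U \<Longrightarrow> fst x = h \<Longrightarrow> dim {} {x} \<le> N"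
    using dim_sort_bounded[of h] by blast
  have "\<not> U_thorn_ge \<kappa> Leq Meq natLeq (Suc N) [a] A" if a: "a \<in> home M" and A: "small \<kappa> Meq A" for a A
  proof
    assume u: "U_thorn_ge \<kappa> Leq Meq natLeq (Suc N) [a] A"
    have aU: "a \<in> U" "fst a = h" using a by (auto simp: home_eq)
    then have "Suc N \<le> dim A {a}" using U_thorn_le_dim[OF u _ A] by simp
    also have "\<dots> \<le> dim {} {a}" by (rule dim_mono[OF A]) (use aU in auto)
    also have "\<dots> \<le> N" using N aU by blast
    finally show False by simp
  qed
  then show "\<exists>n. \<forall>a\<in>home M. \<forall>A. small \<kappa> Meq A \<longrightarrow> \<not> U_thorn_ge \<kappa> Leq Meq natLeq n [a] A"
    by blast
qed

end

theorem theorem6p14: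
  fixes L :: "('f, 'r) lang"
    and T :: "('f, 'r) fm set"
    and M :: "('f, 'r, 'a) struct"
    and \<kappa> :: "'k rel"
  assumes "countable_lang L"
    and "complete_theory L T"
    and "omega_categorical L T"
    and "Card_order \<kappa>" and "natLeq <o \<kappa>"
    and "models L M T"
    and "saturated \<kappa> L M"
    and "soft_elim_imag L M"
    and "exchange0 \<kappa> L M"
  shows "superrosy \<kappa> L M \<and> finite_U_thorn \<kappa> L M"
proof -
  interpret soft_exchange_model L M \<kappa>
  proof
    show "is_struct L M" using assms(6) by (simp add: models_def)
    show "\<exists>R. finite R \<and> R \<subseteq> tuples M n \<and> (\<forall>x\<in>tuples M n. \<exists>r\<in>R. same_type L M {} x r)" for n
      by (rule ryll_nardzewski[OF assms(1,2,3,5,6,7)])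
  qed (fact assms)+
  show ?thesis using superrosy_eq finite_U_thorn_eq by blast
qed

end
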